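(* There is an odd unimodular lattice $L$ in dimension $36$ with minimum norm $\min(L)=4$, kissing number $42840$ and $\sigma(L)=12$, whose automorphism group has order $849346560$.
   Context: A (Euclidean) lattice $L \subset \mathbb{R}^n$ in dimension $n$ (i.e. of full rank $n$) is unimodular if $L=L^*$, where $L^*=\{x\in\mathbb{R}^n \mid (x,y)\in\mathbb{Z}\text{ for all }y\in L\}$ and $(x,y)$ is the standard inner product. The norm of a vector $x$ is $(x,x)$ (the squared length), and the minimum norm $\min(L)$ is the smallest norm of a nonzero vector of $L$. The kissing number of $L$ is the number of vectors of $L$ of norm $\min(L)$. The automorphism group of $L$ is the group of all orthogonal $n\times n$ matrices $A$ with $L\cdot A=\{xA\mid x\in L\}=L$. A unimodular lattice is even if all its vectors have even norm, and odd otherwise. For an odd unimodular lattice $L$, the even sublattice is $L_0=\{x\in L\mid (x,x)\in 2\mathbb{Z}\}$, the shadow is $S(L)=L_0^*\setminus L$, and $\sigma(L)=4\min(S(L))$, where $\min(S(L))$ is the minimum norm of a vector in $S(L)$. *)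

theory Defs
  imports "HOL-Analysis.Analysis"
begin

definition is_lattice :: "(real ^ 'n) set \<Rightarrow> bool" where
  "is_lattice L \<longleftrightarrow>
    (\<exists>B. independent B \<and> span B = UNIV \<and>
      L = {\<Sum>b\<in>B. of_int (c b) *\<^sub>R b | c :: real ^ 'n \<Rightarrow> int. True})"

definition dual_lattice :: "(real ^ 'n) set \<Rightarrow> (real ^ 'n) set" where
  "dual_lattice L = {x. \<forall>y\<in>L. x \<bullet> y \<in> \<int>}"

definition unimodular :: "(real ^ 'n) set \<Rightarrow> bool" where
  "unimodular L \<longleftrightarrow> is_lattice L \<and> L = dual_lattice L"

(* "norm" below is the squared length x \<bullet> x, not the library's norm x.
   The predicate "even" is vacuous on the reals, so evenness is stated with an integer witness. *)

definition even_norm :: "real ^ 'n \<Rightarrow> bool" where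
  "even_norm x \<longleftrightarrow> (\<exists>k :: int. x \<bullet> x = 2 * of_int k)"

definition even_unimodular :: "(real ^ 'n) set \<Rightarrow> bool" where
  "even_unimodular L \<longleftrightarrow> unimodular L \<and> (\<forall>x\<in>L. even_norm x)"

definition odd_unimodular :: "(real ^ 'n) set \<Rightarrow> bool" where
  "odd_unimodular L \<longleftrightarrow> unimodular L \<and> \<not> even_unimodular L"

(* LEAST rather than Inf: the minimum has to be attained for a value to be provable. *)
definition least_norm :: "(real ^ 'n) set \<Rightarrow> real" where
  "least_norm S = (LEAST r. \<exists>x\<in>S. r = x \<bullet> x)"

definition min_norm :: "(real ^ 'n) set \<Rightarrow> real" where
  "min_norm L = least_norm (L - {0})"

definition kissing_number :: "(real ^ 'n) set \<Rightarrow> nat" where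
  "kissing_number L = card {x \<in> L. x \<bullet> x = min_norm L}"

definition even_sublattice :: "(real ^ 'n) set \<Rightarrow> (real ^ 'n) set" where
  "even_sublattice L = {x \<in> L. even_norm x}"

definition lattice_shadow :: "(real ^ 'n) set \<Rightarrow> (real ^ 'n) set" where
  "lattice_shadow L = dual_lattice (even_sublattice L) - L"

definition lattice_sigma :: "(real ^ 'n) set \<Rightarrow> real" where
  "lattice_sigma L = 4 * least_norm (lattice_shadow L)"

definition lattice_aut :: "(real ^ 'n) set \<Rightarrow> (real ^ 'n ^ 'n) set" where
  "lattice_aut L = {A. orthogonal_matrix A \<and> (\<lambda>x. x v* A) ` L = L}"

end

theory Submission
  imports Defs
begin

text \<open>Index the coordinates by the 36 positive roots \<open>v\<close> of \<open>E\<^sub>6\<close>. The lattice is \<open>A\<^sub>4(C)\<close>, the set of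
  all \<open>x/2\<close> with \<open>x\<close> modulo 4 in a self-dual code \<open>C\<close> over the integers modulo 4: modulo 2 the vector
  \<open>x\<close> is an affine function \<open>v \<mapsto> a(v) + t\<close>, and modulo 4 it is orthogonal to the linear functions
  and to the all-one vector. Self-duality holds because the second moments of the roots are divisible by 4.
  The residue code is a [36,7,16] code with 27 linear words of weight 16, so the vectors
  of norm 4 are \<open>72\<close> frame vectors \<open>\<plusminus>2e\<^sub>v\<close>, \<open>945 * 2^4\<close> vectors supported by four
  roots with even sum, and \<open>27 * 2^10\<close> vectors over the words of weight 16. The norm of \<open>x/2\<close> has
  the parity of \<open>t\<close>, which identifies the shadow; its vectors of norm 3 are \<open>\<plusminus>e\<^sub>u \<plusminus> e\<^sub>v \<plusminus> e\<^sub>w\<close>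
  with \<open>u + v + w\<close> even.

  The frame vectors are the vectors of norm 4 that have even inner product with every shadow vector of
  norm 3, so every automorphism is a signed permutation, and its permutation preserves the triples
  of roots with even sum. Products of two reflections act transitively along a flag of four roots
  with orbits of length 36, 15, 8 and 6. What fixes the flag permutes the roots trivially or like one reflection, and
  the latter is excluded by a parity argument. The remaining sign changes are the sets of roots
  orthogonal to all products of two linear functions; there are \<open>2^(36 - 21)\<close> of them.\<close>

text \<open>Modulo 2 the root lattice is a six-dimensional quadratic space of elliptic type: the 36
  roots are its nonsingular vectors, and its 27 nonzero singular vectors give, by the inner product,
  the words of weight 16. A triple of roots with even sum is, up to signs, the positive system of an
  \<open>A\<^sub>2\<close>, so the triples record orthogonality of roots. The second moments form 12
  times the inverse Cartan matrix, 12 being the Coxeter number. First moments depend on signs: the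
  half-sum of the positive roots, (8,15,21,15,8,11), is congruent modulo 2 to (0,1,1,1,0,1), so
  reversing that one root makes the total divisible by 4. A single reflection preserves the even
  sublattice but moves the odd vectors of the lattice into the shadow. Hence the Weyl group of order
  51840 contributes only its rotation subgroup, of order 25920 = 36 * 15 * 8 * 6. The delicate half
  is the upper bound: an automorphism is an arbitrary orthogonal matrix, so the coordinate frame has
  to be recovered from inner products alone.\<close>

section \<open>Full-rank lattices from groups of half-integral vectors\<close>

lemma int_scale_closed:
  fixes L :: "'a::real_vector set"
  assumes zero: "0 \<in> L" and diff: "\<And>x y. x \<in> L \<Longrightarrow> y \<in> L \<Longrightarrow> x - y \<in> L" and x: "x \<in> L"
  shows "of_int c *\<^sub>R x \<in> L"
proof -
  have neg: "- y \<in> L" if "y \<in> L" for y using diff[OF zero that] by simp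
  have add: "y + z \<in> L" if "y \<in> L" "z \<in> L" for y z using diff[OF that(1) neg[OF that(2)]] by simp
  have nat: "of_nat n *\<^sub>R x \<in> L" for n
    by (induction n) (use zero add[OF x] in \<open>auto simp: scaleR_left_distrib\<close>)
  show ?thesis
  proof (cases "c \<ge> 0")
    case True
    then show ?thesis using nat[of "nat c"] by simp
  next
    case False
    then have "of_int c *\<^sub>R x = - (of_nat (nat (- c)) *\<^sub>R x)" by simp
    then show ?thesis using neg[OF nat[of "nat (- c)"]] by simp
  qed
qed

text \<open>The basis is triangular: its vector for the coordinate \<open>i\<close> vanishes on all earlier
  coordinates and has the least positive \<open>i\<close>-th coordinate among such vectors of \<open>L\<close>.\<close>

lemma is_lattice_half_integral:
  fixes L :: "(real ^ 'n) set"
  assumes zero: "0 \<in> L" and diff: "\<And>x y. x \<in> L \<Longrightarrow> y \<in> L \<Longrightarrow> x - y \<in> L"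
    and ax: "\<And>i. axis i 2 \<in> L"
    and half: "\<And>x i. x \<in> L \<Longrightarrow> \<exists>k::int. 2 * x $ i = of_int k"
  shows "is_lattice L"
proof -
  define n where "n = CARD('n)"
  obtain f :: "'n \<Rightarrow> nat" where f: "bij_betw f UNIV {0..<n}"
    using ex_bij_betw_finite_nat[of "UNIV :: 'n set"] unfolding n_def by auto
  have finj: "f i = f j \<longleftrightarrow> i = j" for i j using f by (auto simp: bij_betw_def inj_on_def)
  have flt: "f i < n" for i using f by (auto simp: bij_betw_def)
  define T where "T k = {x \<in> L. \<forall>i. f i < k \<longrightarrow> x $ i = 0}" for k
  have Tdiff: "x - of_int q *\<^sub>R y \<in> T k" if "x \<in> T k" "y \<in> T k" for x y q k
    using that diff int_scale_closed[OF zero diff, of y q] by (auto simp: T_def)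
  define P where "P i m \<longleftrightarrow> m > 0 \<and> (\<exists>x\<in>T (f i). 2 * x $ i = real m)" for i and m :: nat
  define d where "d i = (LEAST m. P i m)" for i
  \<comment> \<open>The vector with single entry 2 doubles to 4 at coordinate \<open>i\<close>, so a
    least positive value exists.\<close>
  have "P i 4" for i
    unfolding P_def T_def using ax[of i] by (auto intro!: bexI[of _ "axis i 2"] simp: axis_def finj)
  then have Pd: "P i (d i)" for i unfolding d_def by (rule LeastI)
  have "\<exists>x. x \<in> T (f i) \<and> 2 * x $ i = real (d i)" for i using Pd[of i] unfolding P_def by auto
  then obtain b where b: "\<And>i. b i \<in> T (f i)" "\<And>i. 2 * b i $ i = real (d i)" by metis
  have dpos: "d i > 0" for i using Pd[of i] by (simp add: P_def)
  have reduce: "\<exists>q. x - of_int q *\<^sub>R b i \<in> T (Suc (f i))" if x: "x \<in> T (f i)" for x i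
  proof -
    obtain p :: int where p: "2 * x $ i = of_int p" using half[of x i] x by (auto simp: T_def)
    define q where "q = p div int (d i)"
    define y where "y = x - of_int q *\<^sub>R b i"
    have y: "y \<in> T (f i)" unfolding y_def using Tdiff[OF x b(1)] .
    have "2 * y $ i = 2 * x $ i - of_int q * (2 * b i $ i)" by (simp add: y_def algebra_simps)
    also have "\<dots> = of_int (p - q * int (d i))" using p b(2) by simp
    also have "p - q * int (d i) = p mod int (d i)" by (simp add: q_def minus_div_mult_eq_mod)
    finally have yi: "2 * y $ i = of_int (p mod int (d i))" .
    have "p mod int (d i) = 0"
    proof (rule ccontr)
      assume ne: "p mod int (d i) \<noteq> 0"
      define m where "m = nat (p mod int (d i))"
      have m: "m > 0" "int m = p mod int (d i)"
        using ne pos_mod_sign[of "int (d i)" p] dpos[of i] unfolding m_def by linarith+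
      then have "P i m" using y yi unfolding P_def by (metis of_int_of_nat_eq)
      moreover have "m < d i" using m(2) dpos[of i] by (metis of_nat_0_less_iff of_nat_less_iff pos_mod_bound)
      ultimately show False unfolding d_def using not_less_Least by blast
    qed
    then have "y $ i = 0" using yi by simp
    then have "y \<in> T (Suc (f i))" using y by (auto simp: T_def less_Suc_eq finj)
    then show ?thesis unfolding y_def by blast
  qed
  have repr: "\<exists>c :: 'n \<Rightarrow> int. x = (\<Sum>i\<in>UNIV. of_int (c i) *\<^sub>R b i)" if "k \<le> n" "x \<in> T k" for k x
    using that
  \<comment> \<open>Downward induction from \<open>n\<close>, where every coordinate vanishes; each
    step uses the basis vector of the coordinate numbered \<open>k\<close> to clear it.\<close>
  proof (induction k arbitrary: x rule: inc_induct)
    case base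
    then have "x = 0" using flt by (auto simp: T_def vec_eq_iff)
    then show ?case by (intro exI[of _ "\<lambda>_. 0"]) simp
  next
    case (step k)
    have "k \<in> range f" using f step.hyps(2) unfolding bij_betw_def by simp
    then obtain i where i: "f i = k" by blast
    obtain q where "x - of_int q *\<^sub>R b i \<in> T (Suc k)" using reduce[of x i] step.prems i by blast
    then obtain c :: "'n \<Rightarrow> int" where c: "x - of_int q *\<^sub>R b i = (\<Sum>i\<in>UNIV. of_int (c i) *\<^sub>R b i)"
      using step.IH by blast
    have "(\<Sum>j\<in>UNIV. of_int (c j + (if j = i then q else 0)) *\<^sub>R b j)
        = (\<Sum>j\<in>UNIV. of_int (c j) *\<^sub>R b j) + (\<Sum>j\<in>UNIV. if j = i then of_int q *\<^sub>R b i else 0)"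
      unfolding sum.distrib[symmetric] by (rule sum.cong) (auto simp: algebra_simps)
    then have "x = (\<Sum>j\<in>UNIV. of_int (c j + (if j = i then q else 0)) *\<^sub>R b j)"
      by (simp add: c[symmetric])
    then show ?case by (intro exI)
  qed
  have indep: "c i = 0" if "(\<Sum>i\<in>UNIV. c i *\<^sub>R b i) = 0" for c :: "'n \<Rightarrow> real" and i
  proof (induction "f i" arbitrary: i rule: less_induct)
    case less
    have z: "c j * b j $ i = (if j = i then c i * b i $ i else 0)" for j
    proof (cases "f j < f i")
      case True then show ?thesis using less[OF True] by auto
    next
      case False
      then have "j = i \<or> f i < f j" using finj[of i j] by auto
      then show ?thesis using b(1)[of j] by (auto simp: T_def)
    qed
    have "0 = (\<Sum>j\<in>UNIV. c j *\<^sub>R b j) $ i" using that by simp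
    also have "\<dots> = (\<Sum>j\<in>UNIV. c j * b j $ i)" by simp
    also have "\<dots> = c i * b i $ i" by (subst z) simp
    finally show "c i = 0" using b(2)[of i] dpos[of i] by auto
  qed
  have binj: "inj b"
  proof (rule injI, rule ccontr)
    fix i j assume *: "b i = b j" "i \<noteq> j"
    have "(\<Sum>l\<in>UNIV. (if l = i then 1 else if l = j then -1 else 0) *\<^sub>R b l)
        = (\<Sum>l\<in>UNIV. (if l = i then b i else 0) + (if l = j then - b j else 0))"
      by (rule sum.cong) (use * in auto)
    also have "\<dots> = 0" using * by (simp add: sum.distrib)
    finally show False using indep[of "\<lambda>l. if l = i then 1 else if l = j then -1 else 0" i] by simp
  qed
  define B where "B = range b"
  have sumB: "(\<Sum>v\<in>B. g v *\<^sub>R v) = (\<Sum>i\<in>UNIV. g (b i) *\<^sub>R b i)" for g :: "_ \<Rightarrow> real"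
    unfolding B_def by (rule sum.reindex[OF binj, unfolded o_def])
  have ind: "independent B"
  proof (rule independent_if_scalars_zero)
    show "finite B" by (simp add: B_def)
    fix g x assume g: "(\<Sum>v\<in>B. g v *\<^sub>R v) = 0" and "x \<in> B"
    then obtain i where "x = b i" by (auto simp: B_def)
    then show "g x = 0" using indep[of "g \<circ> b" i] g sumB[of g] by simp
  qed
  have "card B = dim (UNIV :: (real ^ 'n) set)"
    unfolding B_def by (simp add: card_image[OF binj])
  then have sp: "span B = UNIV"
    using ind card_ge_dim_independent[of B UNIV] by auto
  have "L = {\<Sum>v\<in>B. of_int (c v) *\<^sub>R v | c :: real ^ 'n \<Rightarrow> int. True}" (is "_ = ?R")
  proof
    show "L \<subseteq> ?R"
    proof
      fix x assume "x \<in> L"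
      then have "x \<in> T 0" by (simp add: T_def)
      then obtain c :: "'n \<Rightarrow> int" where c: "x = (\<Sum>i\<in>UNIV. of_int (c i) *\<^sub>R b i)" using repr by blast
      then have "x = (\<Sum>v\<in>B. of_int (c (inv b v)) *\<^sub>R v)"
        using sumB[of "\<lambda>v. of_int (c (inv b v))"] by (simp add: inv_f_f[OF binj])
      then show "x \<in> ?R" by (intro CollectI exI[of _ "\<lambda>v. c (inv b v)"] conjI TrueI)
    qed
    have neg: "- y \<in> L" if "y \<in> L" for y using diff[OF zero that] by simp
    have add: "y + z \<in> L" if "y \<in> L" "z \<in> L" for y z using diff[OF that(1) neg[OF that(2)]] by simp
    have "(\<Sum>v\<in>C. of_int (c v) *\<^sub>R v) \<in> L" if "finite C" "C \<subseteq> B" for c :: "_ \<Rightarrow> int" and C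
      using that
    proof (induction C)
      case empty then show ?case by (simp add: zero)
    next
      case (insert v C)
      then have "v \<in> L" using b(1) by (auto simp: B_def T_def)
      then have "of_int (c v) *\<^sub>R v \<in> L" using int_scale_closed[OF zero diff] by blast
      then show ?case using insert add by simp
    qed
    moreover have "finite B" by (simp add: B_def)
    ultimately show "?R \<subseteq> L" by auto
  qed
  then show ?thesis unfolding is_lattice_def using ind sp by blast
qed

section \<open>Counting kernels over two elements and fibres of group actions\<close>

text \<open>Orthogonality of characters: adjoining \<open>j\<close> multiplies the sum by 2 if
  \<open>f j\<close> is even and by 0 otherwise.\<close>

lemma sum_Pow_sign:
  fixes f :: "'a \<Rightarrow> int"
  assumes "finite J"
  shows "(\<Sum>c\<in>Pow J. if even (sum f c) then 1 else - 1 :: int)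
    = (if \<forall>j\<in>J. even (f j) then 2 ^ card J else 0)"
  using assms
proof (induction J)
  case empty
  then show ?case by simp
next
  case (insert j J)
  let ?s = "\<lambda>c. if even (sum f c) then 1 else - 1 :: int"
  have inj: "inj_on (insert j) (Pow J)" using insert.hyps by (auto simp: inj_on_def)
  have "(\<Sum>c\<in>Pow (insert j J). ?s c) = (\<Sum>c\<in>Pow J. ?s c) + (\<Sum>c\<in>insert j ` Pow J. ?s c)"
    unfolding Pow_insert using insert.hyps by (subst sum.union_disjoint) auto
  also have "(\<Sum>c\<in>insert j ` Pow J. ?s c) = (\<Sum>c\<in>Pow J. ?s (insert j c))"
    by (simp add: sum.reindex[OF inj])
  also have "\<dots> = (\<Sum>c\<in>Pow J. (if even (f j) then 1 else - 1) * ?s c)"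
  proof (rule sum.cong)
    fix c assume "c \<in> Pow J"
    then have "j \<notin> c" "finite c" using insert.hyps by (auto intro: finite_subset)
    then show "?s (insert j c) = (if even (f j) then 1 else - 1) * ?s c" by simp
  qed simp
  also have "\<dots> = (if even (f j) then 1 else - 1) * (\<Sum>c\<in>Pow J. ?s c)"
    by (simp add: sum_distrib_left)
  finally show ?case using insert by auto
qed

text \<open>Rank-nullity over the field with two elements, by a double character sum.\<close>

lemma card_F2_kernel:
  fixes A :: "'j \<Rightarrow> 's \<Rightarrow> int"
  assumes "finite S" "finite J"
  shows "card {N \<in> Pow S. \<forall>j\<in>J. even (\<Sum>i\<in>N. A j i)} * 2 ^ card J
    = card {c \<in> Pow J. \<forall>i\<in>S. even (\<Sum>j\<in>c. A j i)} * 2 ^ card S"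
proof -
  let ?e = "\<lambda>n::int. if even n then 1 else - 1 :: int"
  let ?N = "{N \<in> Pow S. \<forall>j\<in>J. even (\<Sum>i\<in>N. A j i)}"
  let ?C = "{c \<in> Pow J. \<forall>i\<in>S. even (\<Sum>j\<in>c. A j i)}"
  have "(\<Sum>N\<in>Pow S. \<Sum>c\<in>Pow J. ?e (\<Sum>j\<in>c. \<Sum>i\<in>N. A j i))
      = (\<Sum>N\<in>Pow S. if \<forall>j\<in>J. even (\<Sum>i\<in>N. A j i) then 2 ^ card J else 0)"
    by (simp add: sum_Pow_sign[OF assms(2)])
  also have "\<dots> = int (card ?N * 2 ^ card J)"
    using assms(1) by (simp add: sum.If_cases Int_def)
  finally have 1: "(\<Sum>N\<in>Pow S. \<Sum>c\<in>Pow J. ?e (\<Sum>j\<in>c. \<Sum>i\<in>N. A j i)) = int (card ?N * 2 ^ card J)" .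
  have "(\<Sum>N\<in>Pow S. \<Sum>c\<in>Pow J. ?e (\<Sum>j\<in>c. \<Sum>i\<in>N. A j i))
      = (\<Sum>c\<in>Pow J. \<Sum>N\<in>Pow S. ?e (\<Sum>j\<in>c. \<Sum>i\<in>N. A j i))"
    by (rule sum.swap)
  also have "\<dots> = (\<Sum>c\<in>Pow J. \<Sum>N\<in>Pow S. ?e (\<Sum>i\<in>N. \<Sum>j\<in>c. A j i))"
  proof (intro sum.cong refl)
    fix c N
    have "(\<Sum>j\<in>c. \<Sum>i\<in>N. A j i) = (\<Sum>i\<in>N. \<Sum>j\<in>c. A j i)" by (rule sum.swap)
    then show "?e (\<Sum>j\<in>c. \<Sum>i\<in>N. A j i) = ?e (\<Sum>i\<in>N. \<Sum>j\<in>c. A j i)" by (rule arg_cong)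
  qed
  also have "\<dots> = (\<Sum>c\<in>Pow J. if \<forall>i\<in>S. even (\<Sum>j\<in>c. A j i) then 2 ^ card S else 0)"
    by (simp add: sum_Pow_sign[OF assms(1)])
  also have "\<dots> = int (card ?C * 2 ^ card S)"
    using assms(2) by (simp add: sum.If_cases Int_def)
  finally have "int (card ?N * 2 ^ card J) = int (card ?C * 2 ^ card S)" unfolding 1 .
  then show ?thesis by (simp only: of_nat_eq_iff)
qed

text \<open>The orbit-stabiliser count, with translation by a group element abstracted to a
  bijection between fibres.\<close>

lemma card_transport:
  fixes f :: "'a \<Rightarrow> 'b"
  assumes O: "finite O'" and im: "\<And>g. g \<in> G \<Longrightarrow> f g \<in> O'"
    and tr: "\<And>y. y \<in> O' \<Longrightarrow> \<exists>\<phi>. bij_betw \<phi> {g \<in> G. f g = b} {g \<in> G. f g = y}"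
    and st: "finite {g \<in> G. f g = b}"
  shows "finite G" "card G = card O' * card {g \<in> G. f g = b}"
proof -
  have G: "G = (\<Union>y\<in>O'. {g \<in> G. f g = y})" using im by auto
  have fin: "finite {g \<in> G. f g = y}" if "y \<in> O'" for y
    using tr[OF that] st bij_betw_finite by blast
  have "finite (\<Union>y\<in>O'. {g \<in> G. f g = y})" using O fin by blast
  then show "finite G" using G by metis
  have "card (\<Union>y\<in>O'. {g \<in> G. f g = y}) = (\<Sum>y\<in>O'. card {g \<in> G. f g = y})"
    by (rule card_UN_disjoint) (use O fin in auto)
  also have "\<dots> = (\<Sum>y\<in>O'. card {g \<in> G. f g = b})"
  proof (rule sum.cong)
    fix y assume "y \<in> O'"
    then obtain \<phi> where "bij_betw \<phi> {g \<in> G. f g = b} {g \<in> G. f g = y}" using tr by blast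
    then show "card {g \<in> G. f g = y} = card {g \<in> G. f g = b}" by (simp add: bij_betw_same_card)
  qed simp
  finally show "card G = card O' * card {g \<in> G. f g = b}" using G by simp
qed

section \<open>Root data and executable operations on roots\<close>

text \<open>The positive roots of \<open>E\<^sub>6\<close> in simple-root coordinates (\<open>E6_form\<close> below gives the
  numbering of the Dynkin diagram), except that the root \<open>(0,1,1,1,0,1)\<close> is negated: this makes
  the sum of all 36 vectors divisible by 4.\<close>

definition root_list :: "int list list" where
  "root_list =
    [[1,0,0,0,0,0], [0,1,0,0,0,0], [0,0,1,0,0,0], [0,0,0,1,0,0],
     [0,0,0,0,1,0], [0,0,0,0,0,1], [1,1,0,0,0,0], [0,1,1,0,0,0],
     [0,0,1,1,0,0], [0,0,1,0,0,1], [0,0,0,1,1,0], [1,1,1,0,0,0],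
     [0,1,1,1,0,0], [0,1,1,0,0,1], [0,0,1,1,1,0], [0,0,1,1,0,1],
     [1,1,1,1,0,0], [1,1,1,0,0,1], [0,1,1,1,1,0], [0,-1,-1,-1,0,-1],
     [0,0,1,1,1,1], [1,1,1,1,1,0], [1,1,1,1,0,1], [0,1,1,1,1,1],
     [0,1,2,1,0,1], [1,1,1,1,1,1], [1,1,2,1,0,1], [0,1,2,1,1,1],
     [1,1,2,1,1,1], [1,2,2,1,0,1], [0,1,2,2,1,1], [1,2,2,1,1,1],
     [1,1,2,2,1,1], [1,2,2,2,1,1], [1,2,3,2,1,1], [1,2,3,2,1,2]]"

text \<open>The weights of the 27-dimensional representation up to sign, as linear forms on the root
  lattice. They represent the codewords of weight 16 and take only the values \<open>-1, 0, 1\<close> on roots.\<close>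

definition minuscule_list :: "int list list" where
  "minuscule_list =
    [[0,0,0,0,-1,1], [0,0,0,0,-1,0], [0,0,0,-1,1,1], [0,0,0,-1,1,0],
     [0,0,0,-1,0,1], [0,0,-1,1,0,1], [0,0,-1,1,0,0], [0,0,-1,1,-1,1],
     [0,0,-1,0,1,1], [0,-1,1,0,0,0], [0,-1,1,0,0,-1], [0,-1,1,0,-1,0],
     [0,-1,1,-1,1,0], [0,-1,0,1,0,0], [0,-1,0,0,0,1], [-1,1,0,0,0,0],
     [-1,1,0,0,0,-1], [-1,1,0,0,-1,0], [-1,1,0,-1,1,0], [-1,1,-1,1,0,0],
     [-1,1,-1,0,0,1], [-1,0,1,0,0,-1], [-1,0,1,-1,0,0], [-1,0,0,1,-1,0],
     [-1,0,0,0,1,0], [-1,0,0,0,0,1], [-1,0,0,0,0,0]]"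

definition roots :: "int list set" where
  "roots = set root_list"

definition lin :: "(nat \<Rightarrow> int) \<Rightarrow> int list \<Rightarrow> int" where
  "lin a v = (\<Sum>j<6. a j * v ! j)"

definition dotl :: "int list \<Rightarrow> int list \<Rightarrow> int" where
  "dotl u v = sum_list (map2 (*) u v)"

text \<open>The Cartan matrix applied to \<open>v\<close>, for the diagram with chain 0-1-2-3-4 and
  node 5 attached to node 2. Pairing the result with a second vector by \<open>dotl\<close> gives
  the invariant inner product.\<close>

definition E6_form :: "int list \<Rightarrow> int list" where
  "E6_form v = (case v of [a, b, c, d, e, f] \<Rightarrow>
     [2*a - b, 2*b - a - c, 2*c - b - d - f, 2*d - c - e, 2*e - d, 2*f - c] | _ \<Rightarrow> [])"

definition weyl :: "int list \<Rightarrow> int list \<Rightarrow> int list" where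
  "weyl r v = (let c = dotl (E6_form r) v in map2 (\<lambda>x y. x - c * y) v r)"

text \<open>A reflection permutes the 36 pairs of opposite roots. \<open>rperm\<close> is this
  permutation on the listed representatives, and \<open>rsign\<close> is the sign that returns from
  the representative to the true image.\<close>

definition rsign :: "int list \<Rightarrow> int list \<Rightarrow> int" where
  "rsign r v = (if weyl r v \<in> set root_list then 1 else - 1)"

definition rperm :: "int list \<Rightarrow> int list \<Rightarrow> int list" where
  "rperm r v = (let u = weyl r v in if u \<in> set root_list then u else map uminus u)"

definition even3 :: "int list \<Rightarrow> int list \<Rightarrow> int list \<Rightarrow> bool" where
  "even3 u v w = list_all even (map2 (+) u (map2 (+) v w))"

lemma root_list_distinct: "distinct root_list" by code_simp

lemma root_list_length: "length root_list = 36" by code_simp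

lemma card_roots: "card roots = 36"
  by (simp add: roots_def distinct_card root_list_distinct root_list_length)

lemma finite_roots [simp]: "finite roots" by (simp add: roots_def)

lemma list_all_rootsD: "list_all P root_list \<Longrightarrow> v \<in> roots \<Longrightarrow> P v"
  by (simp add: list_all_iff roots_def)

lemma length_root: "v \<in> roots \<Longrightarrow> length v = 6"
proof -
  have "list_all (\<lambda>v. length v = 6) root_list" by code_simp
  then show "v \<in> roots \<Longrightarrow> length v = 6" by (rule list_all_rootsD)
qed

lemma sum_roots: "sum f roots = sum_list (map f root_list)"
  by (simp add: roots_def sum_list_distinct_conv_sum_set root_list_distinct)

lemma card_roots_filter: "card {v \<in> roots. P v} = length (filter P root_list)"
proof -
  have "card (set (filter P root_list)) = length (filter P root_list)"
    by (intro distinct_card distinct_filter root_list_distinct)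
  then show ?thesis by (simp add: roots_def)
qed

lemma dotl_lin: "length l = 6 \<Longrightarrow> length v = 6 \<Longrightarrow> dotl l v = lin ((!) l) v"
  by (simp add: dotl_def lin_def sum_list_sum_nth atLeast0LessThan)

lemma lin_diff: "lin (\<lambda>j. a j - b j) v = lin a v - lin b v"
  by (simp add: lin_def algebra_simps sum_subtractf)

lemma lin_add: "lin (\<lambda>j. a j + b j) v = lin a v + lin b v"
  by (simp add: lin_def algebra_simps sum.distrib)

lemma lin_scale: "lin (\<lambda>j. c * a j) v = c * lin a v"
  by (simp add: lin_def algebra_simps sum_distrib_left)

lemma lin_zero [simp]: "lin (\<lambda>_. 0) v = 0"
  by (simp add: lin_def)

lemma lin_unit: "k < 6 \<Longrightarrow> lin (\<lambda>j. if j = k then 1 else 0) v = v ! k"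
  by (simp add: lin_def if_distrib if_distribR cong: if_cong)

lemma lin_cong_even:
  assumes "\<And>j. j < 6 \<Longrightarrow> even (a j - b j)"
  shows "even (lin a v - lin b v)"
  unfolding lin_diff[symmetric] unfolding lin_def
  by (intro dvd_sum dvd_mult2) (use assms in auto)

subsection \<open>Invariant forms\<close>

text \<open>Off-diagonal terms occur in equal pairs, so only the diagonal counts modulo 2.\<close>

lemma sum_sym_even:
  fixes f :: "nat \<Rightarrow> nat \<Rightarrow> int"
  assumes "\<And>j k. f j k = f k j" "\<And>j. j < n \<Longrightarrow> even (f j j)"
  shows "even (\<Sum>j<n. \<Sum>k<n. f j k)"
  using assms(2)
proof (induction n)
  case (Suc n)
  have eq: "(\<Sum>j<Suc n. \<Sum>k<Suc n. f j k) = (\<Sum>j<n. \<Sum>k<n. f j k) + 2 * (\<Sum>j<n. f j n) + f n n"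
    using assms(1) by (simp add: sum.distrib)
  show ?case unfolding eq using Suc by auto
qed simp

text \<open>Coordinates are inner products with the fundamental weights, so the second moments are
  12 times the inverse Cartan matrix. Its determinant being 3, they are multiples of 4; the diagonal
  is 16, 40, 72, 40, 16, 24.\<close>

lemma root_moments:
  "list_all (\<lambda>j. 4 dvd sum_list (map (\<lambda>v. v ! j) root_list) \<and>
     8 dvd sum_list (map (\<lambda>v. v ! j * v ! j) root_list) \<and>
     list_all (\<lambda>k. 4 dvd sum_list (map (\<lambda>v. v ! j * v ! k) root_list)) [0, 1, 2, 3, 4, 5])
   [0, 1, 2, 3, 4, 5]"
  by code_simp

lemma root_moments':
  assumes "j < 6"
  shows "4 dvd (\<Sum>v\<in>roots. v ! j)" "8 dvd (\<Sum>v\<in>roots. v ! j * v ! j)"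
    "k < 6 \<Longrightarrow> 4 dvd (\<Sum>v\<in>roots. v ! j * v ! k)"
proof -
  have "i \<in> set [0, 1, 2, 3, 4, 5]" if "i < 6" for i :: nat using that by auto
  then show "4 dvd (\<Sum>v\<in>roots. v ! j)" "8 dvd (\<Sum>v\<in>roots. v ! j * v ! j)"
    "k < 6 \<Longrightarrow> 4 dvd (\<Sum>v\<in>roots. v ! j * v ! k)"
    using root_moments assms unfolding list_all_iff sum_roots by blast+
qed

lemma sum_lin_coord: "(\<Sum>v\<in>S. lin a v) = (\<Sum>j<6. a j * (\<Sum>v\<in>S. v ! j))"
  unfolding lin_def by (subst sum.swap) (simp add: sum_distrib_left)

lemma sum_lin_lin:
  "(\<Sum>v\<in>S. lin a v * lin b v) = (\<Sum>j<6. \<Sum>k<6. a j * b k * (\<Sum>v\<in>S. v ! j * v ! k))"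
proof -
  have "(\<Sum>v\<in>S. lin a v * lin b v) = (\<Sum>v\<in>S. \<Sum>j<6. \<Sum>k<6. a j * b k * (v ! j * v ! k))"
    unfolding lin_def sum_product by (simp add: mult_ac)
  also have "\<dots> = (\<Sum>j<6. \<Sum>v\<in>S. \<Sum>k<6. a j * b k * (v ! j * v ! k))" by (rule sum.swap)
  also have "\<dots> = (\<Sum>j<6. \<Sum>k<6. \<Sum>v\<in>S. a j * b k * (v ! j * v ! k))"
    by (rule sum.cong[OF refl], rule sum.swap)
  finally show ?thesis by (simp add: sum_distrib_left)
qed

lemma sum_lin_dvd: "4 dvd (\<Sum>v\<in>roots. lin a v)"
  unfolding sum_lin_coord by (intro root_moments'(1) dvd_sum dvd_mult) simp

lemma sum_lin_lin_dvd: "4 dvd (\<Sum>v\<in>roots. lin a v * lin b v)"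
  unfolding sum_lin_lin by (intro root_moments'(3) dvd_sum dvd_mult) auto

text \<open>The diagonal moments are divisible by 8 and the others, divisible by 4, occur twice.
  This extra factor 2 over the bilinear statement is what determines norms modulo 2 in
  \<open>codeL_norm\<close>.\<close>

lemma sum_lin_square_dvd: "8 dvd (\<Sum>v\<in>roots. lin a v * lin a v)"
proof -
  define q where "q j k = (\<Sum>v\<in>roots. v ! j * v ! k) div 4" for j k
  have q: "(\<Sum>v\<in>roots. v ! j * v ! k) = 4 * q j k" if "j < 6" "k < 6" for j k
    using root_moments'(3)[OF that] by (simp add: q_def)
  have qs: "q j k = q k j" for j k by (simp add: q_def mult.commute)
  have qe: "even (q j j)" if "j < 6" for j using root_moments'(2)[OF that] q[OF that that] by auto
  have "(\<Sum>v\<in>roots. lin a v * lin a v) = (\<Sum>j<6. \<Sum>k<6. a j * a k * (4 * q j k))"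
    unfolding sum_lin_lin using q by simp
  also have "\<dots> = 4 * (\<Sum>j<6. \<Sum>k<6. a j * a k * q j k)"
    by (simp add: sum_distrib_left mult_ac)
  finally have e: "(\<Sum>v\<in>roots. lin a v * lin a v) = 4 * (\<Sum>j<6. \<Sum>k<6. a j * a k * q j k)" .
  have "even (\<Sum>j<6. \<Sum>k<6. a j * a k * q j k)"
    by (rule sum_sym_even) (use qs qe in \<open>auto simp: mult_ac\<close>)
  then show ?thesis unfolding e by auto
qed

subsection \<open>Roots modulo two\<close>

definition simple :: "nat \<Rightarrow> int list" where
  "simple k = map (\<lambda>j. if j = k then 1 else 0) [0..<6]"

lemma simple_numeral:
  "simple 0 = [1,0,0,0,0,0]" "simple (Suc 0) = [0,1,0,0,0,0]" "simple 1 = [0,1,0,0,0,0]"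
  "simple 2 = [0,0,1,0,0,0]" "simple 3 = [0,0,0,1,0,0]"
  "simple 4 = [0,0,0,0,1,0]" "simple 5 = [0,0,0,0,0,1]"
  by (simp_all add: simple_def upt_rec)

lemma simple_take: "set (take 6 root_list) = simple ` {..<6}"
proof -
  have "take 6 root_list = map simple [0..<6]" by code_simp
  then show ?thesis by auto
qed

lemma simple_root: "k < 6 \<Longrightarrow> simple k \<in> roots"
  using simple_take set_take_subset[of 6 root_list] by (auto simp: roots_def)

lemma lin_simple: "k < 6 \<Longrightarrow> lin a (simple k) = a k"
proof -
  assume k: "k < 6"
  have "lin a (simple k) = (\<Sum>j<6. if j = k then a k else 0)"
    unfolding lin_def by (rule sum.cong) (auto simp: simple_def)
  then show ?thesis using k by simp
qed

lemma even3_iff: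
  assumes "length u = 6" "length v = 6" "length w = 6"
  shows "even3 u v w \<longleftrightarrow> (\<forall>j<6. even (u ! j + v ! j + w ! j))"
  using assms by (simp add: even3_def list_all_length add.assoc)

lemma even3_lin:
  assumes "length u = 6" "length v = 6" "length w = 6" "even3 u v w"
  shows "even (lin a u + lin a v + lin a w)"
proof -
  have "lin a u + lin a v + lin a w = (\<Sum>j<6. a j * (u ! j + v ! j + w ! j))"
    unfolding lin_def by (simp add: sum.distrib algebra_simps)
  then show ?thesis using assms by (auto simp: even3_iff intro!: dvd_sum)
qed

text \<open>Certificate that each further root is congruent modulo 2 to the sum of an earlier root
  and a simple root, as in the generation of positive roots by height.\<close>

fun line_generated :: "int list list \<Rightarrow> int list list \<Rightarrow> bool" where
  "line_generated us [] = True"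
| "line_generated us (w # ws) =
    (list_ex (\<lambda>u. list_ex (\<lambda>v. even3 u v w) (take 6 root_list)) us \<and> line_generated (w # us) ws)"

lemma line_generated_root_list: "line_generated (take 6 root_list) (drop 6 root_list)" by code_simp

text \<open>Spreads a property from the simple roots along triples with even sum; it later
  recognises linear functions modulo 2 and compares maps that preserve triples.\<close>

lemma root_induct [consumes 1, case_names simple line]:
  assumes "x \<in> roots" and simple: "\<And>k. k < 6 \<Longrightarrow> P (simple k)"
    and line: "\<And>u v w. u \<in> roots \<Longrightarrow> v \<in> roots \<Longrightarrow> w \<in> roots \<Longrightarrow> even3 u v w \<Longrightarrow> P u \<Longrightarrow> P v \<Longrightarrow> P w"
  shows "P x"
proof -
  have "\<forall>w\<in>set ws. P w" if "line_generated us ws" "\<forall>u\<in>set us. u \<in> roots \<and> P u" "set ws \<subseteq> roots" for us ws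
    using that
  proof (induction ws arbitrary: us)
    case (Cons w ws)
    then obtain u v where "u \<in> set us" "v \<in> simple ` {..<6}" "even3 u v w"
      by (auto simp: list_ex_iff simple_take)
    then have "P w" using line[of u v w] simple simple_root Cons.prems by auto
    then show ?case using Cons.IH[of "w # us"] Cons.prems by auto
  qed simp
  from this[OF line_generated_root_list] have "\<forall>w\<in>set (drop 6 root_list). P w"
    using simple_take simple simple_root set_drop_subset[of 6 root_list] by (auto simp: roots_def)
  moreover have "\<forall>w\<in>set (take 6 root_list). P w" using simple simple_take by auto
  moreover have "roots = set (take 6 root_list) \<union> set (drop 6 root_list)"
    unfolding roots_def set_append[symmetric] by simp
  ultimately show ?thesis using assms(1) by blast
qed

text \<open>Roots congruent modulo 2 agree up to sign, and the list contains one root of each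
  opposite pair.\<close>

lemma root_eq_mod_2:
  assumes "v \<in> roots" "w \<in> roots" "\<And>j. j < 6 \<Longrightarrow> even (v ! j + w ! j)"
  shows "v = w"
proof -
  have "distinct (map (map (\<lambda>x. x mod 2)) root_list)" by code_simp
  then have "inj_on (map (\<lambda>x. x mod 2)) roots" unfolding distinct_map roots_def by blast
  moreover have "map (\<lambda>x. x mod 2) v = map (\<lambda>x. x mod 2) w"
    using assms length_root by (intro nth_equalityI) (auto simp: mod2_eq_if)
  ultimately show ?thesis using assms by (auto dest: inj_onD)
qed

lemma root_odd_coord:
  assumes "v \<in> roots"
  shows "\<exists>j<6. odd (v ! j)"
proof -
  have "list_ex odd v" by (rule list_all_rootsD[OF _ assms]) code_simp
  then show ?thesis using length_root[OF assms] by (auto simp: list_ex_length)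
qed

lemma line_unique:
  assumes "u \<in> roots" "v \<in> roots" "w \<in> roots" "w' \<in> roots" "even3 u v w" "even3 u v w'"
  shows "w = w'"
proof (rule root_eq_mod_2)
  fix j :: nat assume "j < 6"
  then have "even (u ! j + v ! j + w ! j)" "even (u ! j + v ! j + w' ! j)"
    using assms length_root by (auto simp: even3_iff)
  then show "even (w ! j + w' ! j)" by auto
qed (use assms in auto)

lemma line_distinct:
  assumes "u \<in> roots" "v \<in> roots" "w \<in> roots" "even3 u v w"
  shows "u \<noteq> v" "v \<noteq> w" "u \<noteq> w"
  using assms root_odd_coord[of u] root_odd_coord[of v] root_odd_coord[of w] length_root
  by (auto simp: even3_iff)

lemma line_through: "v \<in> roots \<Longrightarrow> \<exists>u\<in>roots. \<exists>w\<in>roots. even3 v u w"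
proof -
  assume v: "v \<in> roots"
  have "list_ex (\<lambda>u. list_ex (even3 v u) root_list) root_list"
    by (rule list_all_rootsD[OF _ v]) code_simp
  then show ?thesis by (auto simp: list_ex_iff roots_def)
qed

section \<open>Weights of the residue code\<close>

definition wt :: "(nat \<Rightarrow> int) \<Rightarrow> nat" where
  "wt a = card {v \<in> roots. odd (lin a v)}"

text \<open>Parities of the values depend only on the six coefficients modulo 2, so statements about
  all linear functions become checks over 64 lists.\<close>

definition bits :: "(nat \<Rightarrow> int) \<Rightarrow> int list" where
  "bits a = map (\<lambda>j. a j mod 2) [0..<6]"

lemma bits_n_lists: "bits a \<in> set (List.n_lists 6 [0, 1])"
  by (auto simp: bits_def set_n_lists)

lemma wt_bits: "wt a = length (filter (\<lambda>v. odd (dotl (bits a) v)) root_list)"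
proof -
  have "odd (lin a v) \<longleftrightarrow> odd (dotl (bits a) v)" if "v \<in> roots" for v
  proof -
    have "dotl (bits a) v = lin ((!) (bits a)) v"
      using length_root[OF that] by (intro dotl_lin) (auto simp: bits_def)
    moreover have "even (lin a v - lin ((!) (bits a)) v)"
      by (rule lin_cong_even) (auto simp: bits_def mod2_eq_if)
    ultimately show ?thesis by auto
  qed
  then have "{v \<in> roots. odd (lin a v)} = {v \<in> roots. odd (dotl (bits a) v)}" by auto
  then show ?thesis unfolding wt_def by (simp add: card_roots_filter)
qed

text \<open>In the quadratic space modulo 2 every nonzero functional is the inner product with one
  of the 27 singular vectors, odd on 16 roots, or with one of the 36 roots, odd on 20.\<close>

lemma wt_cases:
  assumes "j < 6" "odd (a j)"
  shows "wt a \<in> {16, 20}"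
proof -
  have "list_all (\<lambda>a. length (filter (\<lambda>v. odd (dotl a v)) root_list) \<in> {0, 16, 20})
      (List.n_lists 6 [0, 1])" by code_simp
  then have "wt a \<in> {0, 16, 20}" using bits_n_lists[of a] unfolding wt_bits list_all_iff by blast
  moreover have "simple j \<in> {v \<in> roots. odd (lin a v)}" using assms simple_root lin_simple by auto
  then have "wt a \<noteq> 0" unfolding wt_def by auto
  ultimately show ?thesis by auto
qed

lemma minuscule_bound:
  assumes "l \<in> set minuscule_list"
  shows "length l = 6" "v \<in> roots \<Longrightarrow> \<bar>lin ((!) l) v\<bar> \<le> 1" "wt ((!) l) = 16"
proof -
  have 1: "list_all (\<lambda>l. length l = 6 \<and> list_all (\<lambda>v. \<bar>dotl l v\<bar> \<le> 1) root_list
     \<and> length (filter (\<lambda>v. odd (dotl l v)) root_list) = 16) minuscule_list" by code_simp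
  then show l: "length l = 6" using assms by (auto simp: list_all_iff)
  show "v \<in> roots \<Longrightarrow> \<bar>lin ((!) l) v\<bar> \<le> 1"
    using 1 assms length_root dotl_lin[OF l] by (auto simp: list_all_iff roots_def)
  have "{v \<in> roots. odd (lin ((!) l) v)} = {v \<in> roots. odd (dotl l v)}"
    using dotl_lin[OF l] length_root by auto
  then have "wt ((!) l) = length (filter (\<lambda>v. odd (dotl l v)) root_list)"
    unfolding wt_def by (simp add: card_roots_filter)
  then show "wt ((!) l) = 16" using 1 assms by (auto simp: list_all_iff)
qed

lemma minuscule_complete:
  assumes "wt a = 16"
  shows "\<exists>l\<in>set minuscule_list. \<forall>j<6. even (a j - l ! j)"
proof -
  have "list_all (\<lambda>a. length (filter (\<lambda>v. odd (dotl a v)) root_list) = 16 \<longrightarrow>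
      a \<in> set (map (map (\<lambda>x. x mod 2)) minuscule_list)) (List.n_lists 6 [0, 1])" by code_simp
  then have "bits a \<in> set (map (map (\<lambda>x. x mod 2)) minuscule_list)"
    using bits_n_lists[of a] assms unfolding wt_bits list_all_iff by blast
  then obtain l where l: "l \<in> set minuscule_list" "bits a = map (\<lambda>x. x mod 2) l" by auto
  have "even (a j - l ! j)" if "j < 6" for j
  proof -
    have "a j mod 2 = bits a ! j" using that by (simp add: bits_def)
    also have "\<dots> = l ! j mod 2" using that minuscule_bound(1)[OF l(1)] by (simp add: l(2))
    finally show ?thesis by (simp add: mod_eq_dvd_iff)
  qed
  then show ?thesis using l by blast
qed

lemma minuscule_distinct:
  assumes "l \<in> set minuscule_list" "l' \<in> set minuscule_list" "\<And>j. j < 6 \<Longrightarrow> even (l ! j - l' ! j)"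
  shows "l = l'"
proof -
  have "distinct (map (map (\<lambda>x. x mod 2)) minuscule_list)" by code_simp
  then have "inj_on (map (\<lambda>x. x mod 2)) (set minuscule_list)" unfolding distinct_map by blast
  moreover have "map (\<lambda>x. x mod 2) l = map (\<lambda>x. x mod 2) l'"
    using assms minuscule_bound(1) by (intro nth_equalityI) (auto simp: mod_eq_dvd_iff)
  ultimately show ?thesis using assms by (auto dest: inj_onD)
qed

lemma card_minuscule: "card (set minuscule_list) = 27"
proof -
  have "distinct minuscule_list" "length minuscule_list = 27" by code_simp+
  then show ?thesis by (simp add: distinct_card)
qed

subsection \<open>Reflections\<close>

definition ip :: "int list \<Rightarrow> int list \<Rightarrow> int" where
  "ip r v = lin ((!) (E6_form r)) v"

lemma length_E6_form: "length v = 6 \<Longrightarrow> length (E6_form v) = 6"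
  by (auto simp: E6_form_def length_Suc_conv eval_nat_numeral)

lemma length_weyl: "length v = 6 \<Longrightarrow> length r = 6 \<Longrightarrow> length (weyl r v) = 6"
  by (simp add: weyl_def Let_def)

lemma weyl_nth:
  assumes "length v = 6" "length r = 6" "j < 6"
  shows "weyl r v ! j = v ! j - ip r v * r ! j"
  using assms by (simp add: weyl_def Let_def ip_def dotl_lin length_E6_form)

lemma lin_weyl:
  assumes "length v = 6" "length r = 6"
  shows "lin a (weyl r v) = lin a v - ip r v * lin a r"
  using assms by (simp add: lin_def weyl_nth algebra_simps sum_subtractf sum_distrib_left)

lemma lin_uminus: "length v = 6 \<Longrightarrow> lin a (map uminus v) = - lin a v"
  by (simp add: lin_def sum_negf)

lemma ip_self: "r \<in> roots \<Longrightarrow> ip r r = 2"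
proof -
  assume r: "r \<in> roots"
  have "list_all (\<lambda>r. dotl (E6_form r) r = 2) root_list" by code_simp
  from list_all_rootsD[OF this r] show ?thesis
    using length_root[OF r] by (simp add: ip_def dotl_lin length_E6_form)
qed

lemma weyl_weyl:
  assumes "v \<in> roots" "r \<in> roots"
  shows "weyl r (weyl r v) = v"
proof (rule nth_equalityI)
  have l: "length v = 6" "length r = 6" using assms length_root by auto
  then show "length (weyl r (weyl r v)) = length v" by (simp add: length_weyl)
  fix j assume "j < length (weyl r (weyl r v))"
  then have j: "j < 6" using l by (simp add: length_weyl)
  have "ip r (weyl r v) = - ip r v"
    using lin_weyl[OF l] ip_self[OF assms(2)] unfolding ip_def[of r "weyl r v"] by (simp add: ip_def)
  then show "weyl r (weyl r v) ! j = v ! j" using l j by (simp add: weyl_nth length_weyl)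
qed

lemma weyl_uminus:
  assumes "length v = 6" "length r = 6"
  shows "weyl r (map uminus v) = map uminus (weyl r v)"
  using assms by (intro nth_equalityI)
    (auto simp: length_weyl weyl_nth lin_uminus ip_def)

lemma uminus_not_root: "v \<in> roots \<Longrightarrow> map uminus v \<notin> roots"
proof -
  have "list_all (\<lambda>v. map uminus v \<notin> set root_list) root_list" by code_simp
  then show "v \<in> roots \<Longrightarrow> map uminus v \<notin> roots" unfolding roots_def[symmetric] by (rule list_all_rootsD)
qed

lemma weyl_closed:
  assumes "r \<in> roots" "v \<in> roots"
  shows "weyl r v \<in> roots \<or> map uminus (weyl r v) \<in> roots"
proof -
  have "list_all (\<lambda>r. list_all (\<lambda>v. let u = weyl r v in
      u \<in> set root_list \<or> map uminus u \<in> set root_list) root_list) root_list"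
    by code_simp
  from list_all_rootsD[OF list_all_rootsD[OF this assms(1)] assms(2)] show ?thesis
    by (simp add: Let_def roots_def)
qed

lemma rperm_root: "r \<in> roots \<Longrightarrow> v \<in> roots \<Longrightarrow> rperm r v \<in> roots"
  using weyl_closed[of r v] by (auto simp: rperm_def Let_def roots_def)

lemma rsign_cases: "rsign r v = 1 \<or> rsign r v = - 1"
  by (simp add: rsign_def)

lemma uminus_uminus_list [simp]: "map uminus (map uminus v) = (v :: int list)"
  by (simp add: comp_def)

lemma rperm_rperm:
  assumes "r \<in> roots" "v \<in> roots"
  shows "rperm r (rperm r v) = v" "rsign r (rperm r v) = rsign r v"
proof -
  have l: "length v = 6" "length r = 6" "length (weyl r v) = 6"
    using assms length_root length_weyl by auto
  have n: "map uminus v \<notin> roots" using uminus_not_root assms by blast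
  have "weyl r (map uminus (weyl r v)) = map uminus v"
    using weyl_uminus[OF l(3,2)] weyl_weyl[OF assms(2,1)] by simp
  then show "rperm r (rperm r v) = v" "rsign r (rperm r v) = rsign r v"
    using weyl_weyl[OF assms(2,1)] assms n
    by (auto simp: rperm_def rsign_def Let_def roots_def simp del: map_map)
qed

text \<open>The left side is the value of \<open>lin a\<close> at the true reflection of
  \<open>v\<close>: the sign undoes the passage to the representative.\<close>

lemma lin_rperm:
  assumes "r \<in> roots" "v \<in> roots"
  shows "rsign r v * lin a (rperm r v) = lin a v - ip r v * lin a r"
  using lin_weyl[of v r a] lin_uminus[of "weyl r v" a] assms length_root[of v] length_root[of r]
    length_weyl[of v r]
  by (auto simp: rperm_def rsign_def Let_def)

lemma rperm_bij: "r \<in> roots \<Longrightarrow> bij_betw (rperm r) roots roots"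
  by (rule bij_betw_byWitness[of _ "rperm r"]) (auto simp: rperm_rperm rperm_root)

lemma even_diff_uminus: "x = y \<or> x = - y \<Longrightarrow> even (x - y)" for x y :: int
  by auto

text \<open>Signs disappear modulo 2, and the correction terms add up to the multiple
  \<open>ip r u + ip r v + ip r w\<close> of \<open>r\<close>, which is even because
  \<open>ip r\<close> is linear.\<close>

lemma rperm_even3:
  assumes "r \<in> roots" "u \<in> roots" "v \<in> roots" "w \<in> roots" "even3 u v w"
  shows "even3 (rperm r u) (rperm r v) (rperm r w)"
proof -
  have l: "length u = 6" "length v = 6" "length w = 6" using assms length_root by auto
  have "even (rperm r u ! j + rperm r v ! j + rperm r w ! j)" if j: "j < 6" for j
  proof -
    let ?a = "\<lambda>i. if i = j then 1 else 0 :: int"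
    have e: "even (lin ?a (rperm r x) - (lin ?a x - ip r x * lin ?a r))" if "x \<in> roots" for x
      by (rule even_diff_uminus) (use lin_rperm[OF assms(1) that, of ?a] rsign_cases[of r x] in auto)
    have "even (lin ?a u + lin ?a v + lin ?a w)" by (rule even3_lin[OF l assms(5)])
    moreover have "even (ip r u + ip r v + ip r w)" unfolding ip_def by (rule even3_lin[OF l assms(5)])
    then have "even ((ip r u + ip r v + ip r w) * lin ?a r)" by simp
    ultimately have "even (lin ?a (rperm r u) + lin ?a (rperm r v) + lin ?a (rperm r w))"
      using e[OF assms(2)] e[OF assms(3)] e[OF assms(4)] by (auto simp: algebra_simps)
    then show ?thesis using lin_unit[OF j] by simp
  qed
  then show ?thesis using rperm_root[OF assms(1)] length_root assms by (auto simp: even3_iff)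
qed

definition neg_set :: "int list \<Rightarrow> int list set" where
  "neg_set r = {v \<in> roots. rsign r v = - 1}"

text \<open>For the usual positive roots this set has as many elements as the length of the
  reflection, an odd number, and its sum is the height of \<open>r\<close> times \<open>r\<close>.
  Reversing w = (0,1,1,1,0,1) toggles membership at w and at its image (twice if they coincide),
  which keeps the parity and adds (w,r) times \<open>r\<close> modulo 2. As w is congruent to the
  half-sum of the positive roots, (w,r) has the parity of the height, and the sum becomes
  even.\<close>

lemma neg_set_parity:
  assumes "r \<in> roots"
  shows "odd (card (neg_set r))" "even (\<Sum>v\<in>neg_set r. lin a v)"
proof -
  have c: "list_all (\<lambda>r. let N = filter (\<lambda>v. weyl r v \<notin> set root_list) root_list in
      odd (length N) \<and> list_all (\<lambda>j. even (sum_list (map (\<lambda>v. v ! j) N))) [0, 1, 2, 3, 4, 5]) root_list"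
    by code_simp
  let ?N = "filter (\<lambda>v. weyl r v \<notin> set root_list) root_list"
  have N: "neg_set r = set ?N" by (auto simp: neg_set_def rsign_def roots_def)
  have d: "distinct ?N" by (intro distinct_filter root_list_distinct)
  note c = list_all_rootsD[OF c assms, unfolded Let_def]
  show "odd (card (neg_set r))" unfolding N distinct_card[OF d] by (rule conjunct1[OF c])
  have s: "(\<Sum>v\<in>neg_set r. v ! j) = sum_list (map (\<lambda>v. v ! j) ?N)" for j
    unfolding N by (rule sum.distinct_set_conv_list[OF d])
  have "even (\<Sum>v\<in>neg_set r. v ! j)" if "j < 6" for j
  proof -
    have "j \<in> set [0, 1, 2, 3, 4, 5]" using that by auto
    then show ?thesis unfolding s using c unfolding list_all_iff by blast
  qed
  then show "even (\<Sum>v\<in>neg_set r. lin a v)"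
    unfolding sum_lin_coord by (intro dvd_sum, intro dvd_mult) simp
qed

subsection \<open>Quadratic functions on the roots\<close>

lemma even_card_if_even_products:
  assumes "N \<subseteq> roots" "\<And>j k. j < 6 \<Longrightarrow> k < 6 \<Longrightarrow> even (\<Sum>v\<in>N. v ! j * v ! k)"
  shows "even (card N)"
proof -
  \<comment> \<open>Modulo 2 this is half the norm on the root lattice, with one term for each node
    and each edge of the Dynkin diagram. It is odd on every root, so summing it over
    \<open>N\<close> counts \<open>N\<close> modulo 2.\<close>
  let ?q = "\<lambda>v::int list. v ! 0 * v ! 0 + v ! 1 * v ! 1 + v ! 2 * v ! 2 + v ! 3 * v ! 3 + v ! 4 * v ! 4 + v ! 5 * v ! 5
      + v ! 0 * v ! 1 + v ! 1 * v ! 2 + v ! 2 * v ! 3 + v ! 3 * v ! 4 + v ! 2 * v ! 5"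
  have "list_all (\<lambda>v. odd (?q v)) root_list" by code_simp
  then have "odd (?q v)" if "v \<in> N" for v using list_all_rootsD[of "\<lambda>v. odd (?q v)"] that assms(1) by blast
  then have "even (?q v - 1)" if "v \<in> N" for v using that by simp
  then have "even (\<Sum>v\<in>N. ?q v - 1)" by (rule dvd_sum)
  moreover have "even (\<Sum>v\<in>N. ?q v)" unfolding sum.distrib by (intro dvd_add assms(2)) auto
  ultimately have "even (int (card N))" by (simp add: sum_subtractf)
  then show ?thesis by simp
qed

text \<open>Each pair of simple roots comes with the sum of the simple roots on the path joining them in
  the Dynkin diagram (up to sign). Ordered by path length, the monomials evaluate triangularly on these.\<close>

definition triangle_list :: "((nat \<times> nat) \<times> int list) list" where
  "triangle_list =
    [((0,0), [1,0,0,0,0,0]), ((1,1), [0,1,0,0,0,0]), ((2,2), [0,0,1,0,0,0]),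
     ((3,3), [0,0,0,1,0,0]), ((4,4), [0,0,0,0,1,0]), ((5,5), [0,0,0,0,0,1]),
     ((0,1), [1,1,0,0,0,0]), ((1,2), [0,1,1,0,0,0]), ((2,3), [0,0,1,1,0,0]),
     ((2,5), [0,0,1,0,0,1]), ((3,4), [0,0,0,1,1,0]), ((0,2), [1,1,1,0,0,0]),
     ((1,3), [0,1,1,1,0,0]), ((1,5), [0,1,1,0,0,1]), ((2,4), [0,0,1,1,1,0]),
     ((3,5), [0,0,1,1,0,1]), ((0,3), [1,1,1,1,0,0]), ((0,5), [1,1,1,0,0,1]),
     ((1,4), [0,1,1,1,1,0]), ((4,5), [0,0,1,1,1,1]), ((0,4), [1,1,1,1,1,0])]"

abbreviation monomial :: "nat \<times> nat \<Rightarrow> int list \<Rightarrow> int" where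
  "monomial p v \<equiv> v ! fst p * v ! snd p"

fun triangular :: "((nat \<times> nat) \<times> int list) list \<Rightarrow> bool" where
  "triangular [] = True"
| "triangular ((p, v) # xs) =
    (odd (monomial p v) \<and> list_all (\<lambda>x. even (monomial (fst x) v)) xs \<and> triangular xs)"

definition monomials :: "(nat \<times> nat) set" where
  "monomials = {(j, k). j \<le> k \<and> k < 6}"

lemma set_triangle_list: "fst ` set triangle_list = monomials"
  and card_monomials: "card monomials = 21"
proof -
  have l: "list_all (\<lambda>p. fst p \<le> snd p \<and> snd p < 6) (map fst triangle_list)"
      "list_all (\<lambda>k. list_all (\<lambda>j. (j, k) \<in> set (map fst triangle_list)) [0..<Suc k]) [0..<6]"
      "distinct (map fst triangle_list)" "length triangle_list = 21"
    by code_simp+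
  show eq: "fst ` set triangle_list = monomials"
  proof (intro set_eqI)
    fix p :: "nat \<times> nat"
    obtain j k where p: "p = (j, k)" by fastforce
    have "p \<in> set (map fst triangle_list)" if "j \<le> k" "k < 6"
      using l(2) that unfolding list_all_iff p by fastforce
    moreover have "j \<le> k \<and> k < 6" if "p \<in> set (map fst triangle_list)"
      using l(1) that unfolding list_all_iff p by fastforce
    ultimately show "p \<in> fst ` set triangle_list \<longleftrightarrow> p \<in> monomials"
      unfolding monomials_def p by auto
  qed
  show "card monomials = 21"
    unfolding eq[symmetric] using distinct_card[OF l(3)] l(4) by simp
qed

text \<open>If the leading monomial belonged to \<open>c\<close>, its test root would give an odd
  sum, since all later monomials are even there. So the monomials are struck out one by one from the
  front.\<close>

lemma monomials_independent:
  assumes c: "c \<subseteq> monomials" and ev: "\<And>v. v \<in> roots \<Longrightarrow> even (\<Sum>p\<in>c. monomial p v)"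
  shows "c = {}"
proof -
  have "c = {}" if "triangular xs" "c \<subseteq> fst ` set xs" "snd ` set xs \<subseteq> roots" for xs
    using that
  proof (induction xs)
    case (Cons x xs)
    obtain p v where x: "x = (p, v)" by fastforce
    have fin: "finite c" using Cons.prems(2) finite_surj by blast
    have "even (\<Sum>q\<in>c - {p}. monomial q v)"
    proof (rule dvd_sum)
      fix q assume "q \<in> c - {p}"
      then obtain y where "y \<in> set xs" "q = fst y" using Cons.prems(2) by (auto simp: x)
      then show "even (monomial q v)" using Cons.prems(1) by (simp add: x list_all_iff)
    qed
    moreover have "even (\<Sum>q\<in>c. monomial q v)" using ev Cons.prems by (auto simp: x)
    ultimately have "p \<notin> c" using Cons.prems(1) sum.remove[OF fin, of p "\<lambda>q. monomial q v"]
      by (auto simp: x)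
    then show ?case using Cons by (auto simp: x)
  qed simp
  moreover have "triangular triangle_list" by code_simp
  moreover have "list_all (\<lambda>x. snd x \<in> set root_list) triangle_list" by code_simp
  then have "snd ` set triangle_list \<subseteq> roots" by (auto simp: list_all_iff roots_def)
  ultimately show ?thesis using c set_triangle_list by metis
qed

subsection \<open>Quadruples of roots with even sum\<close>

text \<open>Decides for each entry whether to take it and carries the partial sum in
  \<open>s\<close>, so the 58905 quadruples of roots are tested without building sets.\<close>

fun count_even :: "nat \<Rightarrow> int list \<Rightarrow> int list list \<Rightarrow> nat" where
  "count_even 0 s xs = (if list_all even s then 1 else 0)"
| "count_even (Suc k) s [] = 0"
| "count_even (Suc k) s (x # xs) = count_even k (map2 (+) s x) xs + count_even (Suc k) s xs"

lemma card_even_subsets: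
  assumes "distinct xs" "length s = 6" "\<And>x. x \<in> set xs \<Longrightarrow> length x = 6"
  shows "card {S. S \<subseteq> set xs \<and> card S = k \<and> (\<forall>j<6. even (s ! j + (\<Sum>v\<in>S. v ! j)))} = count_even k s xs"
  using assms
proof (induction k s xs rule: count_even.induct)
  case (1 s xs)
  have "{S. S \<subseteq> set xs \<and> card S = 0 \<and> (\<forall>j<6. even (s ! j + (\<Sum>v\<in>S. v ! j)))}
      = (if list_all even s then {{}} else {})"
    using 1 by (auto simp: list_all_length finite_subset[of _ "set xs"])
  then show ?case by simp
next
  case (2 k s)
  have "{S. S \<subseteq> set [] \<and> card S = Suc k \<and> (\<forall>j<6. even (s ! j + (\<Sum>v\<in>S. v ! j)))} = {}"
    by auto
  then show ?case by simp
next
  case (3 k s x xs)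
  let ?P = "\<lambda>k s xs S. S \<subseteq> set xs \<and> card S = k \<and> (\<forall>j<6. even (s ! j + (\<Sum>v\<in>S. v ! j)))"
  have fin: "finite {S. ?P k s xs S}" for k s and xs :: "int list list"
    by (rule finite_subset[of _ "Pow (set xs)"]) auto
  have x: "x \<notin> set xs" "length x = 6" using 3 by auto
  have ins: "?P (Suc k) s (x # xs) (insert x S) \<longleftrightarrow> ?P k (map2 (+) s x) xs S" if "x \<notin> S" for S
  proof (cases "S \<subseteq> set xs")
    case True
    then have "finite S" by (auto intro: finite_subset)
    then show ?thesis using that True 3(4) x by (auto simp: add.assoc)
  next
    case False
    then show ?thesis using that by auto
  qed
  have split: "{S. ?P (Suc k) s (x # xs) S}
      = insert x ` {S. ?P k (map2 (+) s x) xs S} \<union> {S. ?P (Suc k) s xs S}" (is "?L = ?A \<union> ?B")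
  proof (intro set_eqI iffI)
    fix S assume S: "S \<in> ?L"
    show "S \<in> ?A \<union> ?B"
    proof (cases "x \<in> S")
      case True
      then have eq: "insert x (S - {x}) = S" by auto
      have "?P (Suc k) s (x # xs) (insert x (S - {x}))" using S eq by simp
      then have "?P k (map2 (+) s x) xs (S - {x})" by (subst (asm) ins) auto
      then have "insert x (S - {x}) \<in> ?A" by blast
      then show ?thesis using eq by simp
    next
      case False
      then show ?thesis using S by auto
    qed
  next
    fix S assume "S \<in> ?A \<union> ?B"
    then show "S \<in> ?L"
    proof
      assume "S \<in> ?A"
      then obtain S' where S': "S = insert x S'" "?P k (map2 (+) s x) xs S'" by blast
      then have "x \<notin> S'" using x by auto
      from ins[OF this] show ?thesis using S' by simp
    qed auto
  qed
  have "inj_on (insert x) {S. ?P k (map2 (+) s x) xs S}"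
    using x by (auto simp: inj_on_def insert_eq_iff)
  then have "card ?A = card {S. ?P k (map2 (+) s x) xs S}" by (rule card_image)
  moreover have "?A \<inter> ?B = {}" using x by auto
  ultimately have "card ?L = card {S. ?P k (map2 (+) s x) xs S} + card ?B"
    unfolding split using fin by (simp add: card_Un_disjoint)
  also have "\<dots> = count_even (Suc k) s (x # xs)"
    using 3 by simp
  finally show ?case .
qed

lemma card_quadruples:
  "card {S. S \<subseteq> roots \<and> card S = 4 \<and> (\<forall>j<6. even (\<Sum>v\<in>S. v ! j))} = 945"
proof -
  have "count_even 4 [0, 0, 0, 0, 0, 0] root_list = 945" by code_simp
  moreover have "[0, 0, 0, 0, 0, 0::int] ! j = 0" if "j < 6" for j
    using that by (auto simp: less_Suc_eq eval_nat_numeral)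
  moreover have "card {S. S \<subseteq> set root_list \<and> card S = 4 \<and>
      (\<forall>j<6. even ([0, 0, 0, 0, 0, 0] ! j + (\<Sum>v\<in>S. v ! j)))} = count_even 4 [0, 0, 0, 0, 0, 0] root_list"
    by (rule card_even_subsets) (auto simp: root_list_distinct length_root roots_def[symmetric])
  ultimately show ?thesis by (simp add: roots_def cong: conj_cong)
qed

subsection \<open>Flags of roots\<close>

text \<open>On roots this means inner product 1 or -1, so distinct roots that are not joined are
  orthogonal. Maps that preserve triples preserve it.\<close>

definition adj :: "int list \<Rightarrow> int list \<Rightarrow> bool" where
  "adj u v = list_ex (even3 u v) root_list"

text \<open>An upper bound for the orbit of \<open>b\<close> under injective maps that fix
  \<open>bs\<close> and respect \<open>adj\<close>.\<close>

definition cands :: "int list list \<Rightarrow> int list \<Rightarrow> int list list" where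
  "cands bs b = filter (\<lambda>y. y \<notin> set bs \<and> list_all (\<lambda>c. adj y c = adj b c) bs) root_list"

definition fixers :: "int list list \<Rightarrow> int list list" where
  "fixers bs = filter (\<lambda>r. list_all (\<lambda>c. rperm r c = c) bs) root_list"

text \<open>\<open>homogeneous bs b n\<close>: each of the \<open>n\<close> candidates for the image of \<open>b\<close> under a map fixing \<open>bs\<close> is
  reached from \<open>b\<close> by two reflections that fix \<open>bs\<close>. The order of the roots in the flag matters here.\<close>

definition reaches :: "int list list \<Rightarrow> int list list \<Rightarrow> int list list \<Rightarrow> bool" where
  "reaches rs zs ys = list_all (\<lambda>y. list_ex (\<lambda>r. rperm r y \<in> set zs) rs) ys"

definition homogeneous :: "int list list \<Rightarrow> int list \<Rightarrow> nat \<Rightarrow> bool" where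
  "homogeneous bs b n \<longleftrightarrow> length (cands bs b) = n \<and>
     reaches (fixers bs) (map (\<lambda>r. rperm r b) (fixers bs)) (cands bs b)"

lemma homogeneous_0: "homogeneous [] [1,0,0,0,0,0] 36" by code_simp

text \<open>The roots orthogonal to the first one form an \<open>A\<^sub>5\<close> with 15 positive
  roots; the 8 of the next step are those among them that are joined to the second root of the
  flag.\<close>

lemma homogeneous_1: "homogeneous [[1,0,0,0,0,0]] [0,0,1,0,0,0] 15" by code_simp

lemma homogeneous_2: "homogeneous [[1,0,0,0,0,0], [0,0,1,0,0,0]] [0,0,0,1,0,0] 8" by code_simp

lemma homogeneous_3:
  "homogeneous [[1,0,0,0,0,0], [0,0,1,0,0,0], [0,0,0,1,0,0]] [0,1,0,0,0,0] 6" by code_simp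

lemma cands_4:
  "cands [[1,0,0,0,0,0], [0,0,1,0,0,0], [0,0,0,1,0,0], [0,1,0,0,0,0]] [0,0,0,0,1,0] = [[0,0,0,0,1,0]]"
  by code_simp

text \<open>The highest root is orthogonal to the first five simple roots and not to the last, so
  its reflection is the ambiguity left once these five are fixed.\<close>

lemma cands_5:
  "list_all (\<lambda>y. y = [0,0,0,0,0,1] \<or> y = rperm [1,2,3,2,1,2] [0,0,0,0,0,1])
    (cands [[1,0,0,0,0,0], [0,0,1,0,0,0], [0,0,0,1,0,0], [0,1,0,0,0,0]] [0,0,0,0,0,1])"
  by code_simp

lemma rperm_highest:
  "list_all (\<lambda>v. rperm [1,2,3,2,1,2] v = v)
    [[1,0,0,0,0,0], [0,1,0,0,0,0], [0,0,1,0,0,0], [0,0,0,1,0,0], [0,0,0,0,1,0]]"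
  "[1,2,3,2,1,2] \<in> roots"
  unfolding roots_def by code_simp+

subsection \<open>The integral model of the lattice\<close>

definition resid :: "(nat \<Rightarrow> int) \<Rightarrow> int \<Rightarrow> (int list \<Rightarrow> int) \<Rightarrow> bool" where
  "resid a t x \<longleftrightarrow> (\<forall>v\<in>roots. even (x v - lin a v - t))"

text \<open>An integral function \<open>x\<close> stands for the vector \<open>x/2\<close>, so norms are scaled by 4. The lattice and
  its shadow will be \<open>codeL\<close> and \<open>codeS\<close>; they differ in the sum of the coordinates modulo 4.\<close>

definition codeK :: "(int list \<Rightarrow> int) \<Rightarrow> bool" where
  "codeK x \<longleftrightarrow> (\<exists>a t. resid a t x) \<and> (\<forall>a. 4 dvd (\<Sum>v\<in>roots. x v * lin a v))"

definition codeL :: "(int list \<Rightarrow> int) \<Rightarrow> bool" where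
  "codeL x \<longleftrightarrow> codeK x \<and> 4 dvd sum x roots"

definition codeS :: "(int list \<Rightarrow> int) \<Rightarrow> bool" where
  "codeS x \<longleftrightarrow> codeK x \<and> even (sum x roots) \<and> \<not> 4 dvd sum x roots"

lemma codeK_lin: "codeK x \<Longrightarrow> 4 dvd (\<Sum>v\<in>roots. x v * lin a v)"
  by (simp add: codeK_def)

text \<open>Both factors \<open>x v - lin a v - t\<close> and \<open>y v - lin b v - s\<close> are
  even; expanding their product modulo 4 leaves only the coordinate sums. This serves the pairing of
  the lattice with itself, where both sums vanish modulo 4, and that of the shadow with the even
  sublattice, where one sum and the constant in front of the other vanish.\<close>

lemma codeK_inner:
  assumes "codeK x" "codeK y" "resid a t x" "resid b s y"
  shows "4 dvd ((\<Sum>v\<in>roots. x v * y v) - s * sum x roots - t * sum y roots)"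
proof -
  let ?P = "\<Sum>v\<in>roots. (x v - lin a v - t) * (y v - lin b v - s)"
  have "2 * 2 dvd (x v - lin a v - t) * (y v - lin b v - s)" if "v \<in> roots" for v
    by (rule mult_dvd_mono) (use assms that in \<open>auto simp: resid_def\<close>)
  then have P: "4 dvd ?P" by (intro dvd_sum) simp
  have "?P = (\<Sum>v\<in>roots. x v * y v - x v * lin b v - s * x v - y v * lin a v + lin a v * lin b v
      + s * lin a v - t * y v + t * lin b v + t * s)"
    by (rule sum.cong) (auto simp: algebra_simps)
  also have "\<dots> = (\<Sum>v\<in>roots. x v * y v) - (\<Sum>v\<in>roots. x v * lin b v) - s * sum x roots
      - (\<Sum>v\<in>roots. y v * lin a v) + (\<Sum>v\<in>roots. lin a v * lin b v) + s * sum (lin a) roots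
      - t * sum y roots + t * sum (lin b) roots + 36 * (t * s)"
    by (simp add: sum.distrib sum_subtractf sum_distrib_left card_roots)
  finally have "(\<Sum>v\<in>roots. x v * y v) - s * sum x roots - t * sum y roots
     = ?P + (\<Sum>v\<in>roots. x v * lin b v) + (\<Sum>v\<in>roots. y v * lin a v)
      - (\<Sum>v\<in>roots. lin a v * lin b v) - s * sum (lin a) roots - t * sum (lin b) roots - 36 * (t * s)"
    by simp
  then show ?thesis
    by (simp only:) (intro dvd_add dvd_diff P codeK_lin assms sum_lin_lin_dvd
        dvd_mult[OF sum_lin_dvd] dvd_mult2; simp)
qed

text \<open>Write \<open>x = lin a + t + 2 * u\<close>. The square expands into moments known modulo
  8, apart from 4 times the sum of the squares of \<open>u\<close>; that sum has the parity of
  \<open>sum u roots\<close>, which is even.\<close>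

lemma codeL_norm:
  assumes "codeL x" "resid a t x"
  shows "8 dvd ((\<Sum>v\<in>roots. x v * x v) - 4 * (t * t))"
proof -
  define u where "u v = (x v - lin a v - t) div 2" for v
  have u: "x v - lin a v - t = 2 * u v" if "v \<in> roots" for v
    using assms(2) that by (simp add: resid_def u_def)
  obtain p where p: "sum x roots = 4 * p" using assms(1) by (auto simp: codeL_def)
  obtain q where q: "sum (lin a) roots = 4 * q" using sum_lin_dvd[of a] by (auto simp: dvd_def)
  obtain q2 where q2: "(\<Sum>v\<in>roots. lin a v * lin a v) = 8 * q2"
    using sum_lin_square_dvd[of a] by (auto simp: dvd_def)
  obtain r where r: "(\<Sum>v\<in>roots. x v * lin a v) = 4 * r"
    using codeK_lin[of x a] assms(1) by (auto simp: codeL_def dvd_def)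
  have "2 * sum u roots = (\<Sum>v\<in>roots. x v - lin a v - t)"
    unfolding sum_distrib_left by (rule sum.cong) (simp_all add: u)
  also have "\<dots> = 4 * p - 4 * q - 36 * t" by (simp add: sum_subtractf p q card_roots)
  finally have su: "sum u roots = 2 * (p - q - 9 * t)" by simp
  have "even (\<Sum>v\<in>roots. u v * u v - u v)" by (rule dvd_sum) auto
  then have "even (\<Sum>v\<in>roots. u v * u v)" by (simp add: sum_subtractf su)
  then obtain w where w: "(\<Sum>v\<in>roots. u v * u v) = 2 * w" by blast
  have "8 * w = 4 * (\<Sum>v\<in>roots. u v * u v)" using w by simp
  also have "\<dots> = (\<Sum>v\<in>roots. (2 * u v) * (2 * u v))"
    by (simp add: sum_distrib_left mult_ac)
  also have "\<dots> = (\<Sum>v\<in>roots. (x v - lin a v - t) * (x v - lin a v - t))"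
    by (rule sum.cong) (simp_all add: u)
  also have "\<dots> = (\<Sum>v\<in>roots. x v * x v - 2 * (x v * lin a v) - (2 * t) * x v + lin a v * lin a v
      + (2 * t) * lin a v + t * t)"
    by (rule sum.cong) (auto simp: algebra_simps)
  also have "\<dots> = (\<Sum>v\<in>roots. x v * x v) - 2 * (4 * r) - 2 * t * (4 * p) + 8 * q2
      + 2 * t * (4 * q) + 36 * (t * t)"
    by (simp add: sum.distrib sum_subtractf sum_distrib_left[symmetric] card_roots p q q2 r)
  finally have eq: "(\<Sum>v\<in>roots. x v * x v) - 4 * (t * t) = 8 * (w + r + t * p - q2 - t * q - 5 * (t * t))"
    by (simp add: algebra_simps)
  show ?thesis unfolding eq by (rule dvd_triv_left)
qed

text \<open>The odd positions form a word of weight 16 or 20, or the complement of such a word or of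
  the zero word, hence of weight 20, 16 or 36.\<close>

lemma resid_odd_weight:
  assumes "resid a t x" "v \<in> roots" "odd (x v)"
  shows "16 \<le> card {v \<in> roots. odd (x v)}"
proof -
  have iff: "odd (x w) \<longleftrightarrow> odd (lin a w + t)" if "w \<in> roots" for w
  proof -
    have "even (x w - lin a w - t)" using assms(1) that unfolding resid_def by blast
    then show ?thesis by auto
  qed
  have lin_even: "even (lin a w)" if "\<forall>j<6. even (a j)" for w
    using lin_cong_even[of a "\<lambda>_. 0" w] that by simp
  show ?thesis
  proof (cases "even t")
    case True
    then have "{v \<in> roots. odd (x v)} = {v \<in> roots. odd (lin a v)}" using iff by auto
    then have c: "card {v \<in> roots. odd (x v)} = wt a" by (simp add: wt_def)
    obtain j where "j < 6" "odd (a j)" using lin_even[of v] iff[OF assms(2)] assms(3) True by auto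
    then show ?thesis unfolding c using wt_cases[of j a] by auto
  next
    case False
    have eq: "{v \<in> roots. odd (x v)} = roots - {v \<in> roots. odd (lin a v)}" using iff False by auto
    have c: "card {v \<in> roots. odd (x v)} = 36 - wt a"
      unfolding eq wt_def by (subst card_Diff_subset) (auto simp: card_roots)
    show ?thesis
    proof (cases "\<exists>j<6. odd (a j)")
      case True
      then obtain j where "j < 6" "odd (a j)" by blast
      then show ?thesis using wt_cases[of j a] c by auto
    next
      case False
      then have "wt a = 0" unfolding wt_def using lin_even by auto
      then show ?thesis using c by simp
    qed
  qed
qed

lemma one_le_square: "x \<noteq> 0 \<Longrightarrow> 1 \<le> x * x" for x :: int
  using zero_less_mult_iff[of x x] by linarith

lemma sum_square_odd_part:
  fixes x :: "'a \<Rightarrow> int"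
  assumes "finite A"
  shows "int (card {v \<in> A. odd (x v)}) \<le> (\<Sum>v\<in>A. x v * x v)"
    and "(\<Sum>v\<in>A. x v * x v) \<le> int (card {v \<in> A. odd (x v)}) \<Longrightarrow> v \<in> A \<Longrightarrow>
      x v * x v = (if odd (x v) then 1 else 0)"
proof -
  have c: "int (card {v \<in> A. odd (x v)}) = (\<Sum>v\<in>A. if odd (x v) then 1 else 0)"
    using assms by (simp add: sum.If_cases Int_def)
  have le: "(if odd (y) then 1 else 0) \<le> y * y" for y :: int
  proof (cases "y = 0")
    case False
    then have "0 < y * y" by (auto simp: zero_less_mult_iff)
    then show ?thesis by auto
  qed auto
  show "int (card {v \<in> A. odd (x v)}) \<le> (\<Sum>v\<in>A. x v * x v)"
    unfolding c by (rule sum_mono) (rule le)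
  assume *: "(\<Sum>v\<in>A. x v * x v) \<le> int (card {v \<in> A. odd (x v)})" "v \<in> A"
  have "(\<Sum>v\<in>A. x v * x v - (if odd (x v) then 1 else 0)) = 0"
    using * sum_mono[of A "\<lambda>v. if odd (x v) then 1 else 0" "\<lambda>v. x v * x v", OF le]
    unfolding c sum_subtractf by simp
  then show "x v * x v = (if odd (x v) then 1 else 0)"
    using sum_nonneg_eq_0_iff[OF assms, of "\<lambda>v. x v * x v - (if odd (x v) then 1 else 0)"] le * by force
qed

lemma sum_odd_part:
  fixes y g :: "'a \<Rightarrow> int"
  assumes "finite A"
  shows "even ((\<Sum>v\<in>A. y v * g v) - (\<Sum>v\<in>{v \<in> A. odd (y v)}. g v))"
proof -
  have "(\<Sum>v\<in>{v \<in> A. odd (y v)}. g v) = (\<Sum>v\<in>A. if odd (y v) then g v else 0)"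
    using assms by (simp add: sum.inter_filter)
  then have "(\<Sum>v\<in>A. y v * g v) - (\<Sum>v\<in>{v \<in> A. odd (y v)}. g v)
      = (\<Sum>v\<in>A. y v * g v - (if odd (y v) then g v else 0))" by (simp add: sum_subtractf)
  also have "even \<dots>" by (rule dvd_sum) auto
  finally show ?thesis .
qed

lemma even_sum_lin_iff: "(\<forall>a. even (\<Sum>v\<in>S. lin a v)) \<longleftrightarrow> (\<forall>j<6. even (\<Sum>v\<in>S. v ! j))"
proof
  assume *: "\<forall>a. even (\<Sum>v\<in>S. lin a v)"
  show "\<forall>j<6. even (\<Sum>v\<in>S. v ! j)"
  proof (intro allI impI)
    fix j :: nat assume "j < 6"
    then show "even (\<Sum>v\<in>S. v ! j)"
      using *[THEN spec, of "\<lambda>i. if i = j then 1 else 0"] by (simp add: lin_unit)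
  qed
next
  assume *: "\<forall>j<6. even (\<Sum>v\<in>S. v ! j)"
  have "even (\<Sum>j<6. a j * (\<Sum>v\<in>S. v ! j))" for a :: "nat \<Rightarrow> int"
    by (rule dvd_sum, rule dvd_mult) (use * in simp)
  then show "\<forall>a. even (\<Sum>v\<in>S. lin a v)" unfolding sum_lin_coord by blast
qed

lemma codeK_cong: "(\<And>v. v \<in> roots \<Longrightarrow> x v = y v) \<Longrightarrow> codeK x \<longleftrightarrow> codeK y"
  by (simp add: codeK_def resid_def cong: sum.cong)

lemma codeL_cong: "(\<And>v. v \<in> roots \<Longrightarrow> x v = y v) \<Longrightarrow> codeL x \<longleftrightarrow> codeL y"
  using codeK_cong[of x y] by (simp add: codeL_def cong: sum.cong)

lemma codeS_cong: "(\<And>v. v \<in> roots \<Longrightarrow> x v = y v) \<Longrightarrow> codeS x \<longleftrightarrow> codeS y"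
  using codeK_cong[of x y] by (simp add: codeS_def cong: sum.cong)

text \<open>For doubled vectors the conditions modulo 4 become conditions modulo 2 on the set of odd
  entries of \<open>y\<close>: this is the torsion code.\<close>

lemma codeK_double:
  "codeK (\<lambda>v. 2 * y v) \<longleftrightarrow> (\<forall>j<6. even (\<Sum>v\<in>{v \<in> roots. odd (y v)}. v ! j))"
proof -
  have "resid (\<lambda>_. 0) 0 (\<lambda>v. 2 * y v)" by (simp add: resid_def)
  moreover have "4 dvd (\<Sum>v\<in>roots. 2 * y v * lin a v) \<longleftrightarrow> even (\<Sum>v\<in>{v \<in> roots. odd (y v)}. lin a v)" for a
  proof -
    have "(\<Sum>v\<in>roots. 2 * y v * lin a v) = 2 * (\<Sum>v\<in>roots. y v * lin a v)"
      by (simp add: sum_distrib_left mult.assoc)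
    then have "4 dvd (\<Sum>v\<in>roots. 2 * y v * lin a v) \<longleftrightarrow> even (\<Sum>v\<in>roots. y v * lin a v)" by auto
    then show ?thesis using sum_odd_part[OF finite_roots, of y "lin a"] by auto
  qed
  ultimately show ?thesis unfolding codeK_def even_sum_lin_iff[symmetric] by auto
qed

lemma sum_double_parity: "even (sum y roots) \<longleftrightarrow> even (card {v \<in> roots. odd (y v :: int)})"
  using sum_odd_part[OF finite_roots, of y "\<lambda>_. 1"] by auto

lemma codeL_double:
  "codeL (\<lambda>v. 2 * y v) \<longleftrightarrow> (\<forall>j<6. even (\<Sum>v\<in>{v \<in> roots. odd (y v)}. v ! j)) \<and>
     even (card {v \<in> roots. odd (y v)})"
proof -
  have "4 dvd (\<Sum>v\<in>roots. 2 * y v) \<longleftrightarrow> even (sum y roots)"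
    by (simp add: sum_distrib_left[symmetric]) presburger
  then show ?thesis by (simp add: codeL_def codeK_double sum_double_parity)
qed

lemma codeS_double:
  "codeS (\<lambda>v. 2 * y v) \<longleftrightarrow> (\<forall>j<6. even (\<Sum>v\<in>{v \<in> roots. odd (y v)}. v ! j)) \<and>
     odd (card {v \<in> roots. odd (y v)})"
proof -
  have "4 dvd (\<Sum>v\<in>roots. 2 * y v) \<longleftrightarrow> even (sum y roots)" "even (\<Sum>v\<in>roots. 2 * y v)"
    by (simp_all add: sum_distrib_left[symmetric]) presburger
  then show ?thesis by (simp add: codeS_def codeK_double sum_double_parity)
qed

lemma even_coords_card:
  assumes S: "S \<subseteq> roots" "\<forall>j<6. even (\<Sum>v\<in>S. v ! j)"
  shows "card S \<noteq> 1" "card S \<noteq> 2"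
proof -
  show "card S \<noteq> 1"
  proof
    assume "card S = 1"
    then obtain v where "S = {v}" by (auto simp: card_1_singleton_iff)
    then show False using S root_odd_coord[of v] by auto
  qed
  show "card S \<noteq> 2"
  proof
    assume "card S = 2"
    then obtain v w where "S = {v, w}" "v \<noteq> w" by (auto simp: card_2_iff)
    then show False using S root_eq_mod_2[of v w] by auto
  qed
qed

lemma even_function_half:
  assumes "\<And>v. v \<in> roots \<Longrightarrow> even (x v :: int)"
  obtains y where "\<And>v. v \<in> roots \<Longrightarrow> x v = 2 * y v"
  using assms by (auto intro: that[of "\<lambda>v. x v div 2"])

text \<open>A single odd entry already forces 16. Otherwise \<open>x\<close> is twice a vector whose
  odd support has odd size and even sum of roots; no single root is even, so the size is at least
  3.\<close>

lemma codeS_min: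
  assumes "codeS x"
  shows "12 \<le> (\<Sum>v\<in>roots. x v * x v)"
    and "(\<Sum>v\<in>roots. x v * x v) = 12 \<Longrightarrow> v \<in> roots \<Longrightarrow> even (x v)"
proof -
  obtain a t where r: "resid a t x" using assms by (auto simp: codeS_def codeK_def)
  have 16: "16 \<le> (\<Sum>v\<in>roots. x v * x v)" if "v \<in> roots" "odd (x v)" for v
    using resid_odd_weight[OF r that] sum_square_odd_part(1)[OF finite_roots, of x] by linarith
  show "(\<Sum>v\<in>roots. x v * x v) = 12 \<Longrightarrow> v \<in> roots \<Longrightarrow> even (x v)" using 16 by force
  show "12 \<le> (\<Sum>v\<in>roots. x v * x v)"
  proof (cases "\<exists>v\<in>roots. odd (x v)")
    case True
    then show ?thesis using 16 by force
  next
    case False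
    then obtain y where y: "\<And>v. v \<in> roots \<Longrightarrow> x v = 2 * y v" using even_function_half[of x] by blast
    define S where "S = {v \<in> roots. odd (y v)}"
    have "codeS (\<lambda>v. 2 * y v)" using codeS_cong[OF y] assms by simp
    then have S: "\<forall>j<6. even (\<Sum>v\<in>S. v ! j)" "odd (card S)"
      unfolding codeS_double S_def by auto
    have "card S \<noteq> 1" by (rule even_coords_card(1)[OF _ S(1)]) (auto simp: S_def)
    then have "3 \<le> card S" using S(2) by presburger
    then have "3 \<le> (\<Sum>v\<in>roots. y v * y v)"
      using sum_square_odd_part(1)[OF finite_roots, of y] unfolding S_def by linarith
    moreover have "(\<Sum>v\<in>roots. x v * x v) = 4 * (\<Sum>v\<in>roots. y v * y v)"
      unfolding sum_distrib_left by (rule sum.cong) (auto simp: y)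
    ultimately show ?thesis by linarith
  qed
qed

lemma codeL_even_cases:
  assumes "codeL x" "\<And>v. v \<in> roots \<Longrightarrow> x v = 2 * y v" "\<exists>v\<in>roots. x v \<noteq> 0"
  shows "4 \<le> (\<Sum>v\<in>roots. y v * y v)"
    and "(\<Sum>v\<in>roots. y v * y v) = 4 \<Longrightarrow> (\<forall>v\<in>roots. even (y v)) \<or>
      card {v \<in> roots. odd (y v)} = 4 \<and> (\<forall>j<6. even (\<Sum>v\<in>{v \<in> roots. odd (y v)}. v ! j))"
proof -
  define S where "S = {v \<in> roots. odd (y v)}"
  have "codeL (\<lambda>v. 2 * y v)" using codeL_cong[OF assms(2)] assms(1) by simp
  then have S: "\<forall>j<6. even (\<Sum>v\<in>S. v ! j)" "even (card S)"
    unfolding codeL_double S_def by auto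
  have "card S \<noteq> 2" by (rule even_coords_card(2)[OF _ S(1)]) (auto simp: S_def)
  then have card: "card S = 0 \<or> 4 \<le> card S" using S(2) by presburger
  have le: "int (card S) \<le> (\<Sum>v\<in>roots. y v * y v)"
    using sum_square_odd_part(1)[OF finite_roots, of y] unfolding S_def .
  have fin: "finite S" by (simp add: S_def)
  show "(\<Sum>v\<in>roots. y v * y v) = 4 \<Longrightarrow> (\<forall>v\<in>roots. even (y v)) \<or>
      card {v \<in> roots. odd (y v)} = 4 \<and> (\<forall>j<6. even (\<Sum>v\<in>{v \<in> roots. odd (y v)}. v ! j))"
    using card le S(1) fin unfolding S_def[symmetric] by (auto simp: S_def)
  show "4 \<le> (\<Sum>v\<in>roots. y v * y v)"
  proof (cases "card S = 0")
    case True
    then have ev: "even (y v)" if "v \<in> roots" for v using fin that by (auto simp: S_def)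
    obtain v where v: "v \<in> roots" "y v \<noteq> 0" using assms by auto
    then obtain k where k: "y v = 2 * k" "k \<noteq> 0" using ev by fastforce
    have "1 \<le> k * k" using k(2) by (rule one_le_square)
    then have "4 \<le> y v * y v" unfolding k by simp
    also have "\<dots> \<le> (\<Sum>v\<in>roots. y v * y v)" by (rule member_le_sum) (use v in auto)
    finally show ?thesis .
  next
    case False
    then show ?thesis using card le by linarith
  qed
qed

lemma codeL_min:
  assumes "codeL x" "\<exists>v\<in>roots. x v \<noteq> 0"
  shows "16 \<le> (\<Sum>v\<in>roots. x v * x v)"
proof (cases "\<exists>v\<in>roots. odd (x v)")
  case True
  obtain a t where r: "resid a t x" using assms by (auto simp: codeL_def codeK_def)
  show ?thesis
    using True resid_odd_weight[OF r] sum_square_odd_part(1)[OF finite_roots, of x] by force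
next
  case False
  then obtain y where y: "\<And>v. v \<in> roots \<Longrightarrow> x v = 2 * y v" using even_function_half[of x] by blast
  have "4 \<le> (\<Sum>v\<in>roots. y v * y v)" by (rule codeL_even_cases(1)[OF assms(1) y assms(2)])
  moreover have "(\<Sum>v\<in>roots. x v * x v) = 4 * (\<Sum>v\<in>roots. y v * y v)"
    unfolding sum_distrib_left by (rule sum.cong) (auto simp: y)
  ultimately show ?thesis by linarith
qed

lemma codeL_unit: "codeL (\<lambda>w. if w = v then 4 else 0)"
proof -
  have "codeL (\<lambda>w. 2 * (if w = v then 2 else 0))" unfolding codeL_double by auto
  moreover have "(\<lambda>w. 2 * (if w = v then 2 else 0)) = (\<lambda>w. if w = v then 4 else 0 :: int)" by auto
  ultimately show ?thesis by simp
qed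

lemma codeL_lin: "codeL (lin a)"
proof -
  have "resid a 0 (lin a)" by (simp add: resid_def)
  then show ?thesis unfolding codeL_def codeK_def using sum_lin_lin_dvd sum_lin_dvd by blast
qed

lemma codeL_one: "codeL (\<lambda>_. 1)"
proof -
  have "resid (\<lambda>_. 0) 1 (\<lambda>_. 1)" by (simp add: resid_def)
  then show ?thesis unfolding codeL_def codeK_def using sum_lin_dvd card_roots by auto
qed

lemma codeK_diff:
  assumes "codeK x" "codeK y"
  shows "codeK (\<lambda>v. x v - y v)"
proof -
  obtain a t b s where r: "resid a t x" "resid b s y" using assms by (auto simp: codeK_def)
  have "resid (\<lambda>j. a j - b j) (t - s) (\<lambda>v. x v - y v)"
    unfolding resid_def lin_diff
  proof
    fix v assume "v \<in> roots"
    then have "even (x v - lin a v - t)" "even (y v - lin b v - s)"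
      using r unfolding resid_def by blast+
    then have "even ((x v - lin a v - t) - (y v - lin b v - s))" by (rule dvd_diff)
    then show "even (x v - y v - (lin a v - lin b v) - (t - s))" by (simp add: algebra_simps)
  qed
  moreover have "4 dvd (\<Sum>v\<in>roots. (x v - y v) * lin c v)" for c
    using assms by (simp add: left_diff_distrib sum_subtractf codeK_lin)
  ultimately show ?thesis by (auto simp: codeK_def)
qed

lemma codeL_diff: "codeL x \<Longrightarrow> codeL y \<Longrightarrow> codeL (\<lambda>v. x v - y v)"
  by (simp add: codeL_def codeK_diff sum_subtractf)

subsection \<open>Counting the minimal vectors\<close>

text \<open>Vectors with prescribed absolute values are parametrised by the set \<open>N\<close> of
  positions where they differ in sign from a reference \<open>c\<close>. For the words of weight 16
  the reference has to be a codeword, so it is not constant.\<close>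

definition signed :: "'a set \<Rightarrow> ('a \<Rightarrow> int) \<Rightarrow> 'a set \<Rightarrow> 'a \<Rightarrow> int" where
  "signed S c N v = (if v \<in> S then (if v \<in> N then - c v else c v) else 0)"

lemma inj_on_signed:
  assumes "\<And>v. v \<in> S \<Longrightarrow> c v \<noteq> 0"
  shows "inj_on (signed S c) (Pow S)"
proof (rule inj_onI)
  fix M N assume *: "M \<in> Pow S" "N \<in> Pow S" "signed S c M = signed S c N"
  have "v \<in> M \<longleftrightarrow> v \<in> N" if "v \<in> S" for v
    using fun_cong[OF *(3), of v] assms[OF that] that by (auto simp: signed_def split: if_splits)
  then show "M = N" using * by auto
qed

lemma signed_exhaust:
  assumes "\<And>v. v \<in> S \<Longrightarrow> x v = c v \<or> x v = - c v" "\<And>v. v \<notin> S \<Longrightarrow> x v = 0"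
  shows "x = signed S c {v \<in> S. x v \<noteq> c v}"
  using assms by (auto simp: signed_def fun_eq_iff)

lemma signed_support: "(\<And>v. v \<in> S \<Longrightarrow> c v \<noteq> 0) \<Longrightarrow> {v. signed S c N v \<noteq> 0} = S"
  by (auto simp: signed_def)

lemma sum_square_signed:
  assumes "finite A" "S \<subseteq> A"
  shows "(\<Sum>v\<in>A. signed S c N v * signed S c N v) = (\<Sum>v\<in>S. c v * c v)"
proof -
  have "(\<Sum>v\<in>A. signed S c N v * signed S c N v) = (\<Sum>v\<in>S. signed S c N v * signed S c N v)"
    by (rule sum.mono_neutral_right) (use assms in \<open>auto simp: signed_def\<close>)
  also have "\<dots> = (\<Sum>v\<in>S. c v * c v)" by (rule sum.cong) (auto simp: signed_def)
  finally show ?thesis .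
qed

definition min_codewords :: "(int list \<Rightarrow> int) set" where
  "min_codewords = {x. (\<forall>v. v \<notin> roots \<longrightarrow> x v = 0) \<and> codeL x \<and> (\<Sum>v\<in>roots. x v * x v) = 16}"

definition frame_words :: "(int list \<Rightarrow> int) set" where
  "frame_words = (\<Union>v\<in>roots. signed {v} (\<lambda>_. 4) ` Pow {v})"

definition quads :: "int list set set" where
  "quads = {S. S \<subseteq> roots \<and> card S = 4 \<and> (\<forall>j<6. even (\<Sum>v\<in>S. v ! j))}"

definition quad_words :: "(int list \<Rightarrow> int) set" where
  "quad_words = (\<Union>S\<in>quads. signed S (\<lambda>_. 2) ` Pow S)"

definition msupp :: "int list \<Rightarrow> int list set" where
  "msupp l = {v \<in> roots. odd (lin ((!) l) v)}"

text \<open>Index 6 stands for the constant function 1: the seven conditions express orthogonality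
  to all affine functions modulo 2.\<close>

definition mflips :: "int list \<Rightarrow> int list set set" where
  "mflips l = {N \<in> Pow (msupp l). \<forall>j\<in>{..<7}. even (\<Sum>v\<in>N. if j < 6 then v ! j else 1)}"

definition minuscule_words :: "(int list \<Rightarrow> int) set" where
  "minuscule_words = (\<Union>l\<in>set minuscule_list. signed (msupp l) (lin ((!) l)) ` mflips l)"

lemma card_UN_signed:
  assumes "finite I" "\<And>i. i \<in> I \<Longrightarrow> finite (S i)" "\<And>i. i \<in> I \<Longrightarrow> F i \<subseteq> Pow (S i)"
    "\<And>i. i \<in> I \<Longrightarrow> card (F i) = k" "\<And>i v. i \<in> I \<Longrightarrow> v \<in> S i \<Longrightarrow> c i v \<noteq> 0" "inj_on S I"
  shows "card (\<Union>i\<in>I. signed (S i) (c i) ` F i) = card I * k"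
    and "finite (\<Union>i\<in>I. signed (S i) (c i) ` F i)"
proof -
  have fin: "finite (F i)" if "i \<in> I" for i
    using assms(2,3)[OF that] by (meson finite_Pow_iff finite_subset)
  have "card (\<Union>i\<in>I. signed (S i) (c i) ` F i) = (\<Sum>i\<in>I. card (signed (S i) (c i) ` F i))"
  proof (rule card_UN_disjoint)
    show "\<forall>i\<in>I. \<forall>j\<in>I. i \<noteq> j \<longrightarrow> signed (S i) (c i) ` F i \<inter> signed (S j) (c j) ` F j = {}"
    proof (intro ballI impI)
      fix i j assume ij: "i \<in> I" "j \<in> I" "i \<noteq> j"
      show "signed (S i) (c i) ` F i \<inter> signed (S j) (c j) ` F j = {}"
      proof (rule ccontr)
        assume "\<not> ?thesis"
        then obtain M N where "signed (S i) (c i) M = signed (S j) (c j) N" by blast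
        then have "S i = S j" using signed_support[of "S i" "c i" M] signed_support[of "S j" "c j" N] assms(5) ij
          by metis
        then show False using ij assms(6) by (auto dest: inj_onD)
      qed
    qed
  qed (use assms(1) fin in auto)
  also have "\<dots> = (\<Sum>i\<in>I. k)"
  proof (rule sum.cong)
    fix i assume i: "i \<in> I"
    have "inj_on (signed (S i) (c i)) (F i)"
      using inj_on_signed[of "S i" "c i"] assms(3,5)[OF i] inj_on_subset by blast
    then show "card (signed (S i) (c i) ` F i) = k" using assms(4)[OF i] by (simp add: card_image)
  qed simp
  finally show "card (\<Union>i\<in>I. signed (S i) (c i) ` F i) = card I * k" by simp
  show "finite (\<Union>i\<in>I. signed (S i) (c i) ` F i)" using assms(1) fin by auto
qed

lemma finite_quads: "finite quads"
  by (rule finite_subset[of _ "Pow roots"]) (auto simp: quads_def)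

lemma card_frame_words: "card frame_words = 72" "finite frame_words"
proof -
  have "card (\<Union>v\<in>roots. signed ((\<lambda>v. {v}) v) ((\<lambda>_ _. 4) v) ` Pow {v}) = card roots * 2"
    by (rule card_UN_signed(1)) (auto simp: card_Pow)
  then show "card frame_words = 72" by (simp add: frame_words_def card_roots)
  show "finite frame_words" by (simp add: frame_words_def)
qed

lemma card_quad_words: "card quad_words = 945 * 16" "finite quad_words"
proof -
  have *: "finite S \<and> card S = 4" if "S \<in> quads" for S
    using that by (auto simp: quads_def intro: finite_subset)
  have "card (\<Union>S\<in>quads. signed ((\<lambda>S. S) S) ((\<lambda>_ _. 2) S) ` Pow S) = card quads * 16"
    by (rule card_UN_signed(1)) (use finite_quads * in \<open>auto simp: card_Pow inj_on_def\<close>)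
  moreover have "card quads = 945" using card_quadruples by (simp add: quads_def)
  ultimately show "card quad_words = 945 * 16" by (simp add: quad_words_def)
  show "finite quad_words" using * finite_quads by (auto simp: quad_words_def)
qed

text \<open>If an affine function with linear part \<open>a\<close> is even on the support of
  \<open>l\<close>, the support of \<open>a\<close> is disjoint from it or contains it. Then
  \<open>a + l\<close> has weight at least 32 or at most 4, which no nonzero linear function
  has.\<close>

lemma wt_add:
  assumes "wt l = 16" "wt a \<in> {16, 20}" "\<exists>j<6. odd (a j + l j)"
    "\<forall>v\<in>roots. odd (lin l v) \<longrightarrow> even (lin a v + s)"
  shows False
proof -
  let ?S = "\<lambda>a. {v \<in> roots. odd (lin a v)}"
  have w: "wt (\<lambda>j. a j + l j) \<in> {16, 20}" using wt_cases[of _ "\<lambda>j. a j + l j"] assms(3) by auto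
  have odd_add: "?S (\<lambda>j. a j + l j) = (?S a - ?S l) \<union> (?S l - ?S a)"
    unfolding lin_add by auto
  show False
  proof (cases "even s")
    case True
    then have dis: "?S a \<inter> ?S l = {}" using assms(4) by auto
    then have "?S (\<lambda>j. a j + l j) = ?S a \<union> ?S l" unfolding odd_add by blast
    then have "wt (\<lambda>j. a j + l j) = wt a + wt l"
      using dis unfolding wt_def by (simp add: card_Un_disjoint)
    then show False using w assms(1,2) by auto
  next
    case False
    then have "?S l \<subseteq> ?S a" using assms(4) by auto
    then have "?S (\<lambda>j. a j + l j) = ?S a - ?S l" unfolding odd_add by blast
    then have "wt (\<lambda>j. a j + l j) = wt a - wt l"
      using \<open>?S l \<subseteq> ?S a\<close> unfolding wt_def by (simp add: card_Diff_subset)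
    then show False using w assms(1,2) by auto
  qed
qed

text \<open>Restricted to the 16 positions, the seven affine generators satisfy exactly one relation
  and so have rank 6, which leaves 16 - 6 = 10 free signs.\<close>

lemma card_mflips:
  assumes l: "l \<in> set minuscule_list"
  shows "card (mflips l) = 1024"
proof -
  let ?A = "\<lambda>j v. if j < 6 then v ! j else (1::int)"
  \<comment> \<open>Coefficient set of the affine function \<open>l + 1\<close> modulo 2, the
    nonzero one that vanishes on the support of \<open>l\<close>.\<close>
  define lo where "lo = insert 6 {j. j < 6 \<and> odd (l ! j)}"
  have w: "wt ((!) l) = 16" by (rule minuscule_bound(3)[OF l])
  then have cS: "card (msupp l) = 16" by (simp add: wt_def msupp_def)
  have sum_A: "(\<Sum>j\<in>c. ?A j v) = lin (\<lambda>j. if j \<in> c then 1 else 0) v + (if 6 \<in> c then 1 else 0)"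
    if c: "c \<subseteq> {..<7}" for c v
  proof -
    have "(\<Sum>j\<in>c. ?A j v) = (\<Sum>j<7. if j \<in> c then ?A j v else 0)"
      using c by (simp add: sum.inter_restrict[symmetric] Int_absorb1)
    also have "{..<7::nat} = insert 6 {..<6}" by auto
    finally show ?thesis unfolding lin_def by (auto intro!: sum.cong)
  qed
  have "{c \<in> Pow {..<7}. \<forall>v\<in>msupp l. even (\<Sum>j\<in>c. ?A j v)} = {{}, lo}"
  proof (intro set_eqI iffI)
    fix c assume "c \<in> {c \<in> Pow {..<7}. \<forall>v\<in>msupp l. even (\<Sum>j\<in>c. ?A j v)}"
    then have c: "c \<subseteq> {..<7}" "\<And>v. v \<in> msupp l \<Longrightarrow> even (\<Sum>j\<in>c. ?A j v)" by auto
    define a :: "nat \<Rightarrow> int" where "a = (\<lambda>j. if j \<in> c then 1 else 0)"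
    define s :: int where "s = (if 6 \<in> c then 1 else 0)"
    have ev: "\<forall>v\<in>roots. odd (lin ((!) l) v) \<longrightarrow> even (lin a v + s)"
      using c(2) sum_A[OF c(1)] by (auto simp: msupp_def a_def s_def)
    obtain v where v: "v \<in> msupp l" using cS by (metis card.empty ex_in_conv zero_neq_numeral)
    consider "\<forall>j<6. even (a j)" | "\<forall>j<6. even (a j + l ! j)"
      using wt_add[OF w _ _ ev] wt_cases[of _ a] by blast
    then show "c \<in> {{}, lo}"
    proof cases
      case 1
      then have "even (lin a v)" using lin_cong_even[of a "\<lambda>_. 0" v] by simp
      then have "6 \<notin> c" using ev v by (auto simp: msupp_def s_def split: if_splits)
      moreover have "j \<notin> c" if "j < 6" for j using 1 that by (auto simp: a_def)
      ultimately have "j \<notin> c" for j using c(1) by (cases "j < 6"; cases "j = 6") auto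
      then show ?thesis by auto
    next
      case 2
      then have "even (lin a v - lin ((!) l) v)" by (intro lin_cong_even) auto
      then have "6 \<in> c" using ev v by (auto simp: msupp_def s_def split: if_splits)
      moreover have "j \<in> c \<longleftrightarrow> odd (l ! j)" if "j < 6" for j
        using 2 that by (auto simp: a_def split: if_splits)
      moreover have "j < 6 \<or> j = 6" if "j \<in> c" for j using c(1) that by force
      ultimately have "c = lo" unfolding lo_def by blast
      then show ?thesis by simp
    qed
  next
    fix c assume "c \<in> {{}, lo}"
    moreover have "lo \<subseteq> {..<7}" by (auto simp: lo_def)
    moreover have "even (\<Sum>j\<in>lo. ?A j v)" if "v \<in> msupp l" for v
    proof -
      have "even (lin (\<lambda>j. if j \<in> lo then 1 else 0) v - lin ((!) l) v)"
        by (rule lin_cong_even) (auto simp: lo_def)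
      moreover have "6 \<in> lo" by (simp add: lo_def)
      ultimately show ?thesis using sum_A[OF \<open>lo \<subseteq> {..<7}\<close>] that by (auto simp: msupp_def)
    qed
    ultimately show "c \<in> {c \<in> Pow {..<7}. \<forall>v\<in>msupp l. even (\<Sum>j\<in>c. ?A j v)}" by auto
  qed
  moreover have "lo \<noteq> {}" by (simp add: lo_def)
  ultimately have "card {c \<in> Pow {..<7}. \<forall>v\<in>msupp l. even (\<Sum>j\<in>c. ?A j v)} = 2" by simp
  moreover have "card (mflips l) * 2 ^ card {..<7::nat}
      = card {c \<in> Pow {..<7}. \<forall>v\<in>msupp l. even (\<Sum>j\<in>c. ?A j v)} * 2 ^ card (msupp l)"
    unfolding mflips_def by (rule card_F2_kernel) (auto simp: msupp_def)
  ultimately show ?thesis by (simp add: cS)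
qed

lemma card_minuscule_words: "card minuscule_words = 27 * 1024" "finite minuscule_words"
proof -
  have inj: "inj_on msupp (set minuscule_list)"
  proof (rule inj_onI)
    fix l l' assume *: "l \<in> set minuscule_list" "l' \<in> set minuscule_list" "msupp l = msupp l'"
    show "l = l'"
    proof (rule minuscule_distinct[OF *(1,2)])
      fix j :: nat assume j: "j < 6"
      have "simple j \<in> msupp l \<longleftrightarrow> simple j \<in> msupp l'" using * by simp
      then show "even (l ! j - l' ! j)" using simple_root[OF j] by (simp add: msupp_def lin_simple[OF j])
    qed
  qed
  have fin: "finite (msupp l)" and sub: "mflips l \<subseteq> Pow (msupp l)"
    and nz: "v \<in> msupp l \<Longrightarrow> lin ((!) l) v \<noteq> 0" for l v
    by (auto simp: msupp_def mflips_def)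
  have "card minuscule_words = card (set minuscule_list) * 1024" "finite minuscule_words"
    unfolding minuscule_words_def
    by (rule card_UN_signed; simp add: inj fin sub card_mflips nz)+
  then show "card minuscule_words = 27 * 1024" "finite minuscule_words" by (simp_all add: card_minuscule)
qed

lemma words_disjoint:
  "frame_words \<inter> quad_words = {}" "(frame_words \<union> quad_words) \<inter> minuscule_words = {}"
proof -
  define supp where "supp x = {v. x v \<noteq> (0::int)}" for x :: "int list \<Rightarrow> int"
  have "card (supp x) = 1" if "x \<in> frame_words" for x
    using that by (auto simp: supp_def frame_words_def signed_support)
  moreover have "card (supp x) = 4" if "x \<in> quad_words" for x
    using that by (auto simp: supp_def quad_words_def signed_support quads_def)
  moreover have "card (supp x) = 16" if x: "x \<in> minuscule_words" for x
  proof -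
    obtain l N where l: "l \<in> set minuscule_list" "x = signed (msupp l) (lin ((!) l)) N"
      using x by (auto simp: minuscule_words_def)
    have "supp x = msupp l" unfolding l(2) supp_def by (rule signed_support) (auto simp: msupp_def)
    then show ?thesis using minuscule_bound(3)[OF l(1)] by (simp add: wt_def msupp_def)
  qed
  ultimately show "frame_words \<inter> quad_words = {}" "(frame_words \<union> quad_words) \<inter> minuscule_words = {}"
    by (force, fastforce)
qed

lemma square_eq_1: "x * x = 1 \<longleftrightarrow> x = 1 \<or> x = - 1" for x :: int
  by (metis mult_cancel_left2 mult_minus_left mult_minus_right square_eq_1_iff)

lemma sum_squares_eq_1:
  fixes z :: "'a \<Rightarrow> int"
  assumes "finite A" "(\<Sum>v\<in>A. z v * z v) = 1"
  shows "\<exists>v\<in>A. (z v = 1 \<or> z v = - 1) \<and> (\<forall>w\<in>A. w \<noteq> v \<longrightarrow> z w = 0)"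
proof -
  have "\<exists>v\<in>A. z v \<noteq> 0"
  proof (rule ccontr)
    assume "\<not> ?thesis"
    then have "(\<Sum>v\<in>A. z v * z v) = 0" by (intro sum.neutral) auto
    then show False using assms(2) by simp
  qed
  then obtain v where v: "v \<in> A" "z v \<noteq> 0" by blast
  have s: "(\<Sum>v\<in>A. z v * z v) = z v * z v + (\<Sum>w\<in>A - {v}. z w * z w)"
    using assms(1) v by (simp add: sum.remove)
  have pos: "1 \<le> z v * z v" by (rule one_le_square[OF v(2)])
  have nn: "0 \<le> (\<Sum>w\<in>A - {v}. z w * z w)" by (rule sum_nonneg) simp
  have "z v * z v = 1" "(\<Sum>w\<in>A - {v}. z w * z w) = 0" using s pos nn assms(2) by linarith+
  then show ?thesis using v square_eq_1[of "z v"] assms(1)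
    by (intro bexI[of _ v]) (auto simp: sum_nonneg_eq_0_iff)
qed

lemma min_codewords_subset: "min_codewords \<subseteq> frame_words \<union> quad_words \<union> minuscule_words"
proof
  fix x assume "x \<in> min_codewords"
  then have x: "\<And>v. v \<notin> roots \<Longrightarrow> x v = 0" "codeL x" "(\<Sum>v\<in>roots. x v * x v) = 16"
    by (auto simp: min_codewords_def)
  show "x \<in> frame_words \<union> quad_words \<union> minuscule_words"
  proof (cases "\<exists>v\<in>roots. odd (x v)")
    case False
    then obtain y where y: "\<And>v. v \<in> roots \<Longrightarrow> x v = 2 * y v" using even_function_half[of x] by blast
    define S where "S = {v \<in> roots. odd (y v)}"
    have "(\<Sum>v\<in>roots. x v * x v) = 4 * (\<Sum>v\<in>roots. y v * y v)"
      unfolding sum_distrib_left by (rule sum.cong) (auto simp: y)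
    then have y4: "(\<Sum>v\<in>roots. y v * y v) = 4" using x(3) by simp
    have "\<exists>v\<in>roots. x v \<noteq> 0"
    proof (rule ccontr)
      assume "\<not> ?thesis"
      then have "(\<Sum>v\<in>roots. x v * x v) = 0" by (intro sum.neutral) auto
      then show False using x(3) by simp
    qed
    then consider "\<forall>v\<in>roots. even (y v)" | "S \<in> quads"
      using codeL_even_cases(2)[OF x(2) y _ y4] unfolding S_def quads_def by auto
    then show ?thesis
    proof cases
      case 1
      then obtain z where z: "\<And>v. v \<in> roots \<Longrightarrow> y v = 2 * z v" using even_function_half[of y] by blast
      have "(\<Sum>v\<in>roots. y v * y v) = 4 * (\<Sum>v\<in>roots. z v * z v)"
        unfolding sum_distrib_left by (rule sum.cong) (auto simp: z)
      then have "(\<Sum>v\<in>roots. z v * z v) = 1" using y4 by simp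
      then obtain v where v: "v \<in> roots" "z v = 1 \<or> z v = - 1" "\<forall>w\<in>roots. w \<noteq> v \<longrightarrow> z w = 0"
        using sum_squares_eq_1[OF finite_roots] by blast
      have "x = signed {v} (\<lambda>_. 4) {w \<in> {v}. x w \<noteq> 4}"
      proof (rule signed_exhaust)
        fix w assume "w \<notin> {v}"
        then show "x w = 0" using x(1) y z v(3) by (cases "w \<in> roots") auto
      qed (use v y z in auto)
      then show ?thesis unfolding frame_words_def using v(1) by blast
    next
      case 2
      then have "(\<Sum>v\<in>roots. y v * y v) \<le> int (card {v \<in> roots. odd (y v)})"
        using y4 by (simp add: quads_def S_def)
      note sq = sum_square_odd_part(2)[OF finite_roots this]
      have "x = signed S (\<lambda>_. 2) {w \<in> S. x w \<noteq> 2}"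
      proof (rule signed_exhaust)
        fix v assume "v \<in> S"
        then show "x v = 2 \<or> x v = - 2" using sq[of v] y[of v] square_eq_1[of "y v"] by (auto simp: S_def)
      next
        fix v assume "v \<notin> S"
        then show "x v = 0" using sq[of v] y[of v] x(1)[of v] by (cases "v \<in> roots") (auto simp: S_def)
      qed
      then show ?thesis unfolding quad_words_def using 2 by blast
    qed
  next
    case True
    then obtain v0 where v0: "v0 \<in> roots" "odd (x v0)" by blast
    obtain a t where r: "resid a t x" using x(2) by (auto simp: codeL_def codeK_def)
    have 16: "card {v \<in> roots. odd (x v)} = 16"
      using resid_odd_weight[OF r v0] sum_square_odd_part(1)[OF finite_roots, of x] x(3) by linarith
    then have sq: "v \<in> roots \<Longrightarrow> x v * x v = (if odd (x v) then 1 else 0)" for v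
      using sum_square_odd_part(2)[OF finite_roots, of x] x(3) by simp
    \<comment> \<open>Complements of words of weight 20 also have weight 16. They belong to odd
      \<open>t\<close>, and the parity of the norm excludes them.\<close>
    have t: "even t"
    proof (rule ccontr)
      assume "odd t"
      then obtain k where "t = 2 * k + 1" by (rule oddE)
      then have e: "16 - 4 * (t * t) = 8 * (1 - 2 * k * k - 2 * k) + 4" by (simp add: algebra_simps)
      have "8 dvd 16 - 4 * (t * t)" using codeL_norm[OF x(2) r] x(3) by simp
      then show False unfolding e by presburger
    qed
    have iff: "odd (x w) \<longleftrightarrow> odd (lin a w)" if "w \<in> roots" for w
    proof -
      have "even (x w - lin a w - t)" using r that unfolding resid_def by blast
      then show ?thesis using t by auto
    qed
    then have "{v \<in> roots. odd (lin a v)} = {v \<in> roots. odd (x v)}" by auto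
    then have "wt a = 16" using 16 by (simp add: wt_def)
    then obtain l where l: "l \<in> set minuscule_list" "\<forall>j<6. even (a j - l ! j)"
      using minuscule_complete by blast
    have iff2: "odd (x w) \<longleftrightarrow> odd (lin ((!) l) w)" if "w \<in> roots" for w
      using iff[OF that] lin_cong_even[of a "(!) l" w] l(2) by auto
    define N where "N = {v \<in> msupp l. x v \<noteq> lin ((!) l) v}"
    have xs: "x = signed (msupp l) (lin ((!) l)) N"
      unfolding N_def
    proof (rule signed_exhaust)
      fix v assume v: "v \<in> msupp l"
      then have "\<bar>lin ((!) l) v\<bar> \<le> 1" "odd (lin ((!) l) v)"
        using minuscule_bound(2)[OF l(1)] by (auto simp: msupp_def)
      then have "lin ((!) l) v = 1 \<or> lin ((!) l) v = - 1" by presburger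
      then show "x v = lin ((!) l) v \<or> x v = - lin ((!) l) v"
        using sq[of v] iff2[of v] square_eq_1[of "x v"] v by (auto simp: msupp_def)
    next
      fix v assume "v \<notin> msupp l"
      then show "x v = 0" using sq[of v] iff2[of v] x(1)[of v] by (cases "v \<in> roots") (auto simp: msupp_def)
    qed
    have xv: "lin ((!) l) v - x v = (if v \<in> N then 2 * lin ((!) l) v else 0)" if v: "v \<in> roots" for v
    proof (cases "v \<in> msupp l")
      case True
      then show ?thesis using fun_cong[OF xs, of v] by (simp add: signed_def)
    next
      case False
      then have "even (lin ((!) l) v)" using v by (simp add: msupp_def)
      then have "lin ((!) l) v = 0" using minuscule_bound(2)[OF l(1) v] by presburger
      moreover have "v \<notin> N" "x v = 0" using False fun_cong[OF xs, of v] by (auto simp: N_def signed_def)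
      ultimately show ?thesis by simp
    qed
    \<comment> \<open>The difference is \<open>2 * lin l\<close> on \<open>N\<close> and 0
      elsewhere, with \<open>lin l\<close> odd on \<open>N\<close>; divisibility by 4 thus becomes
      parity of a plain sum over \<open>N\<close>.\<close>
    have key: "even (\<Sum>v\<in>N. g v)" if "4 dvd (\<Sum>v\<in>roots. (lin ((!) l) v - x v) * g v)" for g :: "_ \<Rightarrow> int"
    proof -
      have "(\<Sum>v\<in>roots. (lin ((!) l) v - x v) * g v) = (\<Sum>v\<in>roots. if v \<in> N then 2 * (lin ((!) l) v * g v) else 0)"
        by (rule sum.cong) (simp_all add: xv)
      also have "\<dots> = (\<Sum>v\<in>N. 2 * (lin ((!) l) v * g v))"
        by (rule sum.mono_neutral_cong_right) (auto simp: N_def msupp_def)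
      also have "\<dots> = 2 * (\<Sum>v\<in>N. lin ((!) l) v * g v)" by (simp add: sum_distrib_left)
      finally have "even (\<Sum>v\<in>N. lin ((!) l) v * g v)" using that by auto
      moreover have "even ((\<Sum>v\<in>N. lin ((!) l) v * g v) - (\<Sum>v\<in>N. g v))"
        unfolding sum_subtractf[symmetric] by (rule dvd_sum) (auto simp: N_def msupp_def)
      ultimately show ?thesis by auto
    qed
    have d: "codeL (\<lambda>v. lin ((!) l) v - x v)" by (rule codeL_diff[OF codeL_lin x(2)])
    have "even (\<Sum>v\<in>N. lin b v)" for b by (rule key) (use d in \<open>simp add: codeL_def codeK_lin\<close>)
    then have "\<forall>j<6. even (\<Sum>v\<in>N. v ! j)" using even_sum_lin_iff by blast
    moreover have "even (\<Sum>v\<in>N. 1::int)" by (rule key) (use d in \<open>simp add: codeL_def\<close>)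
    ultimately have "even (\<Sum>v\<in>N. if j < 6 then v ! j else 1)" for j by (cases "j < 6") simp_all
    moreover have "N \<subseteq> msupp l" by (auto simp: N_def)
    ultimately have "N \<in> mflips l" by (simp add: mflips_def)
    then show ?thesis unfolding minuscule_words_def using xs l(1) by blast
  qed
qed

lemma min_codewords_supset: "frame_words \<union> quad_words \<union> minuscule_words \<subseteq> min_codewords"
proof -
  have "x \<in> min_codewords" if "x \<in> frame_words" for x
  proof -
    obtain v N where v: "v \<in> roots" "x = signed {v} (\<lambda>_. 4) N" using \<open>x \<in> frame_words\<close> by (auto simp: frame_words_def)
    have "x = (\<lambda>w. 2 * signed {v} (\<lambda>_. 2) N w)" by (auto simp: v signed_def)
    moreover have "codeL (\<lambda>w. 2 * signed {v} (\<lambda>_. 2) N w)" unfolding codeL_double by (auto simp: signed_def)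
    ultimately have "codeL x" by simp
    then show ?thesis unfolding min_codewords_def
      using v sum_square_signed[of roots "{v}" "\<lambda>_. 4" N] by (auto simp: signed_def)
  qed
  moreover have "x \<in> min_codewords" if "x \<in> quad_words" for x
  proof -
    obtain S N where S: "S \<in> quads" "x = signed S (\<lambda>_. 2) N" using \<open>x \<in> quad_words\<close> by (auto simp: quad_words_def)
    have "x = (\<lambda>w. 2 * signed S (\<lambda>_. 1) N w)" by (auto simp: S signed_def)
    moreover have "{v \<in> roots. odd (signed S (\<lambda>_. 1) N v)} = S" using S by (auto simp: signed_def quads_def)
    then have "codeL (\<lambda>w. 2 * signed S (\<lambda>_. 1) N w)" unfolding codeL_double using S by (simp add: quads_def)
    ultimately have "codeL x" by simp
    then show ?thesis unfolding min_codewords_def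
      using S sum_square_signed[of roots S "\<lambda>_. 2" N] by (auto simp: signed_def quads_def)
  qed
  moreover have "x \<in> min_codewords" if "x \<in> minuscule_words" for x
  proof -
    obtain l N where l: "l \<in> set minuscule_list" "N \<in> mflips l" "x = signed (msupp l) (lin ((!) l)) N"
      using \<open>x \<in> minuscule_words\<close> by (auto simp: minuscule_words_def)
    let ?f = "lin ((!) l)"
    have off: "?f v = 0" if "v \<in> roots" "v \<notin> msupp l" for v
      using minuscule_bound(2)[OF l(1) that(1)] that by (auto simp: msupp_def)
    have xv: "x v = ?f v - 2 * (if v \<in> N then ?f v else 0)" if "v \<in> roots" for v
      using that off[OF that] l(2) by (auto simp: l(3) signed_def mflips_def)
    have e: "even (\<Sum>v\<in>N. if j < 6 then v ! j else 1)" if "j < 7" for j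
      using l(2) that unfolding mflips_def by blast
    have "even (\<Sum>v\<in>N. v ! j)" if "j < 6" for j using e[of j] that by simp
    then have N: "N \<subseteq> msupp l" "\<forall>j<6. even (\<Sum>v\<in>N. v ! j)" "even (card N)"
      using l(2) e[of 6] by (auto simp: mflips_def)
    have odd_part: "{v \<in> roots. odd (if v \<in> N then ?f v else 0)} = N"
      using N(1) by (auto simp: msupp_def)
    have "codeL (\<lambda>v. 2 * (if v \<in> N then ?f v else 0))"
      unfolding codeL_double odd_part using N by simp
    then have "codeL (\<lambda>v. ?f v - 2 * (if v \<in> N then ?f v else 0))" by (rule codeL_diff[OF codeL_lin])
    then have "codeL x" using codeL_cong[OF xv] by simp
    moreover have "(\<Sum>v\<in>roots. x v * x v) = (\<Sum>v\<in>msupp l. ?f v * ?f v)"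
      unfolding l(3) by (rule sum_square_signed) (auto simp: msupp_def)
    moreover have "(\<Sum>v\<in>msupp l. ?f v * ?f v) = (\<Sum>v\<in>msupp l. 1)"
    proof (rule sum.cong)
      fix v assume v: "v \<in> msupp l"
      then have "\<bar>?f v\<bar> \<le> 1" "odd (?f v)" using minuscule_bound(2)[OF l(1)] by (auto simp: msupp_def)
      then have "?f v = 1 \<or> ?f v = - 1" by presburger
      then show "?f v * ?f v = 1" by auto
    qed simp
    moreover have "card (msupp l) = 16" using minuscule_bound(3)[OF l(1)] by (simp add: wt_def msupp_def)
    ultimately show ?thesis unfolding min_codewords_def by (auto simp: l(3) signed_def msupp_def)
  qed
  ultimately show ?thesis by blast
qed

lemma card_min_codewords: "card min_codewords = 42840"
proof -
  have "min_codewords = frame_words \<union> quad_words \<union> minuscule_words"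
    using min_codewords_subset min_codewords_supset by auto
  moreover have "card (frame_words \<union> quad_words) = card frame_words + card quad_words"
    by (intro card_Un_disjoint card_frame_words card_quad_words words_disjoint)
  moreover have "card (frame_words \<union> quad_words \<union> minuscule_words)
      = card (frame_words \<union> quad_words) + card minuscule_words"
    by (intro card_Un_disjoint finite_UnI card_frame_words card_quad_words card_minuscule_words words_disjoint)
  ultimately show ?thesis by (simp add: card_frame_words card_quad_words card_minuscule_words)
qed

subsection \<open>The lattice\<close>

text \<open>The numbering is arbitrary; \<open>vecr\<close> and \<open>coord\<close> let the later
  arguments speak of coordinates indexed by roots.\<close>

definition root_of :: "36 \<Rightarrow> int list" where
  "root_of = (SOME f. bij_betw f UNIV roots)"

lemma bij_root_of: "bij_betw root_of UNIV roots"
proof -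
  have "\<exists>f :: 36 \<Rightarrow> int list. bij_betw f UNIV roots"
    by (rule finite_same_card_bij) (simp_all add: card_roots)
  then show ?thesis unfolding root_of_def by (rule someI_ex)
qed

definition idx_of :: "int list \<Rightarrow> 36" where
  "idx_of = inv root_of"

lemma root_of_idx [simp]: "v \<in> roots \<Longrightarrow> root_of (idx_of v) = v"
  using bij_root_of by (simp add: idx_of_def bij_betw_def f_inv_into_f)

lemma idx_root_of [simp]: "idx_of (root_of i) = i"
  using bij_root_of by (simp add: idx_of_def bij_betw_def)

lemma root_of_root [simp]: "root_of i \<in> roots"
  using bij_root_of by (auto simp: bij_betw_def)

lemma sum_root_of: "(\<Sum>i\<in>UNIV. f (root_of i)) = sum f roots"
  by (rule sum.reindex_bij_betw[OF bij_root_of])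

definition vecr :: "(int list \<Rightarrow> real) \<Rightarrow> real ^ 36" where
  "vecr f = (\<chi> i. f (root_of i))"

definition coord :: "real ^ 36 \<Rightarrow> int list \<Rightarrow> real" where
  "coord y v = y $ idx_of v"

lemma vecr_coord [simp]: "vecr (coord y) = y"
  by (simp add: vecr_def coord_def vec_eq_iff)

lemma coord_vecr [simp]: "v \<in> roots \<Longrightarrow> coord (vecr f) v = f v"
  by (simp add: vecr_def coord_def)

lemma vecr_eq_iff: "vecr f = vecr g \<longleftrightarrow> (\<forall>v\<in>roots. f v = g v)"
proof
  show "vecr f = vecr g \<Longrightarrow> \<forall>v\<in>roots. f v = g v" by (metis coord_vecr)
  show "\<forall>v\<in>roots. f v = g v \<Longrightarrow> vecr f = vecr g" by (simp add: vecr_def vec_eq_iff)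
qed

lemma inner_vecr: "vecr f \<bullet> vecr g = (\<Sum>v\<in>roots. f v * g v)"
  unfolding sum_root_of[symmetric] by (simp add: vecr_def inner_vec_def)

lemma inner_coord: "y \<bullet> vecr g = (\<Sum>v\<in>roots. coord y v * g v)"
  using inner_vecr[of "coord y" g] by simp

lemma dvd_double_iff: "4 dvd 2 * x \<longleftrightarrow> even x" "8 dvd 4 * x \<longleftrightarrow> even x" for x :: int
  by presburger+

definition half_vec :: "(int list \<Rightarrow> int) \<Rightarrow> real ^ 36" where
  "half_vec x = vecr (\<lambda>v. real_of_int (x v) / 2)"

lemma half_vec_eq_iff: "half_vec x = half_vec y \<longleftrightarrow> (\<forall>v\<in>roots. x v = y v)"
  by (simp add: half_vec_def vecr_eq_iff)

lemma inner_half_vec: "half_vec x \<bullet> half_vec y = of_int (\<Sum>v\<in>roots. x v * y v) / 4"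
  by (simp add: half_vec_def inner_vecr sum_divide_distrib)

lemma inner_coord_half_vec: "y \<bullet> half_vec x = (\<Sum>v\<in>roots. coord y v * of_int (x v)) / 2"
  by (simp add: half_vec_def inner_coord sum_divide_distrib)

lemma half_vec_diff: "half_vec x - half_vec y = half_vec (\<lambda>v. x v - y v)"
  by (simp add: half_vec_def vecr_def vec_eq_iff diff_divide_distrib)

definition unit_vec :: "int list \<Rightarrow> real ^ 36" where
  "unit_vec v = vecr (\<lambda>w. if w = v then 1 else 0)"

lemma inner_unit_vec: "v \<in> roots \<Longrightarrow> y \<bullet> unit_vec v = coord y v"
  by (simp add: unit_vec_def inner_coord if_distrib[of "\<lambda>x. _ * x"] cong: if_cong)

lemma half_vec_unit: "half_vec (\<lambda>w. if w = v then 4 else 0) = 2 *\<^sub>R unit_vec v"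
  by (simp add: half_vec_def unit_vec_def vecr_def vec_eq_iff)

definition lattice36 :: "(real ^ 36) set" where
  "lattice36 = {half_vec x | x. codeL x}"

lemma half_vec_lattice36 [simp]: "half_vec x \<in> lattice36 \<longleftrightarrow> codeL x"
  unfolding lattice36_def using half_vec_eq_iff codeL_cong by blast

lemma div_4_Ints: "real_of_int k / 4 \<in> \<int> \<longleftrightarrow> 4 dvd k"
proof
  assume "real_of_int k / 4 \<in> \<int>"
  then obtain m where "real_of_int k / 4 = of_int m" by (auto elim: Ints_cases)
  then have "real_of_int k = of_int (4 * m)" by simp
  then show "4 dvd k" by (simp only: of_int_eq_iff) simp
qed auto

text \<open>Integrality against the even sublattice leaves only the coordinate sum modulo 4
  undecided. The lemma therefore serves both self-duality, with the all-one vector as a further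
  test, and the description of the shadow.\<close>

lemma codeK_test:
  assumes "\<And>x a. codeL x \<Longrightarrow> resid a 0 x \<Longrightarrow> y \<bullet> half_vec x \<in> \<int>"
  shows "\<exists>z. y = half_vec z \<and> codeK z \<and> even (sum z roots)"
proof -
  have "\<exists>k. 2 * coord y v = real_of_int k" if v: "v \<in> roots" for v
  proof -
    have "y \<bullet> half_vec (\<lambda>w. if w = v then 4 else 0) \<in> \<int>"
      by (rule assms[of _ "\<lambda>_. 0"]) (auto simp: codeL_unit resid_def)
    moreover have "y \<bullet> half_vec (\<lambda>w. if w = v then 4 else 0) = 2 * coord y v"
      unfolding half_vec_unit using inner_unit_vec[OF v] by simp
    ultimately show ?thesis by (auto elim: Ints_cases)
  qed
  then obtain z where z: "\<And>v. v \<in> roots \<Longrightarrow> 2 * coord y v = real_of_int (z v)" by metis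
  have yz: "y = half_vec z"
  proof -
    have "vecr (coord y) = half_vec z" unfolding half_vec_def vecr_eq_iff using z by (auto simp: field_simps)
    then show ?thesis by simp
  qed
  have test: "4 dvd (\<Sum>v\<in>roots. z v * x v)" if "codeL x" "resid a 0 x" for x a
    using assms[OF that] unfolding yz inner_half_vec div_4_Ints .
  have lin: "4 dvd (\<Sum>v\<in>roots. z v * lin a v)" for a
    by (rule test[OF codeL_lin, of a]) (simp add: resid_def)
  \<comment> \<open>The three roots have even sum, so an affine function adds up on them to its
    constant term modulo 2.\<close>
  define t where "t = z (simple 0) + z (simple 1) + z [1,1,0,0,0,0]"
  define a where "a j = z (simple j) + t" for j
  have beta: "[1,1,0,0,0,0] \<in> roots" unfolding roots_def by code_simp
  have r: "even (z v - lin a v - t)" if v: "v \<in> roots" for v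
  proof -
    define \<kappa> where "\<kappa> = 1 + (\<Sum>j<6. v ! j)"
    \<comment> \<open>The first two summands cancel under every linear function modulo 2. Adding
      \<open>\<kappa>\<close> copies of the triple keeps this and raises the coordinate sum to
      \<open>4 * \<kappa>\<close>, so \<open>2 * c\<close> is a codeword.\<close>
    define c where "c w = (if w = v then 1 else 0) + (\<Sum>j<6. if w = simple j then v ! j else 0)
       + (if w = simple 0 then \<kappa> else 0) + (if w = simple 1 then \<kappa> else 0)
       + (if w = [1,1,0,0,0,0] then \<kappa> else 0)" for w
    have sum_c: "(\<Sum>w\<in>roots. g w * c w) = g v + (\<Sum>j<6. g (simple j) * v ! j)
        + \<kappa> * (g (simple 0) + g (simple 1) + g [1,1,0,0,0,0])" for g :: "int list \<Rightarrow> int"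
    proof -
      have 1: "(\<Sum>w\<in>roots. g w * (if w = u then k else 0)) = g u * k" if "u \<in> roots" for u k
        using that by (simp add: if_distrib[of "\<lambda>x. _ * x"] cong: if_cong)
      have 2: "(\<Sum>w\<in>roots. g w * (\<Sum>j<6. if w = simple j then v ! j else 0)) = (\<Sum>j<6. g (simple j) * v ! j)"
        unfolding sum_distrib_left by (subst sum.swap) (intro sum.cong refl 1 simple_root, simp)
      show ?thesis unfolding c_def distrib_left sum.distrib
        using 1[OF v] 2 1[OF simple_root[of 0]] 1[OF simple_root[of 1]] 1[OF beta]
        by (simp add: mult.commute)
    qed
    have lin_beta: "lin b [1,1,0,0,0,0] = b 0 + b 1" for b
      by (simp add: lin_def eval_nat_numeral)
    have lin_c: "(\<Sum>w\<in>roots. lin b w * c w) = 2 * lin b v + 2 * (\<kappa> * (b 0 + b 1))" for b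
      unfolding sum_c by (simp add: lin_simple lin_beta algebra_simps)
        (simp add: lin_def)
    have "codeL (\<lambda>w. 2 * c w)"
    proof -
      have "resid (\<lambda>_. 0) 0 (\<lambda>w. 2 * c w)" by (simp add: resid_def)
      moreover have "4 dvd (\<Sum>w\<in>roots. 2 * c w * lin b w)" for b
      proof -
        have "(\<Sum>w\<in>roots. 2 * c w * lin b w) = 2 * (\<Sum>w\<in>roots. lin b w * c w)"
          by (simp add: sum_distrib_left mult_ac)
        then show ?thesis unfolding lin_c by simp
      qed
      moreover have "(\<Sum>w\<in>roots. 2 * c w) = 8 * \<kappa>"
        using sum_c[of "\<lambda>_. 1"] by (simp add: sum_distrib_left[symmetric] \<kappa>_def)
      ultimately show ?thesis unfolding codeL_def codeK_def by auto
    qed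
    then have "4 dvd (\<Sum>w\<in>roots. z w * (2 * c w))" by (rule test[of _ "\<lambda>_. 0"]) (simp add: resid_def)
    also have "(\<Sum>w\<in>roots. z w * (2 * c w)) = 2 * (\<Sum>w\<in>roots. z w * c w)"
      by (simp add: sum_distrib_left mult_ac)
    also have "(\<Sum>w\<in>roots. z w * c w) = z v + (\<Sum>j<6. z (simple j) * v ! j) + \<kappa> * t"
      unfolding sum_c t_def ..
    finally have "even (z v + (\<Sum>j<6. z (simple j) * v ! j) + \<kappa> * t)" unfolding dvd_double_iff .
    moreover have "lin a v = (\<Sum>j<6. z (simple j) * v ! j) + t * (\<Sum>j<6. v ! j)"
      by (simp add: lin_def a_def algebra_simps sum.distrib sum_distrib_left)
    ultimately show ?thesis unfolding \<kappa>_def by (simp add: algebra_simps)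
  qed
  have "even (\<Sum>v\<in>roots. z v - lin a v - t)" by (rule dvd_sum) (use r in auto)
  moreover have "even (sum (lin a) roots)" using sum_lin_dvd[of a] by presburger
  ultimately have "even (sum z roots)" by (simp add: sum_subtractf card_roots)
  moreover have "codeK z" unfolding codeK_def resid_def using r lin by blast
  ultimately show ?thesis using yz by blast
qed

lemma inner_lattice36_Ints: "codeL x \<Longrightarrow> codeL y \<Longrightarrow> half_vec x \<bullet> half_vec y \<in> \<int>"
proof -
  assume xy: "codeL x" "codeL y"
  then obtain a t b s where r: "resid a t x" "resid b s y" by (auto simp: codeL_def codeK_def)
  have "4 dvd ((\<Sum>v\<in>roots. x v * y v) - s * sum x roots - t * sum y roots)"
    by (rule codeK_inner) (use xy r in \<open>auto simp: codeL_def\<close>)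
  moreover have "4 dvd s * sum x roots" "4 dvd t * sum y roots" using xy by (auto simp: codeL_def)
  ultimately have "4 dvd (\<Sum>v\<in>roots. x v * y v)" by (simp add: dvd_diff_left_iff)
  then show ?thesis unfolding inner_half_vec div_4_Ints .
qed

lemma dual_lattice36: "dual_lattice lattice36 = lattice36"
proof (intro set_eqI iffI)
  fix y assume "y \<in> lattice36"
  then show "y \<in> dual_lattice lattice36" unfolding dual_lattice_def lattice36_def using inner_lattice36_Ints by auto
next
  fix y assume "y \<in> dual_lattice lattice36"
  then have y: "y \<bullet> half_vec x \<in> \<int>" if "codeL x" for x using that unfolding dual_lattice_def lattice36_def by auto
  then obtain z where z: "y = half_vec z" "codeK z" using codeK_test[of y] by auto
  have "4 dvd (\<Sum>v\<in>roots. z v * 1)"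
    using y[OF codeL_one] unfolding z inner_half_vec div_4_Ints .
  then show "y \<in> lattice36" using z by (simp add: codeL_def)
qed

lemma codeL_zero: "codeL (\<lambda>_. 0)"
  using codeL_diff[OF codeL_one codeL_one] by simp

lemma unimodular_lattice36: "unimodular lattice36"
proof -
  have "is_lattice lattice36"
  proof (rule is_lattice_half_integral)
    have "half_vec (\<lambda>_. 0) \<in> lattice36" using codeL_zero by simp
    then show "0 \<in> lattice36" by (simp add: half_vec_def vecr_def zero_vec_def)
    show "x - y \<in> lattice36" if xy: "x \<in> lattice36" "y \<in> lattice36" for x y
    proof -
      obtain x' y' where "x = half_vec x'" "codeL x'" "y = half_vec y'" "codeL y'" using xy by (auto simp: lattice36_def)
      then show ?thesis using codeL_diff[of x' y'] by (simp add: half_vec_diff)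
    qed
    show "axis i 2 \<in> lattice36" for i :: 36
    proof -
      have "axis i 2 = half_vec (\<lambda>w. if w = root_of i then 4 else 0)"
        by (simp add: half_vec_def vecr_def axis_def vec_eq_iff) (metis idx_root_of)
      then show ?thesis using codeL_unit by simp
    qed
    show "\<exists>k::int. 2 * x $ i = of_int k" if "x \<in> lattice36" for x i
      using that by (auto simp: lattice36_def half_vec_def vecr_def)
  qed
  then show ?thesis by (simp add: unimodular_def dual_lattice36)
qed

lemma even_norm_half_vec:
  assumes "codeL x"
  shows "even_norm (half_vec x) \<longleftrightarrow> (\<exists>a. resid a 0 x)"
proof -
  have 8: "even_norm (half_vec x) \<longleftrightarrow> 8 dvd (\<Sum>v\<in>roots. x v * x v)"
  proof -
    have "half_vec x \<bullet> half_vec x = 2 * of_int k \<longleftrightarrow> (\<Sum>v\<in>roots. x v * x v) = 8 * k" for k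
    proof -
      have "half_vec x \<bullet> half_vec x = 2 * of_int k \<longleftrightarrow> real_of_int (\<Sum>v\<in>roots. x v * x v) = of_int (8 * k)"
        unfolding inner_half_vec by simp
      then show ?thesis unfolding of_int_eq_iff .
    qed
    then show ?thesis unfolding even_norm_def dvd_def by simp
  qed
  obtain b t where r: "resid b t x" using assms by (auto simp: codeL_def codeK_def)
  show ?thesis
  proof
    assume "\<exists>a. resid a 0 x"
    then show "even_norm (half_vec x)" using codeL_norm[OF assms] 8 by fastforce
  next
    assume "even_norm (half_vec x)"
    then have "8 dvd (4 * (t * t))" using codeL_norm[OF assms r] unfolding 8 by (metis dvd_diff_right_iff)
    then have "even (t * t)" unfolding dvd_double_iff .
    then have "even t" by simp
    then have "resid b 0 x" using r by (auto simp: resid_def)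
    then show "\<exists>a. resid a 0 x" by blast
  qed
qed

lemma odd_unimodular_lattice36: "odd_unimodular lattice36"
proof -
  have "half_vec (\<lambda>_. 1) \<in> lattice36" using codeL_one by simp
  moreover have "\<not> even_norm (half_vec (\<lambda>_. 1))"
  proof
    assume "even_norm (half_vec (\<lambda>_. 1))"
    then obtain k :: int where "9 = 2 * real_of_int k" by (auto simp: even_norm_def inner_half_vec card_roots)
    then have "real_of_int 9 = of_int (2 * k)" by simp
    then show False unfolding of_int_eq_iff by presburger
  qed
  ultimately show ?thesis using unimodular_lattice36 by (auto simp: odd_unimodular_def even_unimodular_def)
qed

lemma min_norm_lattice36: "min_norm lattice36 = 4"
  unfolding min_norm_def least_norm_def
proof (rule Least_equality)
  let ?x = "\<lambda>w. if w = simple 0 then 4 else 0 :: int"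
  have n: "half_vec ?x \<bullet> half_vec ?x = 4"
    unfolding inner_half_vec using simple_root[of 0] by (simp add: if_distrib[of "\<lambda>x. x * x"] cong: if_cong)
  moreover have "half_vec ?x \<in> lattice36" using codeL_unit by simp
  ultimately show "\<exists>x\<in>lattice36 - {0}. 4 = x \<bullet> x" by (metis DiffI inner_zero_left singletonD zero_neq_numeral)
  fix r assume "\<exists>x\<in>lattice36 - {0}. r = x \<bullet> x"
  then obtain x where x: "codeL x" "half_vec x \<noteq> 0" "r = half_vec x \<bullet> half_vec x" by (auto simp: lattice36_def)
  have "\<exists>v\<in>roots. x v \<noteq> 0"
  proof (rule ccontr)
    assume "\<not> ?thesis"
    then have "half_vec x = half_vec (\<lambda>_. 0)" by (simp add: half_vec_eq_iff)
    then show False using x(2) by (simp add: half_vec_def vecr_def zero_vec_def)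
  qed
  then have "16 \<le> (\<Sum>v\<in>roots. x v * x v)" by (rule codeL_min[OF x(1)])
  then have "real_of_int 16 \<le> of_int (\<Sum>v\<in>roots. x v * x v)" by (simp only: of_int_le_iff)
  then show "4 \<le> r" unfolding x(3) inner_half_vec by simp
qed

lemma kissing_lattice36: "kissing_number lattice36 = 42840"
proof -
  have norm: "half_vec x \<bullet> half_vec x = 4 \<longleftrightarrow> (\<Sum>v\<in>roots. x v * x v) = 16" for x
  proof -
    have "half_vec x \<bullet> half_vec x = 4 \<longleftrightarrow> real_of_int (\<Sum>v\<in>roots. x v * x v) = of_int 16" unfolding inner_half_vec by simp
    then show ?thesis unfolding of_int_eq_iff .
  qed
  have "{x \<in> lattice36. x \<bullet> x = 4} = half_vec ` min_codewords"
  proof (intro set_eqI iffI)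
    fix y assume "y \<in> {x \<in> lattice36. x \<bullet> x = 4}"
    then obtain x where x: "y = half_vec x" "codeL x" "half_vec x \<bullet> half_vec x = 4" by (auto simp: lattice36_def)
    let ?x = "\<lambda>v. if v \<in> roots then x v else 0"
    have "half_vec ?x = half_vec x" by (simp add: half_vec_eq_iff)
    moreover have "codeL ?x" using x(2) codeL_cong[of ?x x] by simp
    ultimately show "y \<in> half_vec ` min_codewords"
      using x norm[of ?x] by (intro image_eqI[of _ _ ?x]) (auto simp: min_codewords_def)
  qed (auto simp: min_codewords_def norm)
  moreover have "inj_on half_vec min_codewords"
    by (rule inj_onI) (auto simp: min_codewords_def half_vec_eq_iff fun_eq_iff)
  ultimately show ?thesis by (simp add: kissing_number_def min_norm_lattice36 card_image card_min_codewords)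
qed

section \<open>The even sublattice and the shadow\<close>

lemma even_sublattice_lattice36: "even_sublattice lattice36 = {half_vec x | x. codeL x \<and> (\<exists>a. resid a 0 x)}"
  unfolding even_sublattice_def lattice36_def using even_norm_half_vec by auto

lemma shadow_lattice36: "lattice_shadow lattice36 = {half_vec x | x. codeS x}"
proof (intro set_eqI iffI)
  fix y assume "y \<in> lattice_shadow lattice36"
  then have y: "y \<notin> lattice36" "\<And>x a. codeL x \<Longrightarrow> resid a 0 x \<Longrightarrow> y \<bullet> half_vec x \<in> \<int>"
    unfolding lattice_shadow_def dual_lattice_def even_sublattice_lattice36 by auto
  then obtain z where z: "y = half_vec z" "codeK z" "even (sum z roots)" using codeK_test[of y] by blast
  then have "codeS z" using y(1) by (auto simp: codeS_def codeL_def)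
  then show "y \<in> {half_vec x | x. codeS x}" using z by blast
next
  fix y assume "y \<in> {half_vec x | x. codeS x}"
  then obtain z where z: "y = half_vec z" "codeS z" by blast
  have "half_vec z \<bullet> half_vec x \<in> \<int>" if x: "codeL x" "resid a 0 x" for x a
  proof -
    obtain b s where r: "resid b s z" using z by (auto simp: codeS_def codeK_def)
    have "4 dvd ((\<Sum>v\<in>roots. z v * x v) - 0 * sum z roots - s * sum x roots)"
      by (rule codeK_inner[OF _ _ r x(2)]) (use z x in \<open>auto simp: codeS_def codeL_def\<close>)
    moreover have "4 dvd s * sum x roots" using x by (auto simp: codeL_def)
    ultimately have "4 dvd (\<Sum>v\<in>roots. z v * x v)" by (simp add: dvd_diff_left_iff)
    then show ?thesis unfolding inner_half_vec div_4_Ints .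
  qed
  moreover have "half_vec z \<notin> lattice36" using z by (simp add: codeS_def codeL_def)
  ultimately show "y \<in> lattice_shadow lattice36"
    unfolding lattice_shadow_def dual_lattice_def even_sublattice_lattice36 z(1) by auto
qed

lemma half_vec_shadow [simp]: "half_vec x \<in> lattice_shadow lattice36 \<longleftrightarrow> codeS x"
  unfolding shadow_lattice36 using half_vec_eq_iff codeS_cong by blast

lemma norm_3_iff: "half_vec x \<bullet> half_vec x = 3 \<longleftrightarrow> (\<Sum>v\<in>roots. x v * x v) = 12"
proof -
  have "half_vec x \<bullet> half_vec x = 3 \<longleftrightarrow> real_of_int (\<Sum>v\<in>roots. x v * x v) = of_int 12" unfolding inner_half_vec by simp
  then show ?thesis unfolding of_int_eq_iff .
qed

lemma codeS_line:
  assumes "u \<in> roots" "v \<in> roots" "w \<in> roots" "even3 u v w"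
  shows "codeS (signed {u, v, w} (\<lambda>_. 2) N)"
    and "(\<Sum>x\<in>roots. signed {u, v, w} (\<lambda>_. 2) N x * signed {u, v, w} (\<lambda>_. 2) N x) = 12"
proof -
  note d = line_distinct[OF assms]
  have "{x \<in> roots. odd (signed {u, v, w} (\<lambda>_. 1) N x)} = {u, v, w}"
    using assms by (auto simp: signed_def)
  moreover have "even (\<Sum>x\<in>{u, v, w}. x ! j)" if "j < 6" for j
    using assms that even3_iff[of u v w] d length_root by (simp add: add.assoc)
  ultimately have "codeS (\<lambda>x. 2 * signed {u, v, w} (\<lambda>_. 1) N x)"
    unfolding codeS_double using d by simp
  moreover have "(\<lambda>x. 2 * signed {u, v, w} (\<lambda>_. 1) N x) = signed {u, v, w} (\<lambda>_. 2) N"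
    by (auto simp: signed_def)
  ultimately show "codeS (signed {u, v, w} (\<lambda>_. 2) N)" by simp
  show "(\<Sum>x\<in>roots. signed {u, v, w} (\<lambda>_. 2) N x * signed {u, v, w} (\<lambda>_. 2) N x) = 12"
    by (subst sum_square_signed) (use assms d in auto)
qed

lemma sigma_lattice36: "lattice_sigma lattice36 = 12"
proof -
  have "(LEAST r. \<exists>x\<in>lattice_shadow lattice36. r = x \<bullet> x) = 3"
  proof (rule Least_equality)
    obtain u w where "u \<in> roots" "w \<in> roots" "even3 (simple 0) u w"
      using line_through[OF simple_root[of 0]] by auto
    then have "codeS (signed {simple 0, u, w} (\<lambda>_. 2) {})"
      "half_vec (signed {simple 0, u, w} (\<lambda>_. 2) {}) \<bullet> half_vec (signed {simple 0, u, w} (\<lambda>_. 2) {}) = 3"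
      unfolding norm_3_iff using codeS_line simple_root[of 0] by auto
    then show "\<exists>x\<in>lattice_shadow lattice36. 3 = x \<bullet> x" by (metis half_vec_shadow)
    fix r assume "\<exists>x\<in>lattice_shadow lattice36. r = x \<bullet> x"
    then obtain x where x: "codeS x" "r = half_vec x \<bullet> half_vec x" by (auto simp: shadow_lattice36)
    have "real_of_int 12 \<le> of_int (\<Sum>v\<in>roots. x v * x v)"
      using codeS_min(1)[OF x(1)] by (simp only: of_int_le_iff)
    then show "3 \<le> r" unfolding x(2) inner_half_vec by simp
  qed
  then show ?thesis by (simp add: lattice_sigma_def least_norm_def)
qed

subsection \<open>Automorphisms are monomial\<close>

lemma vec_mult_transpose:
  fixes A :: "real ^ 'n ^ 'n"
  assumes "orthogonal_matrix A"
  shows "(x v* A) v* transpose A = x" "(x v* transpose A) v* A = x"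
  using assms unfolding vector_matrix_mul_assoc orthogonal_matrix_def by simp_all

lemma inner_vec_mult:
  fixes A :: "real ^ 'n ^ 'n"
  assumes "orthogonal_matrix A"
  shows "(x v* A) \<bullet> (y v* A) = x \<bullet> y"
  using vec_mult_transpose(1)[OF assms, of y] unfolding dot_lmul_matrix vector_transpose_matrix by simp

lemma inner_vec_mult_left:
  fixes A :: "real ^ 'n ^ 'n"
  shows "(x v* A) \<bullet> y = x \<bullet> (y v* transpose A)"
  by (simp add: dot_lmul_matrix)

lemma matrix_eq_vec_mult:
  fixes A B :: "real ^ 'n ^ 'm"
  assumes "\<And>x. x v* A = x v* B"
  shows "A = B"
proof -
  have "transpose A *v x = transpose B *v x" for x using assms by simp
  then have "transpose A = transpose B" unfolding matrix_eq by blast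
  then show ?thesis by (metis transpose_transpose)
qed

lemma lattice_autI:
  assumes "orthogonal_matrix A" "\<And>x. x \<in> L \<Longrightarrow> x v* A \<in> L" "\<And>x. x \<in> L \<Longrightarrow> x v* transpose A \<in> L"
  shows "A \<in> lattice_aut L"
proof -
  have "x \<in> (\<lambda>x. x v* A) ` L" if "x \<in> L" for x
    using assms(3)[OF that] vec_mult_transpose(2)[OF assms(1), of x] by (metis image_eqI)
  then show ?thesis using assms(1,2) unfolding lattice_aut_def by blast
qed

lemma lattice_autD:
  assumes "A \<in> lattice_aut L"
  shows "orthogonal_matrix A" "x \<in> L \<Longrightarrow> x v* A \<in> L" "x \<in> L \<Longrightarrow> x v* transpose A \<in> L"
proof -
  show o: "orthogonal_matrix A" using assms by (simp add: lattice_aut_def)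
  have im: "(\<lambda>x. x v* A) ` L = L" using assms by (simp add: lattice_aut_def)
  then show "x \<in> L \<Longrightarrow> x v* A \<in> L" by blast
  assume "x \<in> L"
  then obtain y where "x = y v* A" "y \<in> L" using im by blast
  then show "x v* transpose A \<in> L" using vec_mult_transpose(1)[OF o, of y] by simp
qed

lemma lattice_aut_transpose: "A \<in> lattice_aut L \<Longrightarrow> transpose A \<in> lattice_aut L"
  using lattice_autD[of A L] by (intro lattice_autI) (auto simp del: vector_transpose_matrix)

lemma lattice_aut_mult:
  assumes "A \<in> lattice_aut L" "B \<in> lattice_aut L"
  shows "A ** B \<in> lattice_aut L"
proof (rule lattice_autI)
  show "orthogonal_matrix (A ** B)" using assms lattice_autD(1) orthogonal_matrix_mul by blast
  show "x v* (A ** B) \<in> L" if "x \<in> L" for x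
    using lattice_autD(2)[OF assms(2) lattice_autD(2)[OF assms(1) that]] by (simp add: vector_matrix_mul_assoc)
  show "x v* transpose (A ** B) \<in> L" if "x \<in> L" for x
    unfolding matrix_transpose_mul vector_matrix_mul_assoc[symmetric]
    using lattice_autD(3)[OF assms(1) lattice_autD(3)[OF assms(2) that]] .
qed

lemma lattice_aut_shadow:
  assumes A: "A \<in> lattice_aut L" and s: "s \<in> lattice_shadow L"
  shows "s v* A \<in> lattice_shadow L"
proof -
  have o: "orthogonal_matrix (transpose A)" using lattice_autD(1)[OF A] by simp
  have "(s v* A) \<bullet> y \<in> \<int>" if y: "y \<in> even_sublattice L" for y
  proof -
    have "y v* transpose A \<in> even_sublattice L"
      using y lattice_autD(3)[OF A] inner_vec_mult[OF o]
      unfolding even_sublattice_def even_norm_def by (simp del: vector_transpose_matrix)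
    then show ?thesis
      using s unfolding inner_vec_mult_left lattice_shadow_def dual_lattice_def by blast
  qed
  moreover have "s v* A \<notin> L"
    using s lattice_autD(3)[OF A, of "s v* A"] vec_mult_transpose(1)[OF lattice_autD(1)[OF A], of s]
    unfolding lattice_shadow_def by auto
  ultimately show ?thesis unfolding lattice_shadow_def dual_lattice_def by blast
qed

text \<open>This property is preserved by all automorphisms and singles out the vectors \<open>\<plusminus>2e\<^sub>v\<close>.\<close>

definition frame_vec :: "real ^ 36 \<Rightarrow> bool" where
  "frame_vec y \<longleftrightarrow> y \<bullet> y = 4 \<and>
     (\<forall>s\<in>lattice_shadow lattice36. s \<bullet> s = 3 \<longrightarrow> (\<exists>k::int. y \<bullet> s = 2 * of_int k))"

lemma frame_vec_aut:
  assumes A: "A \<in> lattice_aut lattice36" and y: "frame_vec y"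
  shows "frame_vec (y v* A)"
proof -
  note o = lattice_autD(1)[OF A]
  have "\<exists>k::int. (y v* A) \<bullet> s = 2 * of_int k" if s: "s \<in> lattice_shadow lattice36" "s \<bullet> s = 3" for s
  proof -
    have "s v* transpose A \<in> lattice_shadow lattice36"
      by (rule lattice_aut_shadow[OF lattice_aut_transpose[OF A] s(1)])
    moreover have "(s v* transpose A) \<bullet> (s v* transpose A) = 3"
      using inner_vec_mult[of "transpose A" s s] o s(2) by (simp del: vector_transpose_matrix)
    ultimately show ?thesis using y unfolding inner_vec_mult_left[of y A s] frame_vec_def by blast
  qed
  then show ?thesis using y inner_vec_mult[OF o] unfolding frame_vec_def by simp
qed

lemma coord_half_vec: "v \<in> roots \<Longrightarrow> coord (half_vec x) v = of_int (x v) / 2"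
  by (simp add: half_vec_def)

lemma norm_unit_vec: "v \<in> roots \<Longrightarrow> unit_vec v \<bullet> unit_vec v = 1"
  using inner_unit_vec[of v "unit_vec v"] by (simp add: unit_vec_def)

lemma coord_unit_vec: "w \<in> roots \<Longrightarrow> coord (unit_vec v) w = (if w = v then 1 else 0)"
  by (simp add: unit_vec_def)

lemma coord_scale: "coord (c *\<^sub>R y) v = c * coord y v"
  by (simp add: coord_def)

lemma coord_eqI: "(\<And>v. v \<in> roots \<Longrightarrow> coord x v = coord y v) \<Longrightarrow> x = y"
  using vecr_eq_iff[of "coord x" "coord y"] by simp

lemma frame_vec_unit:
  assumes "v \<in> roots" "e = 1 \<or> e = - 1"
  shows "frame_vec ((2 * e) *\<^sub>R unit_vec v)"
proof -
  have "\<exists>k::int. ((2 * e) *\<^sub>R unit_vec v) \<bullet> s = 2 * of_int k"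
    if s: "s \<in> lattice_shadow lattice36" "s \<bullet> s = 3" for s
  proof -
    obtain z where z: "s = half_vec z" "codeS z" using s(1) by (auto simp: shadow_lattice36)
    have "even (z v)" by (rule codeS_min(2)[OF z(2) _ assms(1)]) (use s(2) z(1) norm_3_iff in simp)
    then obtain k where k: "z v = 2 * k" by blast
    have "s \<bullet> unit_vec v = of_int k" unfolding z(1)
      using inner_unit_vec[OF assms(1), of "half_vec z"] coord_half_vec[OF assms(1), of z] k by simp
    then have "((2 * e) *\<^sub>R unit_vec v) \<bullet> s = 2 * (e * of_int k)" by (simp add: inner_commute)
    then show ?thesis using assms(2) by (metis mult_1 mult_minus_left of_int_minus)
  qed
  then show ?thesis using assms norm_unit_vec[OF assms(1)] unfolding frame_vec_def by auto
qed

text \<open>Changing one sign in a shadow vector on a triple changes the inner product by twice a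
  coordinate of \<open>y\<close>, so the coordinates are integers. They have even sum on every
  triple and hence form a linear function modulo 2; a nonzero one would force norm at least 16. So
  all are even, and norm 4 leaves a single entry 2 or -2.\<close>

lemma frame_vec_cases:
  assumes y: "frame_vec y"
  shows "\<exists>v\<in>roots. \<exists>e. (e = 1 \<or> e = - 1) \<and> y = (2 * e) *\<^sub>R unit_vec v"
proof -
  have test: "\<exists>k::int. y \<bullet> half_vec (signed {u, v, w} (\<lambda>_. 2) N) = 2 * of_int k"
    if "u \<in> roots" "v \<in> roots" "w \<in> roots" "even3 u v w" for u v w N
  proof -
    have "half_vec (signed {u, v, w} (\<lambda>_. 2) N) \<in> lattice_shadow lattice36"
      "half_vec (signed {u, v, w} (\<lambda>_. 2) N) \<bullet> half_vec (signed {u, v, w} (\<lambda>_. 2) N) = 3"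
      unfolding norm_3_iff half_vec_shadow by (rule codeS_line[OF that])+
    then show ?thesis using y unfolding frame_vec_def by blast
  qed
  have val: "y \<bullet> half_vec (signed {u, v, w} (\<lambda>_. 2) N)
      = (\<Sum>x\<in>{u, v, w}. if x \<in> N then - coord y x else coord y x)"
    if "u \<in> roots" "v \<in> roots" "w \<in> roots" for u v w N
  proof -
    have "y \<bullet> half_vec (signed {u, v, w} (\<lambda>_. 2) N)
        = (\<Sum>x\<in>roots. coord y x * of_int (signed {u, v, w} (\<lambda>_. 2) N x) / 2)"
      by (simp add: inner_coord_half_vec sum_divide_distrib)
    also have "\<dots> = (\<Sum>x\<in>{u, v, w}. if x \<in> N then - coord y x else coord y x)"
      by (rule sum.mono_neutral_cong_right) (use that in \<open>auto simp: signed_def\<close>)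
    finally show ?thesis .
  qed
  have "\<exists>k::int. coord y v = of_int k" if v: "v \<in> roots" for v
  proof -
    obtain u w where l: "u \<in> roots" "w \<in> roots" "even3 v u w" using line_through[OF v] by blast
    note d = line_distinct[OF v l]
    obtain k where k: "y \<bullet> half_vec (signed {v, u, w} (\<lambda>_. 2) {}) = 2 * of_int k" using test[OF v l] by blast
    obtain k' where k': "y \<bullet> half_vec (signed {v, u, w} (\<lambda>_. 2) {v}) = 2 * of_int k'" using test[OF v l] by blast
    have "2 * coord y v = 2 * of_int k - 2 * of_int k'"
      using k k' d unfolding val[OF v l(1,2)] by simp
    then have "coord y v = of_int (k - k')" by simp
    then show ?thesis by blast
  qed
  then obtain n where n: "\<And>v. v \<in> roots \<Longrightarrow> coord y v = real_of_int (n v)" by metis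
  have line: "even (n u + n v + n w)" if l: "u \<in> roots" "v \<in> roots" "w \<in> roots" "even3 u v w" for u v w
  proof -
    note d = line_distinct[OF l]
    obtain k where k: "y \<bullet> half_vec (signed {u, v, w} (\<lambda>_. 2) {}) = 2 * of_int k" using test[OF l] by blast
    then have "real_of_int (n u + n v + n w) = of_int (2 * k)"
      unfolding val[OF l(1-3)] using d n l by simp
    then show ?thesis unfolding of_int_eq_iff by simp
  qed
  define a where "a j = n (simple j)" for j
  have "even (n v - lin a v)" if "v \<in> roots" for v
    using that
  proof (induction v rule: root_induct)
    case (simple k)
    then show ?case by (simp add: lin_simple a_def)
  next
    case (line u v w)
    have "even (lin a u + lin a v + lin a w)" using line length_root even3_lin by blast
    moreover have "even (n u + n v + n w)" using line \<open>\<And>u v w. \<lbrakk>u \<in> roots; v \<in> roots; w \<in> roots; even3 u v w\<rbrakk> \<Longrightarrow> even (n u + n v + n w)\<close> by blast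
    ultimately show ?case using line(5,6) by presburger
  qed
  then have r: "resid a 0 n" by (simp add: resid_def)
  have "y \<bullet> y = (\<Sum>v\<in>roots. coord y v * coord y v)" using inner_coord[of y "coord y"] by simp
  also have "\<dots> = (\<Sum>v\<in>roots. of_int (n v * n v))" by (rule sum.cong) (simp_all add: n)
  finally have "real_of_int (\<Sum>v\<in>roots. n v * n v) = of_int 4" using y by (simp add: frame_vec_def)
  then have n4: "(\<Sum>v\<in>roots. n v * n v) = 4" unfolding of_int_eq_iff .
  have "even (n v)" if v: "v \<in> roots" for v
  proof (rule ccontr)
    assume "odd (n v)"
    then show False
      using resid_odd_weight[OF r v] sum_square_odd_part(1)[OF finite_roots, of n] n4 by linarith
  qed
  then obtain m where m: "\<And>v. v \<in> roots \<Longrightarrow> n v = 2 * m v" using even_function_half[of n] by blast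
  have "(\<Sum>v\<in>roots. n v * n v) = 4 * (\<Sum>v\<in>roots. m v * m v)"
    unfolding sum_distrib_left by (rule sum.cong) (auto simp: m)
  then have "(\<Sum>v\<in>roots. m v * m v) = 1" using n4 by simp
  then obtain v where v: "v \<in> roots" "m v = 1 \<or> m v = - 1" "\<forall>w\<in>roots. w \<noteq> v \<longrightarrow> m w = 0"
    using sum_squares_eq_1[OF finite_roots] by blast
  have "y = (2 * real_of_int (m v)) *\<^sub>R unit_vec v"
    by (rule coord_eqI) (use v n m in \<open>auto simp: coord_scale coord_unit_vec\<close>)
  then show ?thesis using v by (intro bexI[OF _ v(1)] exI[of _ "real_of_int (m v)"]) auto
qed

lemma unit_vec_eq:
  assumes "v \<in> roots" "w \<in> roots" "e = 1 \<or> e = - 1" "e *\<^sub>R unit_vec v = e' *\<^sub>R unit_vec w"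
  shows "v = w" "e = e'"
proof -
  have "e * coord (unit_vec v) v = e' * coord (unit_vec w) v"
    using assms(4) coord_scale by metis
  then show "v = w" "e = e'" using assms coord_unit_vec by (auto split: if_splits)
qed

text \<open>For an automorphism such a root exists by the frame argument and is unique by
  \<open>unit_vec_eq\<close>. The signs are recovered separately in
  \<open>coord_frame_perm\<close>.\<close>

definition frame_perm :: "real ^ 36 ^ 36 \<Rightarrow> int list \<Rightarrow> int list" where
  "frame_perm A v = (SOME w. w \<in> roots \<and> (\<exists>e. (e = 1 \<or> e = - 1) \<and> unit_vec v v* A = e *\<^sub>R unit_vec w))"

lemma frame_perm_exists:
  assumes A: "A \<in> lattice_aut lattice36" and v: "v \<in> roots"
  shows "frame_perm A v \<in> roots \<and> (\<exists>e. (e = 1 \<or> e = - 1) \<and> unit_vec v v* A = e *\<^sub>R unit_vec (frame_perm A v))"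
proof -
  have "frame_vec (2 *\<^sub>R unit_vec v)" using frame_vec_unit[OF v, of 1] by simp
  then have "frame_vec ((2 *\<^sub>R unit_vec v) v* A)" by (rule frame_vec_aut[OF A])
  then obtain w e where w: "w \<in> roots" "e = 1 \<or> e = - 1" "(2 *\<^sub>R unit_vec v) v* A = (2 * e) *\<^sub>R unit_vec w"
    using frame_vec_cases by blast
  have "2 *\<^sub>R (unit_vec v v* A) = 2 *\<^sub>R (e *\<^sub>R unit_vec w)" using w(3) by (simp add: scaleR_vector_matrix_assoc)
  then have "unit_vec v v* A = e *\<^sub>R unit_vec w" unfolding real_vector.scale_cancel_left by simp
  then have "\<exists>w. w \<in> roots \<and> (\<exists>e. (e = 1 \<or> e = - 1) \<and> unit_vec v v* A = e *\<^sub>R unit_vec w)"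
    using w(1,2) by blast
  then show ?thesis unfolding frame_perm_def by (rule someI_ex)
qed

lemma frame_perm_root: "A \<in> lattice_aut lattice36 \<Longrightarrow> v \<in> roots \<Longrightarrow> frame_perm A v \<in> roots"
  using frame_perm_exists by blast

lemma frame_perm_eqI:
  assumes "A \<in> lattice_aut lattice36" "v \<in> roots" "w \<in> roots" "e = 1 \<or> e = - 1" "unit_vec v v* A = e *\<^sub>R unit_vec w"
  shows "frame_perm A v = w"
  using frame_perm_exists[OF assms(1,2)] assms(3-5) unit_vec_eq(1) by metis

lemma frame_perm_mult:
  assumes A: "A \<in> lattice_aut lattice36" and B: "B \<in> lattice_aut lattice36" and v: "v \<in> roots"
  shows "frame_perm (A ** B) v = frame_perm B (frame_perm A v)"
proof -
  obtain e where e: "e = 1 \<or> e = - 1" "unit_vec v v* A = e *\<^sub>R unit_vec (frame_perm A v)" using frame_perm_exists[OF A v] by blast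
  note w = frame_perm_root[OF A v]
  obtain e' where e': "e' = 1 \<or> e' = - 1" "unit_vec (frame_perm A v) v* B = e' *\<^sub>R unit_vec (frame_perm B (frame_perm A v))"
    using frame_perm_exists[OF B w] by blast
  have "unit_vec v v* (A ** B) = (e * e') *\<^sub>R unit_vec (frame_perm B (frame_perm A v))"
    unfolding vector_matrix_mul_assoc[symmetric] e(2) scaleR_vector_matrix_assoc e'(2) by simp
  then show ?thesis
    by (intro frame_perm_eqI[OF lattice_aut_mult[OF A B] v frame_perm_root[OF B w], of "e * e'"]) (use e(1) e'(1) in auto)
qed

lemma frame_perm_transpose:
  assumes A: "A \<in> lattice_aut lattice36" and v: "v \<in> roots"
  shows "frame_perm (transpose A) (frame_perm A v) = v" "frame_perm A (frame_perm (transpose A) v) = v"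
proof -
  have *: "frame_perm (transpose A) (frame_perm A v) = v" if A: "A \<in> lattice_aut lattice36" for A
  proof -
    obtain e where e: "e = 1 \<or> e = - 1" "unit_vec v v* A = e *\<^sub>R unit_vec (frame_perm A v)" using frame_perm_exists[OF A v] by blast
    have "unit_vec v = e *\<^sub>R (unit_vec (frame_perm A v) v* transpose A)"
      using vec_mult_transpose(1)[OF lattice_autD(1)[OF A], of "unit_vec v"]
      unfolding e(2) scaleR_vector_matrix_assoc by simp
    then have "e *\<^sub>R unit_vec v = (e * e) *\<^sub>R (unit_vec (frame_perm A v) v* transpose A)"
      by (metis scaleR_scaleR)
    then have "unit_vec (frame_perm A v) v* transpose A = e *\<^sub>R unit_vec v" using e(1) by auto
    then show ?thesis
      by (rule frame_perm_eqI[OF lattice_aut_transpose[OF A] frame_perm_root[OF A v] v e(1)])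
  qed
  show "frame_perm (transpose A) (frame_perm A v) = v" by (rule *[OF A])
  show "frame_perm A (frame_perm (transpose A) v) = v" using *[OF lattice_aut_transpose[OF A]] by (simp add: transpose_transpose)
qed

lemma frame_perm_bij: "A \<in> lattice_aut lattice36 \<Longrightarrow> bij_betw (frame_perm A) roots roots"
  by (rule bij_betw_byWitness[of _ "frame_perm (transpose A)"])
    (auto simp: frame_perm_transpose frame_perm_root lattice_aut_transpose)

lemma frame_perm_inj: "A \<in> lattice_aut lattice36 \<Longrightarrow> u \<in> roots \<Longrightarrow> v \<in> roots \<Longrightarrow> frame_perm A u = frame_perm A v \<Longrightarrow> u = v"
  using frame_perm_bij by (metis bij_betw_imp_inj_on inj_onD)

lemma coord_frame_perm:
  assumes A: "A \<in> lattice_aut lattice36"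
  obtains e :: "int list \<Rightarrow> int" where "\<And>v. e v = 1 \<or> e v = - 1"
    "\<And>y v. v \<in> roots \<Longrightarrow> coord (y v* A) (frame_perm A v) = of_int (e v) * coord y v"
proof -
  have "\<exists>e::int. (e = 1 \<or> e = - 1) \<and> (v \<in> roots \<longrightarrow> unit_vec v v* A = of_int e *\<^sub>R unit_vec (frame_perm A v))" for v
  proof (cases "v \<in> roots")
    case True
    then obtain e :: real where "e = 1 \<or> e = - 1" "unit_vec v v* A = e *\<^sub>R unit_vec (frame_perm A v)"
      using frame_perm_exists[OF A] by blast
    then show ?thesis by (intro exI[of _ "if e = 1 then 1 else - 1"]) auto
  qed auto
  then obtain e :: "int list \<Rightarrow> int" where e: "\<And>v. e v = 1 \<or> e v = - 1"
    "\<And>v. v \<in> roots \<Longrightarrow> unit_vec v v* A = of_int (e v) *\<^sub>R unit_vec (frame_perm A v)" by metis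
  have "coord (y v* A) (frame_perm A v) = of_int (e v) * coord y v" if v: "v \<in> roots" for y v
  proof -
    have "coord y v = (y v* A) \<bullet> (unit_vec v v* A)"
      using inner_vec_mult[OF lattice_autD(1)[OF A]] inner_unit_vec[OF v] by simp
    also have "\<dots> = of_int (e v) * coord (y v* A) (frame_perm A v)"
      using e(2)[OF v] inner_unit_vec[OF frame_perm_root[OF A v]] by simp
    finally show ?thesis using e(1)[of v] by auto
  qed
  then show thesis using that e(1) by blast
qed

text \<open>The shadow vector with entries 2 on the triple goes to a shadow vector with entries 2 or
  -2 on the image triple, and the code condition modulo 4 there says that the image roots have even
  sum.\<close>

lemma frame_perm_even3:
  assumes A: "A \<in> lattice_aut lattice36" and l: "u \<in> roots" "v \<in> roots" "w \<in> roots" "even3 u v w"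
  shows "even3 (frame_perm A u) (frame_perm A v) (frame_perm A w)"
proof -
  note d = line_distinct[OF l]
  obtain e :: "int list \<Rightarrow> int" where e: "\<And>v. e v = 1 \<or> e v = - 1"
    "\<And>y v. v \<in> roots \<Longrightarrow> coord (y v* A) (frame_perm A v) = of_int (e v) * coord y v" using coord_frame_perm[OF A] by blast
  let ?s = "signed {u, v, w} (\<lambda>_. 2) {}"
  have "half_vec ?s v* A \<in> lattice_shadow lattice36"
    by (rule lattice_aut_shadow[OF A]) (simp add: codeS_line[OF l])
  then obtain z where z: "half_vec ?s v* A = half_vec z" "codeS z" unfolding shadow_lattice36 by blast
  have zx: "z (frame_perm A x) = e x * ?s x" if "x \<in> roots" for x
  proof -
    have "real_of_int (z (frame_perm A x)) = of_int (e x * ?s x)"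
      using e(2)[OF that, of "half_vec ?s"] unfolding z(1) coord_half_vec[OF frame_perm_root[OF A that]] coord_half_vec[OF that] by simp
    then show ?thesis unfolding of_int_eq_iff .
  qed
  have "even (frame_perm A u ! j + frame_perm A v ! j + frame_perm A w ! j)" if j: "j < 6" for j
  proof -
    let ?a = "\<lambda>i. if i = j then 1 else 0 :: int"
    have "4 dvd (\<Sum>x\<in>roots. z x * lin ?a x)" using z(2) codeK_lin by (simp add: codeS_def)
    also have "(\<Sum>x\<in>roots. z x * lin ?a x) = (\<Sum>x\<in>roots. z (frame_perm A x) * lin ?a (frame_perm A x))"
      by (rule sum.reindex_bij_betw[OF frame_perm_bij[OF A], symmetric])
    also have "\<dots> = (\<Sum>x\<in>{u, v, w}. 2 * (e x * frame_perm A x ! j))"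
      by (rule sum.mono_neutral_cong_right) (use l j in \<open>auto simp: zx signed_def lin_unit\<close>)
    also have "\<dots> = 2 * (e u * frame_perm A u ! j + e v * frame_perm A v ! j + e w * frame_perm A w ! j)"
      using d by (simp add: algebra_simps)
    finally have "even (e u * frame_perm A u ! j + e v * frame_perm A v ! j + e w * frame_perm A w ! j)" unfolding dvd_double_iff .
    moreover have "even (e x * k) \<longleftrightarrow> even k" for x k using e(1)[of x] by auto
    ultimately show ?thesis by simp
  qed
  then show ?thesis using frame_perm_root[OF A] l length_root by (simp add: even3_iff)
qed

lemma adj_iff: "adj u v \<longleftrightarrow> (\<exists>w\<in>roots. even3 u v w)"
  by (simp add: adj_def list_ex_iff roots_def)

lemma frame_perm_adj:
  assumes A: "A \<in> lattice_aut lattice36" and l: "u \<in> roots" "v \<in> roots"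
  shows "adj (frame_perm A u) (frame_perm A v) \<longleftrightarrow> adj u v"
proof -
  have *: "adj (frame_perm B x) (frame_perm B y)" if "B \<in> lattice_aut lattice36" "x \<in> roots" "y \<in> roots" "adj x y" for B x y
    using that frame_perm_even3 frame_perm_root unfolding adj_iff by blast
  show ?thesis
    using *[OF A l] *[OF lattice_aut_transpose[OF A], of "frame_perm A u" "frame_perm A v"] frame_perm_root[OF A] l frame_perm_transpose[OF A]
    by auto
qed

subsection \<open>Signed involutions\<close>

text \<open>For the action on row vectors the unit vector of \<open>v\<close> goes to
  \<open>s v\<close> times that of \<open>p v\<close>. An involution with invariant signs gives a
  symmetric matrix that is its own inverse.\<close>

definition smat :: "(int list \<Rightarrow> int list) \<Rightarrow> (int list \<Rightarrow> int) \<Rightarrow> real ^ 36 ^ 36" where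
  "smat p s = (\<chi> i j. if root_of j = p (root_of i) then of_int (s (root_of i)) else 0)"

definition signed_inv :: "(int list \<Rightarrow> int list) \<Rightarrow> (int list \<Rightarrow> int) \<Rightarrow> bool" where
  "signed_inv p s \<longleftrightarrow>
    (\<forall>v\<in>roots. p v \<in> roots \<and> p (p v) = v \<and> s (p v) = s v \<and> (s v = 1 \<or> s v = - 1))"

lemma coord_smat:
  assumes "signed_inv p s" "w \<in> roots"
  shows "coord (y v* smat p s) w = of_int (s w) * coord y (p w)"
proof -
  have *: "w = p (root_of i) \<longleftrightarrow> i = idx_of (p w)" for i
    using assms by (metis idx_root_of root_of_idx root_of_root signed_inv_def)
  have "coord (y v* smat p s) w
      = (\<Sum>i\<in>UNIV. y $ i * (if i = idx_of (p w) then of_int (s (root_of i)) else 0))"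
    unfolding coord_def vector_matrix_mult_def smat_def
    by (simp add: assms(2) * mult.commute del: mult_delta_right mult_delta_left sum.delta sum.delta')
  also have "\<dots> = (\<Sum>i\<in>UNIV. if i = idx_of (p w) then of_int (s (root_of i)) * y $ i else 0)"
    by (rule sum.cong) auto
  also have "\<dots> = of_int (s w) * coord y (p w)"
    using assms by (simp add: coord_def signed_inv_def)
  finally show ?thesis .
qed

lemma smat_smat:
  assumes "signed_inv p s"
  shows "(y v* smat p s) v* smat p s = y"
proof (rule coord_eqI)
  fix v assume v: "v \<in> roots"
  then have "p v \<in> roots" "p (p v) = v" "s (p v) = s v" "s v = 1 \<or> s v = - 1"
    using assms by (auto simp: signed_inv_def)
  then show "coord ((y v* smat p s) v* smat p s) v = coord y v"
    using coord_smat[OF assms] v by auto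
qed

lemma transpose_smat:
  assumes "signed_inv p s"
  shows "transpose (smat p s) = smat p s"
proof -
  have "(root_of i = p (root_of j)) = (root_of j = p (root_of i))"
    and "root_of j = p (root_of i) \<Longrightarrow> s (root_of j) = s (root_of i)" for i j :: 36
    using assms root_of_root[of i] root_of_root[of j] unfolding signed_inv_def by metis+
  moreover have "s (p (root_of i)) = s (root_of i)" for i :: 36
    using assms by (simp add: signed_inv_def)
  ultimately show ?thesis by (simp add: transpose_def smat_def vec_eq_iff)
qed

lemma orthogonal_smat:
  assumes "signed_inv p s"
  shows "orthogonal_matrix (smat p s)"
proof -
  have "smat p s ** smat p s = mat 1"
    by (rule matrix_eq_vec_mult) (simp add: vector_matrix_mul_assoc[symmetric] smat_smat[OF assms])
  then show ?thesis by (simp add: orthogonal_matrix_def transpose_smat[OF assms])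
qed

lemma half_vec_smat: "signed_inv p s \<Longrightarrow> half_vec x v* smat p s = half_vec (\<lambda>v. s v * x (p v))"
proof (rule coord_eqI)
  fix v assume *: "signed_inv p s" "v \<in> roots"
  then have "p v \<in> roots" by (simp add: signed_inv_def)
  then show "coord (half_vec x v* smat p s) v = coord (half_vec (\<lambda>v. s v * x (p v))) v"
    using * by (simp add: coord_smat coord_half_vec)
qed

lemma unit_vec_smat:
  assumes "signed_inv p s" "v \<in> roots"
  shows "unit_vec v v* smat p s = of_int (s v) *\<^sub>R unit_vec (p v)"
proof (rule coord_eqI)
  fix w assume w: "w \<in> roots"
  have "p w = v \<longleftrightarrow> w = p v" "w = p v \<Longrightarrow> s w = s v" "p w \<in> roots"
    using assms w unfolding signed_inv_def by metis+
  then show "coord (unit_vec v v* smat p s) w = coord (of_int (s v) *\<^sub>R unit_vec (p v)) w"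
    using w by (auto simp: coord_smat[OF assms(1)] coord_unit_vec coord_scale)
qed

subsection \<open>Products of two reflections\<close>

abbreviation refl_mat :: "int list \<Rightarrow> real ^ 36 ^ 36" where
  "refl_mat r \<equiv> smat (rperm r) (rsign r)"

lemma signed_inv_refl: "r \<in> roots \<Longrightarrow> signed_inv (rperm r) (rsign r)"
  unfolding signed_inv_def using rperm_root rperm_rperm rsign_cases by blast

text \<open>Since a reflection shifts the sum of the coordinates by \<open>2 * t\<close> modulo 4, only products of
  an even number of reflections preserve the lattice.\<close>

lemma codeK_refl:
  assumes r: "r \<in> roots" and x: "codeK x" "resid a t x"
  defines "y \<equiv> \<lambda>v. rsign r v * x (rperm r v)"
  shows "codeK y" "\<exists>b. resid b t y" "4 dvd (sum y roots - sum x roots - 2 * t)"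
proof -
  have reindex: "(\<Sum>v\<in>roots. y v * g v) = (\<Sum>v\<in>roots. x v * (rsign r v * g (rperm r v)))" for g
  proof -
    have "(\<Sum>v\<in>roots. y v * g v) = (\<Sum>v\<in>roots. y (rperm r v) * g (rperm r v))"
      by (rule sum.reindex_bij_betw[OF rperm_bij[OF r], symmetric])
    also have "\<dots> = (\<Sum>v\<in>roots. x v * (rsign r v * g (rperm r v)))"
      by (rule sum.cong) (simp_all add: y_def rperm_rperm[OF r])
    finally show ?thesis .
  qed
  \<comment> \<open>The functional \<open>a\<close> composed with the reflection in
    \<open>r\<close>: the residue of \<open>y\<close> has this linear part and the same constant
    \<open>t\<close>.\<close>
  let ?b = "\<lambda>j. a j - lin a r * E6_form r ! j"
  have lin_b: "lin ?b v = lin a v - ip r v * lin a r" for v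
    unfolding lin_diff lin_scale ip_def by simp
  have "even (y v - lin ?b v - t)" if v: "v \<in> roots" for v
  proof -
    have "even (x (rperm r v) - lin a (rperm r v) - t)"
      using x(2) rperm_root[OF r v] by (simp add: resid_def)
    moreover have "lin ?b v = rsign r v * lin a (rperm r v)" unfolding lin_b lin_rperm[OF r v] ..
    ultimately show ?thesis using rsign_cases[of r v] unfolding y_def by auto
  qed
  then have res: "resid ?b t y" by (simp add: resid_def)
  then show "\<exists>b. resid b t y" by blast
  have "4 dvd (\<Sum>v\<in>roots. y v * lin c v)" for c
  proof -
    have "(\<Sum>v\<in>roots. y v * lin c v) = (\<Sum>v\<in>roots. x v * (lin c v - ip r v * lin c r))"
      unfolding reindex by (rule sum.cong) (simp_all add: lin_rperm[OF r])
    also have "\<dots> = (\<Sum>v\<in>roots. x v * lin c v) - lin c r * (\<Sum>v\<in>roots. x v * ip r v)"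
      by (simp add: right_diff_distrib sum_subtractf sum_distrib_left mult_ac)
    finally show ?thesis unfolding ip_def using codeK_lin[OF x(1)] by simp
  qed
  then show "codeK y" using res by (auto simp: codeK_def)
  have "sum y roots = (\<Sum>v\<in>roots. x v * rsign r v)" using reindex[of "\<lambda>_. 1"] by simp
  also have "\<dots> = (\<Sum>v\<in>roots. x v - 2 * (if v \<in> neg_set r then x v else 0))"
    by (rule sum.cong) (use rsign_cases in \<open>auto simp: neg_set_def\<close>)
  also have "\<dots> = sum x roots - 2 * (\<Sum>v\<in>roots. if v \<in> neg_set r then x v else 0)"
    by (simp add: sum_subtractf sum_distrib_left)
  also have "(\<Sum>v\<in>roots. if v \<in> neg_set r then x v else 0) = sum x (neg_set r)"
    by (rule sum.mono_neutral_cong_right) (auto simp: neg_set_def)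
  finally have s: "sum y roots = sum x roots - 2 * sum x (neg_set r)" .
  \<comment> \<open>Over the negated roots \<open>lin a\<close> has even sum and \<open>t\<close> is
    counted an odd number of times; this produces the shift by \<open>2 * t\<close>.\<close>
  have "even (\<Sum>v\<in>neg_set r. x v - lin a v - t)"
    by (rule dvd_sum) (use x(2) in \<open>auto simp: resid_def neg_set_def\<close>)
  then have "even (sum x (neg_set r) - int (card (neg_set r)) * t)"
    using neg_set_parity(2)[OF r, of a] by (simp add: sum_subtractf)
  then have "even (sum x (neg_set r) + t)" using neg_set_parity(1)[OF r] by auto
  then have "4 dvd 2 * (sum x (neg_set r) + t)" unfolding dvd_double_iff .
  then have "4 dvd - (2 * (sum x (neg_set r) + t))" by (simp only: dvd_minus_iff)
  moreover have "sum y roots - sum x roots - 2 * t = - (2 * (sum x (neg_set r) + t))" unfolding s by simp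
  ultimately show "4 dvd (sum y roots - sum x roots - 2 * t)" by (simp only:)
qed

text \<open>The constant \<open>t\<close> survives the first reflection, so the two shifts add up to
  \<open>4 * t\<close>.\<close>

lemma codeL_refl_refl:
  assumes "r \<in> roots" "r' \<in> roots" "codeL x"
  shows "codeL (\<lambda>v. rsign r' v * (rsign r (rperm r' v) * x (rperm r (rperm r' v))))"
proof -
  obtain a t where x: "resid a t x" "codeK x" "4 dvd sum x roots"
    using assms(3) by (auto simp: codeL_def codeK_def)
  let ?y = "\<lambda>v. rsign r v * x (rperm r v)"
  note y = codeK_refl[OF assms(1) x(2,1)]
  obtain b where b: "resid b t ?y" using y(2) by blast
  note z = codeK_refl[OF assms(2) y(1) b]
  let ?z = "\<lambda>v. rsign r' v * (rsign r (rperm r' v) * x (rperm r (rperm r' v)))"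
  have "4 dvd (sum ?z roots - sum ?y roots - 2 * t) + (sum ?y roots - sum x roots - 2 * t) + sum x roots + 4 * t"
    by (intro dvd_add z(3) y(3) x(3)) simp
  then show ?thesis using z(1) by (simp add: codeL_def)
qed

lemma refl_refl_aut:
  assumes r: "r \<in> roots" "r' \<in> roots"
  shows "refl_mat r ** refl_mat r' \<in> lattice_aut lattice36"
proof (rule lattice_autI)
  note s = signed_inv_refl[OF r(1)] signed_inv_refl[OF r(2)]
  show "orthogonal_matrix (refl_mat r ** refl_mat r')"
    by (intro orthogonal_matrix_mul orthogonal_smat s)
  show "x v* (refl_mat r ** refl_mat r') \<in> lattice36" if "x \<in> lattice36" for x
    using that codeL_refl_refl[OF r]
    by (auto simp: lattice36_def vector_matrix_mul_assoc[symmetric] half_vec_smat s)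
  show "x v* transpose (refl_mat r ** refl_mat r') \<in> lattice36" if "x \<in> lattice36" for x
    using that codeL_refl_refl[OF r(2,1)]
    unfolding matrix_transpose_mul transpose_smat[OF s(1)] transpose_smat[OF s(2)]
    by (auto simp: lattice36_def vector_matrix_mul_assoc[symmetric] half_vec_smat s)
qed

lemma frame_perm_refl_refl:
  assumes r: "r \<in> roots" "r' \<in> roots" and v: "v \<in> roots"
  shows "frame_perm (refl_mat r ** refl_mat r') v = rperm r' (rperm r v)"
proof (rule frame_perm_eqI[OF refl_refl_aut[OF r] v])
  show "rperm r' (rperm r v) \<in> roots" using rperm_root r v by blast
  show "unit_vec v v* (refl_mat r ** refl_mat r')
      = real_of_int (rsign r v * rsign r' (rperm r v)) *\<^sub>R unit_vec (rperm r' (rperm r v))"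
    unfolding vector_matrix_mul_assoc[symmetric] unit_vec_smat[OF signed_inv_refl[OF r(1)] v]
      scaleR_vector_matrix_assoc unit_vec_smat[OF signed_inv_refl[OF r(2)] rperm_root[OF r(1) v]]
    by simp
  show "real_of_int (rsign r v * rsign r' (rperm r v)) = 1
      \<or> real_of_int (rsign r v * rsign r' (rperm r v)) = - 1"
    using rsign_cases[of r v] rsign_cases[of r' "rperm r v"] by auto
qed

subsection \<open>The stabiliser chain\<close>

definition stab :: "int list set \<Rightarrow> (real ^ 36 ^ 36) set" where
  "stab B = {A \<in> lattice_aut lattice36. \<forall>b\<in>B. frame_perm A b = b}"

lemma stab_mult: "B \<subseteq> roots \<Longrightarrow> A \<in> stab B \<Longrightarrow> C \<in> stab B \<Longrightarrow> A ** C \<in> stab B"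
  by (auto simp: stab_def lattice_aut_mult frame_perm_mult subset_iff)

lemma stab_transpose:
  assumes "B \<subseteq> roots" "A \<in> stab B"
  shows "transpose A \<in> stab B"
proof -
  have "frame_perm (transpose A) b = b" if "b \<in> B" for b
    using assms that frame_perm_transpose(1)[of A b] by (auto simp: stab_def)
  then show ?thesis using assms by (auto simp: stab_def lattice_aut_transpose)
qed

lemma cands_frame_perm:
  assumes "set bs \<subseteq> roots" "b \<in> roots" "b \<notin> set bs" "A \<in> stab (set bs)"
  shows "frame_perm A b \<in> set (cands bs b)"
proof -
  have A: "A \<in> lattice_aut lattice36" "\<And>c. c \<in> set bs \<Longrightarrow> frame_perm A c = c" using assms(4) by (auto simp: stab_def)
  have "frame_perm A b \<notin> set bs"
  proof
    assume c: "frame_perm A b \<in> set bs"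
    then have "frame_perm A b = b" using frame_perm_inj[OF A(1) _ assms(2) A(2)[OF c]] assms(1) by blast
    then show False using c assms(3) by simp
  qed
  moreover have "adj (frame_perm A b) c = adj b c" if "c \<in> set bs" for c
    using frame_perm_adj[OF A(1) assms(2), of c] A(2)[OF that] assms(1) that by auto
  ultimately show ?thesis using frame_perm_root[OF A(1) assms(2)] by (auto simp: cands_def list_all_iff roots_def)
qed

text \<open>The candidates bound the orbit of \<open>b\<close> from above, and products of two
  reflections reach all of them. Multiplication by such a product \<open>h\<close> carries the
  stabiliser of \<open>b\<close> onto the fibre over \<open>y\<close>.\<close>

lemma stab_step:
  assumes bs: "set bs \<subseteq> roots" "b \<in> roots" "b \<notin> set bs"
    and hom: "homogeneous bs b n" and fin: "finite (stab (insert b (set bs)))"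
  shows "finite (stab (set bs))" "card (stab (set bs)) = n * card (stab (insert b (set bs)))"
proof -
  let ?G = "stab (set bs)"
  have sub: "{A \<in> ?G. frame_perm A b = b} = stab (insert b (set bs))" by (auto simp: stab_def)
  have tr: "\<exists>\<phi>. bij_betw \<phi> {A \<in> ?G. frame_perm A b = b} {A \<in> ?G. frame_perm A b = y}" if y: "y \<in> set (cands bs b)" for y
  proof -
    have yr: "y \<in> roots" using y by (auto simp: cands_def roots_def)
    obtain r r' where rr: "r \<in> set (fixers bs)" "r' \<in> set (fixers bs)" "rperm r y = rperm r' b"
      using hom y unfolding homogeneous_def reaches_def by (fastforce simp: list_all_iff list_ex_iff)
    then have r: "r \<in> roots" "r' \<in> roots" and fx: "\<And>c. c \<in> set bs \<Longrightarrow> rperm r c = c"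
      "\<And>c. c \<in> set bs \<Longrightarrow> rperm r' c = c"
      by (auto simp: fixers_def list_all_iff roots_def)
    \<comment> \<open>Reflections are involutions, so \<open>rperm r y = rperm r' b\<close> says
      that \<open>r'\<close> followed by \<open>r\<close> takes \<open>b\<close> to
      \<open>y\<close>.\<close>
    define h where "h = refl_mat r' ** refl_mat r"
    have h: "h \<in> ?G" "frame_perm h b = y"
      using refl_refl_aut[OF r(2,1)] frame_perm_refl_refl[OF r(2,1)] fx bs rr(3) rperm_rperm(1)[OF r(1) yr]
      unfolding stab_def h_def by auto
    have ht: "transpose h \<in> ?G" by (rule stab_transpose[OF bs(1) h(1)])
    have aut: "h \<in> lattice_aut lattice36" using h by (simp add: stab_def)
    have inv: "h ** transpose h = mat 1" "transpose h ** h = mat 1"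
      using lattice_autD(1)[OF aut] by (simp_all add: orthogonal_matrix_def)
    have "bij_betw (\<lambda>A. A ** h) {A \<in> ?G. frame_perm A b = b} {A \<in> ?G. frame_perm A b = y}"
    proof (rule bij_betw_byWitness[of _ "\<lambda>A. A ** transpose h"])
      show "(\<lambda>A. A ** h) ` {A \<in> ?G. frame_perm A b = b} \<subseteq> {A \<in> ?G. frame_perm A b = y}"
        using h stab_mult[OF bs(1)] frame_perm_mult aut bs by (auto simp: stab_def)
      have "frame_perm (transpose h) y = b" using frame_perm_transpose(1)[OF aut bs(2)] h(2) by simp
      then show "(\<lambda>A. A ** transpose h) ` {A \<in> ?G. frame_perm A b = y} \<subseteq> {A \<in> ?G. frame_perm A b = b}"
        using ht stab_mult[OF bs(1)] frame_perm_mult lattice_aut_transpose[OF aut] bs by (auto simp: stab_def)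
    qed (auto simp: matrix_mul_assoc[symmetric] inv)
    then show ?thesis by blast
  qed
  have "distinct (cands bs b)" by (simp add: cands_def root_list_distinct)
  then have n: "card (set (cands bs b)) = n"
    using hom by (simp add: homogeneous_def distinct_card)
  note T = card_transport[of "set (cands bs b)" ?G "\<lambda>A. frame_perm A b" b, OF _ cands_frame_perm[OF bs] tr]
  show "finite ?G" by (rule T(1)) (use fin sub in auto)
  show "card ?G = n * card (stab (insert b (set bs)))"
    using T(2) fin unfolding sub n by simp
qed

subsection \<open>Sign changes\<close>

definition even_products :: "int list set \<Rightarrow> bool" where
  "even_products N \<longleftrightarrow> (\<forall>j<6. \<forall>k<6. even (\<Sum>v\<in>N. v ! j * v ! k))"

lemma even_products_lin: "even_products N \<Longrightarrow> even (\<Sum>v\<in>N. lin a v * lin b v)"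
  unfolding sum_lin_lin by (intro dvd_sum, rule dvd_mult) (simp add: even_products_def)

text \<open>An integer and its square have the same parity, so the quadratic conditions contain the
  linear ones.\<close>

lemma even_products_single: "even_products N \<Longrightarrow> even (\<Sum>v\<in>N. lin a v)"
proof -
  assume "even_products N"
  then have "even (\<Sum>v\<in>N. lin a v * lin a v)" by (rule even_products_lin)
  moreover have "even (\<Sum>v\<in>N. lin a v * lin a v - lin a v)" by (rule dvd_sum) auto
  ultimately show ?thesis by (simp add: sum_subtractf)
qed

definition flip :: "int list set \<Rightarrow> int list \<Rightarrow> int" where
  "flip N v = (if v \<in> N then - 1 else 1)"

lemma sum_flip:
  assumes "N \<subseteq> roots"
  shows "(\<Sum>v\<in>roots. flip N v * g v) = sum g roots - 2 * sum g N"
proof -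
  have "(\<Sum>v\<in>roots. flip N v * g v) = (\<Sum>v\<in>roots. g v - 2 * (if v \<in> N then g v else 0))"
    by (rule sum.cong) (auto simp: flip_def)
  also have "\<dots> = sum g roots - 2 * (\<Sum>v\<in>roots. if v \<in> N then g v else 0)"
    by (simp add: sum_subtractf sum_distrib_left)
  also have "(\<Sum>v\<in>roots. if v \<in> N then g v else 0) = sum g N"
    by (rule sum.mono_neutral_cong_right) (use assms in auto)
  finally show ?thesis .
qed

lemma even_products_if_codeK:
  assumes N: "N \<subseteq> roots" and K: "\<And>a. codeK (\<lambda>v. flip N v * lin a v)"
  shows "even_products N"
  unfolding even_products_def
proof (intro allI impI)
  fix j k :: nat assume jk: "j < 6" "k < 6"
  let ?e = "\<lambda>j i. if i = j then 1 else 0 :: int"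
  have "4 dvd (\<Sum>v\<in>roots. flip N v * lin (?e j) v * lin (?e k) v)" by (rule codeK_lin[OF K])
  then have "4 dvd (\<Sum>v\<in>roots. lin (?e j) v * lin (?e k) v) - 2 * (\<Sum>v\<in>N. lin (?e j) v * lin (?e k) v)"
    by (simp only: mult.assoc sum_flip[OF N])
  then have "4 dvd 2 * (\<Sum>v\<in>N. lin (?e j) v * lin (?e k) v)"
    using sum_lin_lin_dvd[of "?e j" "?e k"] by (simp add: dvd_diff_right_iff)
  then show "even (\<Sum>v\<in>N. v ! j * v ! k)" unfolding dvd_double_iff by (simp add: lin_unit jk)
qed

text \<open>Modulo 2 the vector is affine. Its sum over \<open>N\<close>, and that of its product
  with a linear function, reduce to products of two linear functions, single linear functions and
  \<open>card N\<close>, all of them even.\<close>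

lemma codeL_flip:
  assumes N: "N \<subseteq> roots" "even_products N" and x: "codeL x"
  shows "codeL (\<lambda>v. flip N v * x v)"
proof -
  obtain a t where r: "resid a t x" using x by (auto simp: codeL_def codeK_def)
  have card: "even (card N)" using even_card_if_even_products[OF N(1)] N(2) by (simp add: even_products_def)
  have xN: "even (\<Sum>v\<in>N. x v * lin b v)" for b
  proof -
    have "even (\<Sum>v\<in>N. (x v - lin a v - t) * lin b v)"
      by (intro dvd_sum dvd_mult2) (use r N(1) in \<open>auto simp: resid_def\<close>)
    moreover have "(\<Sum>v\<in>N. (x v - lin a v - t) * lin b v)
        = (\<Sum>v\<in>N. x v * lin b v) - (\<Sum>v\<in>N. lin a v * lin b v) - t * (\<Sum>v\<in>N. lin b v)"
      by (simp add: algebra_simps sum.distrib sum_subtractf sum_distrib_left)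
    ultimately show ?thesis using even_products_lin[OF N(2), of a b] even_products_single[OF N(2), of b] by simp
  qed
  have "even (\<Sum>v\<in>N. x v - lin a v - t)" by (rule dvd_sum) (use r N(1) in \<open>auto simp: resid_def\<close>)
  then have x1: "even (sum x N)" using even_products_single[OF N(2), of a] card by (simp add: sum_subtractf)
  have "resid a t (\<lambda>v. flip N v * x v)" using r by (auto simp: resid_def flip_def)
  moreover have "4 dvd (\<Sum>v\<in>roots. flip N v * x v * lin b v)" for b
  proof -
    have "4 dvd (\<Sum>v\<in>roots. x v * lin b v)" using x codeK_lin by (simp add: codeL_def)
    moreover have "4 dvd 2 * (\<Sum>v\<in>N. x v * lin b v)" using xN unfolding dvd_double_iff .
    ultimately show ?thesis by (simp only: mult.assoc sum_flip[OF N(1)] dvd_diff)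
  qed
  moreover have "4 dvd (\<Sum>v\<in>roots. flip N v * x v)"
  proof -
    have "4 dvd 2 * sum x N" using x1 unfolding dvd_double_iff .
    then show ?thesis using x by (simp only: sum_flip[OF N(1)] dvd_diff codeL_def)
  qed
  ultimately show ?thesis unfolding codeL_def codeK_def by blast
qed

abbreviation flip_mat :: "int list set \<Rightarrow> real ^ 36 ^ 36" where
  "flip_mat N \<equiv> smat (\<lambda>v. v) (flip N)"

lemma signed_inv_flip: "signed_inv (\<lambda>v. v) (flip N)"
  by (simp add: signed_inv_def flip_def)

lemma flip_mat_aut:
  assumes "N \<subseteq> roots" "even_products N"
  shows "flip_mat N \<in> lattice_aut lattice36" "v \<in> roots \<Longrightarrow> frame_perm (flip_mat N) v = v"
proof -
  have L: "x v* flip_mat N \<in> lattice36" if "x \<in> lattice36" for x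
    using that codeL_flip[OF assms] by (auto simp: lattice36_def half_vec_smat signed_inv_flip)
  show A: "flip_mat N \<in> lattice_aut lattice36"
    by (rule lattice_autI) (use L in \<open>auto simp: orthogonal_smat signed_inv_flip transpose_smat
      simp del: vector_transpose_matrix\<close>)
  show "v \<in> roots \<Longrightarrow> frame_perm (flip_mat N) v = v"
    by (rule frame_perm_eqI[OF A _ _ _ unit_vec_smat[OF signed_inv_flip]]) (auto simp: flip_def)
qed

definition flips :: "int list set set" where
  "flips = {N \<in> Pow roots. \<forall>p\<in>monomials. even (\<Sum>v\<in>N. monomial p v)}"

lemma flips_iff: "N \<in> flips \<longleftrightarrow> N \<subseteq> roots \<and> even_products N"
proof -
  have "(\<forall>p\<in>monomials. even (\<Sum>v\<in>N. monomial p v)) \<longleftrightarrow> even_products N"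
  proof
    assume *: "\<forall>p\<in>monomials. even (\<Sum>v\<in>N. monomial p v)"
    show "even_products N" unfolding even_products_def
    proof (intro allI impI)
      fix j k :: nat assume "j < 6" "k < 6"
      then have "(j, k) \<in> monomials \<or> (k, j) \<in> monomials" by (auto simp: monomials_def)
      then show "even (\<Sum>v\<in>N. v ! j * v ! k)"
      proof
        assume "(j, k) \<in> monomials"
        from *[rule_format, OF this] show ?thesis by simp
      next
        assume "(k, j) \<in> monomials"
        from *[rule_format, OF this] show ?thesis by (simp add: mult.commute)
      qed
    qed
  qed (auto simp: even_products_def monomials_def)
  then show ?thesis by (simp add: flips_def)
qed

lemma card_flips: "card flips = 2 ^ 15"
proof -
  have fin: "finite monomials" using card_monomials by (metis card.infinite zero_neq_numeral)
  have "{c \<in> Pow monomials. \<forall>v\<in>roots. even (\<Sum>p\<in>c. monomial p v)} = {{}}"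
    using monomials_independent by auto
  moreover have "card flips * 2 ^ card monomials
      = card {c \<in> Pow monomials. \<forall>v\<in>roots. even (\<Sum>p\<in>c. monomial p v)} * 2 ^ card roots"
    unfolding flips_def by (rule card_F2_kernel[OF finite_roots fin])
  ultimately show ?thesis by (simp add: card_monomials card_roots)
qed

subsection \<open>The stabiliser of a flag consists of sign changes\<close>

abbreviation flag :: "int list list" where
  "flag \<equiv> [[1,0,0,0,0,0], [0,0,1,0,0,0], [0,0,0,1,0,0], [0,1,0,0,0,0]]"

abbreviation highest :: "int list" where
  "highest \<equiv> [1,2,3,2,1,2]"

lemma flag_simple: "flag = map simple [0, 2, 3, 1]"
  by (simp add: simple_numeral)

text \<open>Two members of a triple determine the third, so agreement spreads from the simple
  roots.\<close>

lemma line_maps_eq: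
  assumes f: "\<And>v. v \<in> roots \<Longrightarrow> f v \<in> roots" "\<And>v. v \<in> roots \<Longrightarrow> g v \<in> roots"
    "\<And>u v w. u \<in> roots \<Longrightarrow> v \<in> roots \<Longrightarrow> w \<in> roots \<Longrightarrow> even3 u v w \<Longrightarrow> even3 (f u) (f v) (f w)"
    "\<And>u v w. u \<in> roots \<Longrightarrow> v \<in> roots \<Longrightarrow> w \<in> roots \<Longrightarrow> even3 u v w \<Longrightarrow> even3 (g u) (g v) (g w)"
    and s: "\<And>k. k < 6 \<Longrightarrow> f (simple k) = g (simple k)" and v: "v \<in> roots"
  shows "f v = g v"
  using v
proof (induction v rule: root_induct)
  case (line u v w)
  then show ?case using f(1,2) f(3,4)[OF line(1-4)] line_unique by metis
qed (rule s)

text \<open>The fifth simple root is forced by its adjacencies and the sixth has two possible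
  images. Either choice fixes the whole permutation.\<close>

lemma flag_stab_cases:
  assumes "A \<in> stab (set flag)"
  shows "(\<forall>v\<in>roots. frame_perm A v = v) \<or> (\<forall>v\<in>roots. frame_perm A v = rperm highest v)"
proof -
  have A: "A \<in> lattice_aut lattice36" "\<And>b. b \<in> set flag \<Longrightarrow> frame_perm A b = b" using assms by (auto simp: stab_def)
  have sub: "set flag \<subseteq> roots" unfolding flag_simple using simple_root by auto
  note h = rperm_highest(2)
  have s: "frame_perm A (simple k) = simple k" "rperm highest (simple k) = simple k" if "k < 5" for k
  proof -
    have k: "k = 0 \<or> k = 1 \<or> k = 2 \<or> k = 3 \<or> k = 4" using that by auto
    have "frame_perm A [0,0,0,0,1,0] \<in> set (cands flag [0,0,0,0,1,0])"
      by (rule cands_frame_perm[OF sub _ _ assms]) (use simple_root[of 4] in \<open>simp_all add: simple_numeral\<close>)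
    then have "frame_perm A [0,0,0,0,1,0] = [0,0,0,0,1,0]" unfolding cands_4 by simp
    moreover have "frame_perm A [1,0,0,0,0,0] = [1,0,0,0,0,0]" "frame_perm A [0,1,0,0,0,0] = [0,1,0,0,0,0]"
      "frame_perm A [0,0,1,0,0,0] = [0,0,1,0,0,0]" "frame_perm A [0,0,0,1,0,0] = [0,0,0,1,0,0]"
      by (rule A(2); simp)+
    ultimately show "frame_perm A (simple k) = simple k" using k by (elim disjE) (simp_all add: simple_numeral)
    show "rperm highest (simple k) = simple k"
      using k rperm_highest(1) by (elim disjE) (simp_all add: simple_numeral)
  qed
  have "frame_perm A (simple 5) \<in> set (cands flag (simple 5))"
    by (rule cands_frame_perm[OF sub simple_root _ assms]) (simp_all add: simple_numeral)
  then consider "frame_perm A (simple 5) = simple 5" | "frame_perm A (simple 5) = rperm highest (simple 5)"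
    using cands_5 by (auto simp: list_all_iff simple_numeral)
  then show ?thesis
  proof cases
    case 1
    then have s6: "frame_perm A (simple k) = simple k" if "k < 6" for k using s(1)[of k] that by (cases "k = 5") auto
    have "frame_perm A v = v" if "v \<in> roots" for v
      by (rule line_maps_eq[of "frame_perm A" "\<lambda>v. v", OF frame_perm_root[OF A(1)] _ frame_perm_even3[OF A(1)]]) (use s6 that in auto)
    then show ?thesis by blast
  next
    case 2
    then have s6: "frame_perm A (simple k) = rperm highest (simple k)" if "k < 6" for k
      using s[of k] that by (cases "k = 5") auto
    have "frame_perm A v = rperm highest v" if "v \<in> roots" for v
      by (rule line_maps_eq[of "frame_perm A" "rperm highest",
            OF frame_perm_root[OF A(1)] rperm_root[OF h] frame_perm_even3[OF A(1)] rperm_even3[OF h]]) (use s6 that in auto)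
    then show ?thesis by blast
  qed
qed

text \<open>Following such an automorphism by the reflection would give a sign change of an odd set \<open>N\<close>
  of coordinates that preserves the code; the latter forces \<open>N\<close> to be even, because the
  quadratic form of the root lattice is constant on the roots.\<close>

lemma reflection_not_aut:
  assumes A: "A \<in> lattice_aut lattice36" and r: "r \<in> roots" and frame_perm: "\<And>v. v \<in> roots \<Longrightarrow> frame_perm A v = rperm r v"
  shows False
proof -
  obtain e :: "int list \<Rightarrow> int" where e: "\<And>v. e v = 1 \<or> e v = - 1"
    "\<And>y v. v \<in> roots \<Longrightarrow> coord (y v* A) (frame_perm A v) = of_int (e v) * coord y v" using coord_frame_perm[OF A] by blast
  define N where "N = {v \<in> roots. rsign r v * e v = - 1}"
  have flipN: "flip N v = rsign r v * e v" if "v \<in> roots" for v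
    using that e(1)[of v] rsign_cases[of r v] by (auto simp: flip_def N_def)
  have main: "\<exists>t y. codeL y \<and> (\<exists>a. resid a t y) \<and> (\<Sum>v\<in>roots. y v * y v) = (\<Sum>v\<in>roots. x v * x v) \<and>
      codeK (\<lambda>v. flip N v * x v) \<and> 4 dvd ((\<Sum>v\<in>roots. flip N v * x v) - sum y roots - 2 * t)"
    if x: "codeL x" for x
  proof -
    have "half_vec x v* A \<in> lattice36" using lattice_autD(2)[OF A, of "half_vec x"] x by simp
    then obtain y where y: "half_vec x v* A = half_vec y" "codeL y" unfolding lattice36_def by blast
    obtain a t where at: "resid a t y" using y(2) by (auto simp: codeL_def codeK_def)
    have yx: "y (rperm r v) = e v * x v" if v: "v \<in> roots" for v
    proof -
      have "real_of_int (y (rperm r v)) = of_int (e v * x v)"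
        using e(2)[OF v, of "half_vec x"] unfolding y(1) frame_perm[OF v] coord_half_vec[OF rperm_root[OF r v]] coord_half_vec[OF v] by simp
      then show ?thesis unfolding of_int_eq_iff .
    qed
    have eq: "rsign r v * y (rperm r v) = flip N v * x v" if "v \<in> roots" for v
      by (simp add: yx[OF that] flipN[OF that])
    have K: "codeK y" using y(2) by (simp add: codeL_def)
    have "codeK (\<lambda>v. flip N v * x v)" using codeK_refl(1)[OF r K at] codeK_cong[OF eq] by simp
    moreover have "4 dvd ((\<Sum>v\<in>roots. flip N v * x v) - sum y roots - 2 * t)"
      using codeK_refl(3)[OF r K at] by (simp add: eq cong: sum.cong)
    moreover have "(\<Sum>v\<in>roots. y v * y v) = (\<Sum>v\<in>roots. x v * x v)"
    proof -
      have "(\<Sum>v\<in>roots. y v * y v) = (\<Sum>v\<in>roots. y (rperm r v) * y (rperm r v))"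
        by (rule sum.reindex_bij_betw[OF rperm_bij[OF r], symmetric])
      also have "\<dots> = (\<Sum>v\<in>roots. x v * x v)"
      proof (rule sum.cong)
        fix v assume v: "v \<in> roots"
        show "y (rperm r v) * y (rperm r v) = x v * x v" unfolding yx[OF v] using e(1)[of v] by auto
      qed simp
      finally show ?thesis .
    qed
    ultimately show ?thesis using y(2) at by blast
  qed
  have N: "N \<subseteq> roots" by (auto simp: N_def)
  have "even_products N" by (rule even_products_if_codeK[OF N]) (use main[OF codeL_lin] in blast)
  then have even: "even (card N)" using even_card_if_even_products[OF N] by (simp add: even_products_def)
  \<comment> \<open>Here \<open>y\<close> describes the image of the all-one vector; its norm 9 is
    odd, which makes \<open>t\<close> odd.\<close>
  obtain t y a where y: "codeL y" "resid a t y" "(\<Sum>v\<in>roots. y v * y v) = (\<Sum>v\<in>roots. 1 * 1)"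
    "4 dvd ((\<Sum>v\<in>roots. flip N v * 1) - sum y roots - 2 * t)"
    using main[OF codeL_one] by blast
  have "4 dvd sum y roots" using y(1) by (simp add: codeL_def)
  then have "4 dvd ((\<Sum>v\<in>roots. flip N v * 1) - sum y roots - 2 * t) + sum y roots"
    using y(4) by (rule dvd_add[rotated])
  then have "4 dvd (\<Sum>v\<in>roots. flip N v * 1) - 2 * t" by simp
  \<comment> \<open>With \<open>card N\<close> even and \<open>t\<close> odd this number is 2 modulo
    4, a contradiction.\<close>
  then have d: "4 dvd 36 - 2 * int (card N) - 2 * t"
    unfolding sum_flip[OF N] by (simp add: card_roots)
  have "8 dvd 36 - 4 * (t * t)" using codeL_norm[OF y(1,2)] y(3) by (simp add: card_roots)
  have "odd (t * t)"
  proof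
    assume "even (t * t)"
    then obtain m where "t * t = 2 * m" by blast
    then show False using \<open>8 dvd 36 - 4 * (t * t)\<close> by presburger
  qed
  then have "odd t" by simp
  then show False using d even by presburger
qed

lemma flag_stab: "stab (set flag) = flip_mat ` flips"
proof (intro set_eqI iffI)
  fix A assume A: "A \<in> stab (set flag)"
  then have aut: "A \<in> lattice_aut lattice36" by (simp add: stab_def)
  have id: "frame_perm A v = v" if "v \<in> roots" for v
    using flag_stab_cases[OF A] reflection_not_aut[OF aut rperm_highest(2)] that by blast
  obtain e :: "int list \<Rightarrow> int" where e: "\<And>v. e v = 1 \<or> e v = - 1"
    "\<And>y v. v \<in> roots \<Longrightarrow> coord (y v* A) (frame_perm A v) = of_int (e v) * coord y v" using coord_frame_perm[OF aut] by blast
  define N where "N = {v \<in> roots. e v = - 1}"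
  have N: "N \<subseteq> roots" by (auto simp: N_def)
  have flipN: "flip N v = e v" if "v \<in> roots" for v
    using that e(1)[of v] by (auto simp: flip_def N_def)
  have eq: "A = flip_mat N"
  proof (rule matrix_eq_vec_mult, rule coord_eqI)
    fix x v assume v: "v \<in> roots"
    then show "coord (x v* A) v = coord (x v* flip_mat N) v"
      using e(2)[OF v, of x] by (simp add: id coord_smat[OF signed_inv_flip v] flipN)
  qed
  have "codeK (\<lambda>v. flip N v * lin a v)" for a
  proof -
    have "half_vec (lin a) v* A \<in> lattice36" by (rule lattice_autD(2)[OF aut]) (simp add: codeL_lin)
    then show ?thesis unfolding eq half_vec_smat[OF signed_inv_flip] by (simp add: codeL_def)
  qed
  then have "N \<in> flips" unfolding flips_iff using N even_products_if_codeK[OF N] by blast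
  then show "A \<in> flip_mat ` flips" using eq by blast
next
  fix A assume "A \<in> flip_mat ` flips"
  then obtain N where N: "A = flip_mat N" "N \<subseteq> roots" "even_products N" unfolding flips_iff[symmetric] by (auto simp: flips_iff)
  have "set flag \<subseteq> roots" unfolding flag_simple using simple_root by auto
  then show "A \<in> stab (set flag)" using flip_mat_aut[OF N(2,3)] unfolding N(1) stab_def by blast
qed

lemma card_flag_stab: "card (stab (set flag)) = 2 ^ 15"
proof -
  have "inj_on flip_mat flips"
  proof (rule inj_onI)
    fix M N assume *: "M \<in> flips" "N \<in> flips" "flip_mat M = flip_mat N"
    have "flip M v = flip N v" if v: "v \<in> roots" for v
      using coord_smat[OF signed_inv_flip v, of "unit_vec v" M] coord_smat[OF signed_inv_flip v, of "unit_vec v" N]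
        *(3) coord_unit_vec[OF v, of v] by simp
    then have "v \<in> M \<longleftrightarrow> v \<in> N" if "v \<in> roots" for v
      using that by (fastforce simp: flip_def split: if_splits)
    then show "M = N" using * by (auto simp: flips_iff)
  qed
  then show ?thesis unfolding flag_stab by (simp add: card_image card_flips)
qed

lemma card_aut_lattice36: "card (lattice_aut lattice36) = 849346560"
proof -
  have s: "simple k \<in> roots" if "k \<in> {0,1,2,3}" for k using that simple_root by auto
  note r = s[of 0, simplified simple_numeral, simplified] s[of 1, simplified simple_numeral, simplified]
    s[of 2, simplified simple_numeral, simplified] s[of 3, simplified simple_numeral, simplified]
  have f4: "finite (stab (set flag))" using card_flag_stab card.infinite by fastforce
  have e4: "insert [0,1,0,0,0,0] (set [[1,0,0,0,0,0], [0,0,1,0,0,0], [0,0,0,1,0,0]]) = set flag" by auto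
  have e3: "insert [0,0,0,1,0,0] (set [[1,0,0,0,0,0], [0,0,1,0,0,0]])
      = set [[1,0,0,0,0,0], [0,0,1,0,0,0], [0,0,0,1,0,0::int]]" by auto
  have e2: "insert [0,0,1,0,0,0] (set [[1,0,0,0,0,0]]) = set [[1,0,0,0,0,0], [0,0,1,0,0,0::int]]" by auto
  have e1: "insert [1,0,0,0,0,0] (set []) = set [[1,0,0,0,0,0::int]]" by auto
  note c3 = stab_step[OF _ _ _ homogeneous_3, unfolded e4, OF _ _ _ f4]
  have 3: "finite (stab (set [[1,0,0,0,0,0], [0,0,1,0,0,0], [0,0,0,1,0,0]]))"
    "card (stab (set [[1,0,0,0,0,0], [0,0,1,0,0,0], [0,0,0,1,0,0]])) = 6 * card (stab (set flag))"
    by (rule c3; use r in simp)+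
  note c2 = stab_step[OF _ _ _ homogeneous_2, unfolded e3, OF _ _ _ 3(1)]
  have 2: "finite (stab (set [[1,0,0,0,0,0], [0,0,1,0,0,0]]))"
    "card (stab (set [[1,0,0,0,0,0], [0,0,1,0,0,0]]))
      = 8 * card (stab (set [[1,0,0,0,0,0], [0,0,1,0,0,0], [0,0,0,1,0,0]]))"
    by (rule c2; use r in simp)+
  note c1 = stab_step[OF _ _ _ homogeneous_1, unfolded e2, OF _ _ _ 2(1)]
  have 1: "finite (stab (set [[1,0,0,0,0,0]]))"
    "card (stab (set [[1,0,0,0,0,0]])) = 15 * card (stab (set [[1,0,0,0,0,0], [0,0,1,0,0,0]]))"
    by (rule c1; use r in simp)+
  note c0 = stab_step[OF _ _ _ homogeneous_0, unfolded e1, OF _ _ _ 1(1)]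
  have 0: "card (stab (set [])) = 36 * card (stab (set [[1,0,0,0,0,0]]))"
    by (rule c0; use r in simp)
  have eq: "lattice_aut lattice36 = stab (set [])" by (simp add: stab_def)
  show ?thesis unfolding eq 0 1(2) 2(2) 3(2) card_flag_stab by simp
qed

theorem mainTheorem7:
  shows "\<exists>L :: (real ^ 36) set.
    odd_unimodular L \<and>
    min_norm L = 4 \<and>
    kissing_number L = 42840 \<and>
    lattice_sigma L = 12 \<and>
    card (lattice_aut L) = 849346560"
  using odd_unimodular_lattice36 min_norm_lattice36 kissing_lattice36 sigma_lattice36 card_aut_lattice36 by blast

end
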